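(* Let $d,m$ be positive integers with $m>d/2$ and let $\Phi=\Phi_{m,d}$ be the Matérn kernel. If $f\in L^{2m,1}$, then there exists a constant $C_f=C(f,d,m)>0$ such that $$\mathrm{dist}(f,\mathcal{S}^h_0(\Phi_h);L_\infty)=\mathrm{dist}(f,\mathcal{S}^h(\Phi_h);L_\infty)\le C_f\,h^{2m},\qquad h\in(0,1].$$
   Context: $\|\cdot\|$ is the Euclidean norm on $\mathbb{R}^d$ and $L_\infty=L_\infty(\mathbb{R}^d)$. The Matérn kernel is $\Phi(x)=\Phi_{m,d}(x)=\|x\|^{m-d/2}K_{m-d/2}(\|x\|)$, $x\in\mathbb{R}^d$ (value at $0$ by continuity), where $K_\nu$ is the modified Bessel function of the third kind (Macdonald function) of order $\nu$. For $h>0$, $\Phi_h(x):=\Phi(hx)$, $$\mathcal{S}^h(\Phi_h)=\Big\{\sum_{j\in\mathbb{Z}^d}c_j\,\Phi_h(h^{-1}\cdot-j):\ c\in\ell_\infty(\mathbb{Z}^d)\Big\}=\Big\{\sum_{j\in\mathbb{Z}^d}c_j\,\Phi(\cdot-hj):\ c\in\ell_\infty(\mathbb{Z}^d)\Big\},$$ and $\mathcal{S}^h_0(\Phi_h)=\mathrm{span}\{\Phi_h(h^{-1}\cdot-j):j\in\mathbb{Z}^d\}$ is the space of finite linear combinations of the translates $\Phi(\cdot-hj)$, $j\in\mathbb{Z}^d$. Scalars are complex (or real throughout if $f$ is real-valued). For a set $\mathcal{A}$ of functions and a normed space $X$, $\mathrm{dist}(f,\mathcal{A};X):=\inf_{s\in\mathcal{A}}\|f-s\|_X$.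 $L^{2m,1}$ is the space of all $f\in L_1(\mathbb{R}^d)$ such that $(1+\|\cdot\|^2)^m\widehat{f}\in L_1(\mathbb{R}^d)$, where $\widehat{f}$ is the Fourier transform of $f$. *)

theory Defs
  imports "HOL-Probability.Probability"
begin

text \<open>
  Macdonald's function (modified Bessel function of the third kind) of real order
  \<open>\<nu>\<close>, for arguments \<open>r > 0\<close>, given by its integral representation, which is the
  usual definition in the literature on radial basis functions.
\<close>

definition macdonald :: "real \<Rightarrow> real \<Rightarrow> real" where
  "macdonald \<nu> r = (LBINT t:{0..}. exp (- r * cosh t) * cosh (\<nu> * t))"

text \<open>
  The kernel on \<open>\<real>\<^sup>d\<close>, with \<open>d = CARD('n)\<close>. The value at \<open>0\<close> is the continuous extension;
  the limit exists when \<open>m > d / 2\<close>.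
\<close>

definition matern :: "nat \<Rightarrow> real ^ 'n \<Rightarrow> real" where
  "matern m x =
    (let \<nu> = real m - real CARD('n) / 2;
         F = (\<lambda>y :: real ^ 'n. norm y powr \<nu> * macdonald \<nu> (norm y))
     in if x = 0 then Lim (at 0) F else F x)"

definition dilate :: "real \<Rightarrow> (real ^ 'n \<Rightarrow> real) \<Rightarrow> real ^ 'n \<Rightarrow> real" where
  "dilate h \<phi> = (\<lambda>x. \<phi> (h *\<^sub>R x))"

definition lattice_point :: "int ^ 'n \<Rightarrow> real ^ 'n" where
  "lattice_point j = (\<chi> i. real_of_int (j $ i))"

text \<open>
  The spaces \<open>S\<^sup>h(\<phi>)\<close> and \<open>S\<^sup>h\<^sub>0(\<phi>)\<close>. The parameter \<open>K\<close> is the field of scalars, either all of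
  \<open>\<complex>\<close> or the subfield \<open>\<real>\<close> of \<open>\<complex>\<close>. For the kernels used here the series over \<open>\<int>\<^sup>d\<close> converges
  absolutely at every point, since the kernel decays exponentially.
\<close>

definition shift_space ::
    "complex set \<Rightarrow> real \<Rightarrow> (real ^ 'n \<Rightarrow> real) \<Rightarrow> (real ^ 'n \<Rightarrow> complex) set" where
  "shift_space K h \<phi> =
    {(\<lambda>x. \<Sum>\<^sub>\<infinity>j\<in>UNIV. c j * complex_of_real (\<phi> (inverse h *\<^sub>R x - lattice_point j))) | c.
      range c \<subseteq> K \<and> bounded (range c)}"

definition shift_space0 ::
    "complex set \<Rightarrow> real \<Rightarrow> (real ^ 'n \<Rightarrow> real) \<Rightarrow> (real ^ 'n \<Rightarrow> complex) set" where
  "shift_space0 K h \<phi> =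
    {(\<lambda>x. \<Sum>j\<in>J. c j * complex_of_real (\<phi> (inverse h *\<^sub>R x - lattice_point j))) | J c.
      finite J \<and> c ` J \<subseteq> K}"

text \<open>
  The essential supremum norm and the induced distance take values in the extended
  reals, so that no convention is needed for unbounded functions.
\<close>

definition Linf_norm :: "(real ^ 'n \<Rightarrow> complex) \<Rightarrow> ereal" where
  "Linf_norm g = esssup lebesgue (\<lambda>x. ereal (norm (g x)))"

definition Linf_dist :: "(real ^ 'n \<Rightarrow> complex) \<Rightarrow> (real ^ 'n \<Rightarrow> complex) set \<Rightarrow> ereal" where
  "Linf_dist f A = (INF s\<in>A. Linf_norm (\<lambda>x. f x - s x))"

definition fourier :: "(real ^ 'n \<Rightarrow> complex) \<Rightarrow> real ^ 'n \<Rightarrow> complex" where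
  "fourier f \<xi> = (LINT x|lebesgue. f x * cis (- (x \<bullet> \<xi>)))"

text \<open>
  The space \<open>L\<^sup>2\<^sup>m\<^sup>,\<^sup>1\<close>; it does not depend on the normalization of the Fourier transform.
\<close>

definition L2m1 :: "nat \<Rightarrow> (real ^ 'n \<Rightarrow> complex) set" where
  "L2m1 m = {f. integrable lebesgue f \<and>
     integrable lebesgue (\<lambda>\<xi>. complex_of_real ((1 + (norm \<xi>)\<^sup>2) ^ m) * fourier f \<xi>)}"

end

theory Submission imports Defs begin

text \<open>
  The kernel is a mixture of Gaussians, hence a multiple of the Fourier transform of
  \<open>(1 + |\<xi>|\<^sup>2)\<^sup>-\<^sup>m\<close>, and it decays faster than any polynomial. By Poisson summation the combination
  of its translates along \<open>h \<int>\<^sup>d\<close> with coefficients proportional to \<open>e\<^sup>i\<^sup>h\<^sup>j\<^sup>\<xi>\<close> reproduces a plane wave of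
  frequency \<open>\<xi>\<close> in the cube \<open>|h \<xi>\<^sub>i| \<le> \<pi>\<close> up to the aliases \<open>\<xi> + 2 \<pi> k / h\<close>, whose total relative weight
  is at most a constant times \<open>(1 + |\<xi>|\<^sup>2)\<^sup>m h\<^sup>2\<^sup>m\<close>. Integrating this against the Fourier transform of \<open>f\<close> over the
  cube, and discarding the frequencies outside it at the same cost, gives an approximant with bounded
  coefficients and error of order \<open>h\<^sup>2\<^sup>m\<close>. The function \<open>f\<close> vanishes at infinity, being almost everywhere equal to
  a Lipschitz integrable function; therefore multiplying the coefficients of any element of \<open>S\<^sup>h\<close> by a
  slowly varying cutoff makes them finitely many and increases the error by an arbitrarily small amount,
  so both distances agree.
\<close>

section \<open>Gaussian integrals\<close>

text \<open>An element of \<open>shift_space\<close> need not vanish at infinity, so finite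
  combinations cannot in general come uniformly close to it. Equality of the distances therefore has
  to use the decay of \<open>f\<close>, and the cutoff is arranged pointwise: an error of at most
  \<open>\<delta>\<close> at a point becomes at most \<open>\<delta> + \<epsilon>\<close> at the
  same point, so exceptional null sets do no harm. The exponent \<open>2 * m\<close> is the decay
  exponent of the Fourier transform of the kernel. The aliases of a frequency in the cube lie at
  distance of order \<open>|k| / h\<close> from the origin, and the sum of
  \<open>|k| ^ (- 2 * m)\<close> over nonzero lattice points converges because
  \<open>2 * m > d\<close>. The same condition makes the order \<open>m - d / 2\<close> positive,
  which keeps the mixture of Gaussians integrable even at the origin of the space. As
  \<open>f\<close> is merely integrable, the inversion formula holds almost everywhere only, and the
  continuous function that it defines takes the place of \<open>f\<close> in all estimates.\<close>

lemma lborel_affine_has_integral: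
  fixes f :: "'a::euclidean_space \<Rightarrow> 'b::{banach, second_countable_topology}"
  assumes f: "integrable lborel f" and c: "c \<noteq> 0"
  shows "integrable lborel (\<lambda>x. f (t + c *\<^sub>R x))"
    and "(\<integral>x. f (t + c *\<^sub>R x) \<partial>lborel) = (1 / \<bar>c\<bar> ^ DIM('a)) *\<^sub>R (\<integral>x. f x \<partial>lborel)"
proof -
  have [measurable]: "f \<in> borel_measurable borel"
    using borel_measurable_integrable[OF f] by simp
  have "integrable (density (distr lborel borel (\<lambda>x. t + c *\<^sub>R x)) (\<lambda>_. ennreal (\<bar>c\<bar> ^ DIM('a)))) f"
    using f lborel_affine[OF c, of t] c by (simp add: ennreal_power)
  then have *: "integrable (distr lborel borel (\<lambda>x. t + c *\<^sub>R x)) (\<lambda>x. \<bar>c\<bar> ^ DIM('a) *\<^sub>R f x)"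
    by (subst (asm) integrable_density) auto
  then show 1: "integrable lborel (\<lambda>x. f (t + c *\<^sub>R x))"
    using c integrable_scaleR_right[of "1 / \<bar>c\<bar> ^ DIM('a)" lborel "\<lambda>x. \<bar>c\<bar> ^ DIM('a) *\<^sub>R f (t + c *\<^sub>R x)"]
    by (subst (asm) integrable_distr_eq) auto
  have "(\<integral>x. f x \<partial>lborel) = (\<integral>x. f x \<partial>density (distr lborel borel (\<lambda>x. t + c *\<^sub>R x)) (\<lambda>_. ennreal (\<bar>c\<bar> ^ DIM('a))))"
    using lborel_affine[OF c, of t] c by (simp add: ennreal_power)
  also have "\<dots> = (\<integral>x. \<bar>c\<bar> ^ DIM('a) *\<^sub>R f (t + c *\<^sub>R x) \<partial>lborel)"
    by (subst integral_density) (auto simp: integral_distr)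
  finally show "(\<integral>x. f (t + c *\<^sub>R x) \<partial>lborel) = (1 / \<bar>c\<bar> ^ DIM('a)) *\<^sub>R (\<integral>x. f x \<partial>lborel)"
    using c by simp
qed

lemma lborel_prod_Basis:
  fixes g :: "'a::euclidean_space \<Rightarrow> real \<Rightarrow> 'b::{real_normed_field, banach, second_countable_topology}"
  assumes g: "\<And>b. b \<in> Basis \<Longrightarrow> integrable lborel (g b)"
  shows "integrable lborel (\<lambda>x::'a. \<Prod>b\<in>Basis. g b (x \<bullet> b))"
    and "(\<integral>x. (\<Prod>b\<in>Basis. g b (x \<bullet> b)) \<partial>lborel) = (\<Prod>b\<in>Basis. \<integral>x. g b x \<partial>lborel)"
proof -
  interpret product_sigma_finite "\<lambda>b::'a. lborel :: real measure" ..
  have [measurable]: "g b \<in> borel_measurable borel"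
    if "b \<in> Basis" for b
    using borel_measurable_integrable[OF g[OF that]] by simp
  have *: "(\<Prod>b\<in>Basis. g b ((\<Sum>c\<in>Basis. f c *\<^sub>R c) \<bullet> b)) = (\<Prod>b\<in>Basis. g b (f b))" for f :: "'a \<Rightarrow> real"
    by (intro prod.cong refl) (simp add: inner_sum_left_Basis)
  have m[measurable]: "(\<lambda>f. \<Sum>b\<in>Basis. f b *\<^sub>R b) \<in> (\<Pi>\<^sub>M b\<in>(Basis::'a set). lborel) \<rightarrow>\<^sub>M borel"
    by measurable
  have m2[measurable]: "(\<lambda>x::'a. \<Prod>b\<in>Basis. g b (x \<bullet> b)) \<in> borel_measurable borel"
    by measurable
  show "integrable lborel (\<lambda>x::'a. \<Prod>b\<in>Basis. g b (x \<bullet> b))"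
    by (subst lborel_eq, subst integrable_distr_eq[OF m m2])
       (simp only: *, rule product_integrable_prod, use g in auto)
  show "(\<integral>x. (\<Prod>b\<in>Basis. g b (x \<bullet> b)) \<partial>lborel) = (\<Prod>b\<in>Basis. \<integral>x. g b x \<partial>lborel)"
    by (subst lborel_eq, subst integral_distr[OF m m2])
       (simp only: *, rule product_integral_prod, use g in auto)
qed

lemma measurable_cis [measurable]: "cis \<in> borel_measurable borel"
  by (intro borel_measurable_continuous_onI continuous_intros)

lemma measurable_complex_of_real [measurable]: "complex_of_real \<in> borel_measurable borel"
  by (intro borel_measurable_continuous_onI continuous_intros)

lemma measurable_cnj [measurable]: "cnj \<in> borel_measurable borel"
  by (intro borel_measurable_continuous_onI continuous_intros)

text \<open>The substitution with factor \<open>sqrt s\<close> reduces the integral to the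
  characteristic function of the standard normal distribution.\<close>

lemma gauss_fourier_real:
  assumes s: "s > 0"
  shows "integrable lborel (\<lambda>x. of_real (exp (- s * x\<^sup>2 / 2)) * cis (t * x))"
    and "(\<integral>x. of_real (exp (- s * x\<^sup>2 / 2)) * cis (t * x) \<partial>lborel)
         = complex_of_real (sqrt (2 * pi / s) * exp (- t\<^sup>2 / (2 * s)))"
proof -
  define r where "r = sqrt s"
  have r: "r > 0" "r\<^sup>2 = s" using s by (auto simp: r_def)
  have 1: "(\<integral>x. std_normal_density x *\<^sub>R cis (u * x) \<partial>lborel) = complex_of_real (exp (- (u^2) / 2))" for u
    using fun_cong[OF char_std_normal_distribution, of u]
    unfolding char_def by (subst (asm) integral_density) (auto simp: cis_conv_exp mult_ac)
  have 2: "integrable lborel (\<lambda>x. std_normal_density x *\<^sub>R cis (u * x))" for u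
    by (rule Bochner_Integration.integrable_bound[where f=std_normal_density])
       (auto simp: integrable_normal_density)
  have 3: "integrable lborel (\<lambda>x. std_normal_density (0 + r * x) *\<^sub>R cis ((t / r) * (0 + r * x)))"
    by (rule lborel_integrable_real_affine[OF 2]) (use r in auto)
  have 4: "std_normal_density (0 + r * x) *\<^sub>R cis ((t / r) * (0 + r * x))
      = (1 / sqrt (2 * pi)) *\<^sub>R (of_real (exp (- s * x\<^sup>2 / 2)) * cis (t * x))" for x
    using r by (simp add: std_normal_density_def power_mult_distrib scaleR_conv_of_real)
  show "integrable lborel (\<lambda>x. of_real (exp (- s * x\<^sup>2 / 2)) * cis (t * x))"
    using integrable_scaleR_right[OF 3[unfolded 4], of "sqrt (2 * pi)"] by simp
  have "complex_of_real (exp (- ((t / r)^2) / 2)) = \<bar>r\<bar> *\<^sub>R (\<integral>x. std_normal_density (0 + r * x) *\<^sub>R cis ((t / r) * (0 + r * x)) \<partial>lborel)"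
    unfolding 1[symmetric] by (rule lborel_integral_real_affine) (use r in auto)
  also have "\<dots> = (r / sqrt (2 * pi)) *\<^sub>R (\<integral>x. of_real (exp (- s * x\<^sup>2 / 2)) * cis (t * x) \<partial>lborel)"
    unfolding 4 using r by simp
  finally have "(\<integral>x. of_real (exp (- s * x\<^sup>2 / 2)) * cis (t * x) \<partial>lborel) = (sqrt (2 * pi) / r) *\<^sub>R complex_of_real (exp (- ((t / r)^2) / 2))"
    using r by (simp add: field_simps)
  then show "(\<integral>x. of_real (exp (- s * x\<^sup>2 / 2)) * cis (t * x) \<partial>lborel)
         = complex_of_real (sqrt (2 * pi / s) * exp (- t\<^sup>2 / (2 * s)))"
    using r by (simp add: scaleR_conv_of_real real_sqrt_divide r_def power_divide mult.commute)
qed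

lemma cis_sum: "cis (\<Sum>x\<in>A. f x) = (\<Prod>x\<in>A. cis (f x))"
  by (induction A rule: infinite_finite_induct) (auto simp: cis_mult[symmetric])

text \<open>Gaussian and wave both factor over the coordinates, so the one-dimensional formula
  applies in each. The parameter \<open>s\<close> is a precision; on the Fourier side it turns into
  a variance.\<close>

lemma gauss_fourier:
  fixes \<xi> :: "'a::euclidean_space"
  assumes s: "s > 0"
  shows "integrable lborel (\<lambda>x. of_real (exp (- s * (norm x)\<^sup>2 / 2)) * cis (\<xi> \<bullet> x))"
    and "(\<integral>x. of_real (exp (- s * (norm x)\<^sup>2 / 2)) * cis (\<xi> \<bullet> x) \<partial>lborel)
         = complex_of_real (sqrt (2 * pi / s) ^ DIM('a) * exp (- (norm \<xi>)\<^sup>2 / (2 * s)))"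
proof -
  have n: "(norm (x::'a))\<^sup>2 = (\<Sum>b\<in>Basis. (x \<bullet> b)\<^sup>2)" for x
    by (subst power2_norm_eq_inner, subst euclidean_inner) (simp add: power2_eq_square)
  have *: "of_real (exp (- s * (norm x)\<^sup>2 / 2)) * cis (\<xi> \<bullet> x)
      = (\<Prod>b\<in>Basis. of_real (exp (- s * (x \<bullet> b)\<^sup>2 / 2)) * cis ((\<xi> \<bullet> b) * (x \<bullet> b)))" for x
    unfolding prod.distrib cis_sum[symmetric] of_real_prod[symmetric]
    by (simp add: n exp_sum[symmetric] sum_distrib_left sum_divide_distrib sum_negf)
       (subst euclidean_inner, simp)
  show "integrable lborel (\<lambda>x. of_real (exp (- s * (norm x)\<^sup>2 / 2)) * cis (\<xi> \<bullet> x))"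
    unfolding * by (rule lborel_prod_Basis) (rule gauss_fourier_real[OF s])
  show "(\<integral>x. of_real (exp (- s * (norm x)\<^sup>2 / 2)) * cis (\<xi> \<bullet> x) \<partial>lborel)
         = complex_of_real (sqrt (2 * pi / s) ^ DIM('a) * exp (- (norm \<xi>)\<^sup>2 / (2 * s)))"
    unfolding * 
    by (subst lborel_prod_Basis, rule gauss_fourier_real[OF s], subst gauss_fourier_real[OF s])
       (simp add: prod.distrib of_real_prod[symmetric] exp_sum[symmetric] n sum_divide_distrib sum_negf
         del: of_real_prod of_real_mult)
qed

text \<open>A sum is an integral over the counting measure, so this is Fubini. Absolute summability
  at every point identifies \<open>infsum\<close> with that integral.\<close>

lemma integral_infsum:
  fixes f :: "'i::countable \<Rightarrow> 'a \<Rightarrow> 'b::{banach, second_countable_topology}"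
  assumes "sigma_finite_measure M"
    and int: "\<And>i. integrable M (f i)"
    and sum: "(\<lambda>i. \<integral>x. norm (f i x) \<partial>M) summable_on UNIV"
    and pt: "\<And>x. (\<lambda>i. norm (f i x)) summable_on UNIV"
  shows "integrable M (\<lambda>x. \<Sum>\<^sub>\<infinity>i. f i x)"
    and "(\<integral>x. (\<Sum>\<^sub>\<infinity>i. f i x) \<partial>M) = (\<Sum>\<^sub>\<infinity>i. \<integral>x. f i x \<partial>M)"
proof -
  interpret M: sigma_finite_measure M by fact
  interpret C: sigma_finite_measure "count_space (UNIV :: 'i set)"
    by (rule sigma_finite_measure_count_space_countable) simp
  interpret P: pair_sigma_finite "count_space (UNIV :: 'i set)" M ..
  have [measurable]: "f i \<in> borel_measurable M" for i using int[of i] by simp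
  have eq: "(\<integral>i. g i \<partial>count_space UNIV) = (\<Sum>\<^sub>\<infinity>i. g i)" if "(\<lambda>i. norm (g i)) summable_on UNIV"
    for g :: "'i \<Rightarrow> 'b"
    using that infsetsum_infsum[of g UNIV] by (simp add: infsetsum_def abs_summable_equivalent)
  have meas: "case_prod f \<in> borel_measurable (count_space UNIV \<Otimes>\<^sub>M M)"
    by (rule measurable_pair_measure_countable1) auto
  have "integrable (count_space UNIV) (\<lambda>i. \<integral>x. norm (f i x) \<partial>M)"
    using sum abs_summable_equivalent[of "\<lambda>i. \<integral>x. norm (f i x) \<partial>M" UNIV]
    by (simp add: Infinite_Set_Sum.abs_summable_on_def)
  then have int2: "integrable (count_space UNIV \<Otimes>\<^sub>M M) (case_prod f)"
    by (intro P.Fubini_integrable meas) (use int in auto)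
  show "integrable M (\<lambda>x. \<Sum>\<^sub>\<infinity>i. f i x)"
    using P.integrable_snd[OF int2] by (simp add: eq[OF pt])
  have s2: "(\<lambda>i. norm (\<integral>x. f i x \<partial>M)) summable_on UNIV"
    by (rule summable_on_comparison_test[OF sum]) auto
  show "(\<integral>x. (\<Sum>\<^sub>\<infinity>i. f i x) \<partial>M) = (\<Sum>\<^sub>\<infinity>i. \<integral>x. f i x \<partial>M)"
    using P.Fubini_integral[OF int2] by (simp add: eq[OF pt] eq[OF s2])
qed

section \<open>Fourier inversion\<close>

lemma gauss_integrable:
  assumes "s > 0"
  shows "integrable lborel (\<lambda>x::'a::euclidean_space. exp (- s * (norm x)\<^sup>2 / 2))"
    and "integral\<^sup>L lborel (\<lambda>x::'a. exp (- s * (norm x)\<^sup>2 / 2)) = sqrt (2 * pi / s) ^ DIM('a)"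
  using gauss_fourier[OF assms, of "0::'a"]
  by (simp_all add: complex_of_real_integrable_eq integral_complex_of_real del: of_real_power of_real_mult)

text \<open>
  Testing against continuous approximations of \<open>cnj u / (1 + \<bar>u\<bar>)\<close>, damped by a Gaussian, makes a
  weighted integral of \<open>\<bar>u\<bar>\<^sup>2 / (1 + \<bar>u\<bar>)\<close> vanish.
\<close>

lemma AE_eq_0_of_orthogonal_continuous:
  fixes u :: "'a::euclidean_space \<Rightarrow> complex"
  assumes [measurable]: "u \<in> borel_measurable borel"
    and int: "integrable lborel (\<lambda>x. exp (- (norm x)\<^sup>2 / 2) *\<^sub>R u x)"
    and orth: "\<And>q. continuous_on UNIV q \<Longrightarrow> integrable lborel q \<Longrightarrow> (\<And>x. norm (q x) \<le> 1)
      \<Longrightarrow> (\<integral>x. u x * q x \<partial>lborel) = 0"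
  shows "AE x in lborel. u x = 0"
proof -
  define w where "w x = exp (- (norm x)\<^sup>2 / 2)" for x :: 'a
  have w: "w x > 0" "w x \<le> 1" for x by (auto simp: w_def)
  have wm[measurable]: "w \<in> borel_measurable borel" unfolding w_def by measurable
  have wc: "continuous_on UNIV w" unfolding w_def by (intro continuous_intros) auto
  have wint: "integrable lborel w" using gauss_integrable(1)[of 1, where 'a='a] by (simp add: w_def[abs_def])
  define \<psi> where "\<psi> x = cnj (u x) / (1 + norm (u x))" for x
  have \<psi>1: "norm (\<psi> x) \<le> 1" for x
  proof -
    have "norm (1 + complex_of_real (cmod (u x))) = 1 + cmod (u x)"
      by (metis norm_ge_zero norm_of_real of_real_1 of_real_add abs_of_nonneg add_nonneg_nonneg zero_le_one)
    then show ?thesis by (auto simp: \<psi>_def norm_divide divide_simps add_pos_nonneg)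
  qed
  have [measurable]: "\<psi> \<in> borel_measurable borel"
    unfolding \<psi>_def by measurable
  \<comment> \<open>\<open>measurable_on\<close> supplies continuous functions that converge to
    \<open>\<psi>\<close> off a negligible set, but no bound on their size.\<close>
  have "\<psi> measurable_on UNIV"
    by (rule lebesgue_measurable_imp_measurable_on) (auto intro: measurable_completion)
  then obtain N F where N: "negligible N" and F: "\<And>n::nat. continuous_on UNIV (F n)"
    and lim: "\<And>x. x \<notin> N \<Longrightarrow> (\<lambda>n. F n x) \<longlonglongrightarrow> \<psi> x"
    unfolding measurable_on_def by auto
  \<comment> \<open>Radial projection to the unit disc: it keeps continuity, supplies the missing
    bound, and leaves the limit unchanged because \<open>\<psi>\<close> has modulus at most
    1.\<close>
  define \<phi> where "\<phi> n x = F n x / of_real (max 1 (norm (F n x)))" for n x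
  have \<phi>c: "continuous_on UNIV (\<phi> n)" for n
    unfolding \<phi>_def by (intro continuous_intros F) auto
  have \<phi>1: "norm (\<phi> n x) \<le> 1" for n x
    by (auto simp: \<phi>_def norm_divide divide_simps)
  have \<phi>lim: "(\<lambda>n. \<phi> n x) \<longlonglongrightarrow> \<psi> x" if "x \<notin> N" for x
  proof -
    have "(\<lambda>n. \<phi> n x) \<longlonglongrightarrow> \<psi> x / of_real (max 1 (norm (\<psi> x)))"
      unfolding \<phi>_def by (intro tendsto_intros lim that) auto
    then show ?thesis using \<psi>1[of x] by (simp add: max_def split: if_splits)
  qed
  have [measurable]: "\<phi> n \<in> borel_measurable borel" for n
    by (rule borel_measurable_continuous_onI[OF \<phi>c])
  have z: "(\<integral>x. u x * (w x *\<^sub>R \<phi> n x) \<partial>lborel) = 0" for n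
  proof (rule orth)
    show "continuous_on UNIV (\<lambda>x. w x *\<^sub>R \<phi> n x)" by (intro continuous_intros wc \<phi>c)
    show "integrable lborel (\<lambda>x. w x *\<^sub>R \<phi> n x)"
      by (rule Bochner_Integration.integrable_bound[OF wint])
         (use \<phi>1 w in \<open>auto simp: less_imp_le mult_left_le abs_mult\<close>)
    show "norm (w x *\<^sub>R \<phi> n x) \<le> 1" for x
      using mult_mono[OF w(2)[of x] \<phi>1[of n x]] w(1)[of x] by simp
  qed
  have "AE x in lebesgue. x \<notin> N"
    using N by (simp add: negligible_iff_null_sets AE_not_in)
  then have aeN: "AE x in lborel. x \<notin> N" using AE_completion_iff by blast
  have "(\<lambda>n. \<integral>x. u x * (w x *\<^sub>R \<phi> n x) \<partial>lborel) \<longlonglongrightarrow> (\<integral>x. u x * (w x *\<^sub>R \<psi> x) \<partial>lborel)"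
  proof (rule integral_dominated_convergence)
    show "integrable lborel (\<lambda>x. norm (w x *\<^sub>R u x))"
      using int unfolding w_def by (rule integrable_norm)
    show "AE x in lborel. (\<lambda>n. u x * (w x *\<^sub>R \<phi> n x)) \<longlonglongrightarrow> u x * (w x *\<^sub>R \<psi> x)"
      using aeN by eventually_elim (intro tendsto_intros \<phi>lim)
    show "AE x in lborel. norm (u x * (w x *\<^sub>R \<phi> n x)) \<le> norm (w x *\<^sub>R u x)" for n
      using \<phi>1 w by (auto simp: norm_mult abs_mult mult_left_le mult_ac intro!: mult_left_mono)
  qed measurable
  then have 0: "(\<integral>x. u x * (w x *\<^sub>R \<psi> x) \<partial>lborel) = 0" unfolding z by (simp add: LIMSEQ_const_iff)
  define v where "v x = w x * ((norm (u x))\<^sup>2 / (1 + norm (u x)))" for x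
  have uv: "u x * (w x *\<^sub>R \<psi> x) = of_real (v x)" for x
    using complex_norm_square[of "u x"] by (simp add: \<psi>_def v_def scaleR_conv_of_real)
  have v0: "v x \<ge> 0" for x using w[of x] by (auto simp: v_def less_imp_le)
  have vm[measurable]: "v \<in> borel_measurable borel" unfolding v_def by measurable
  have vint: "integrable lborel v"
  proof (rule Bochner_Integration.integrable_bound[OF int])
    have "v x \<le> w x * norm (u x)" for x
    proof -
      have "(norm (u x))\<^sup>2 / (1 + norm (u x)) \<le> norm (u x)"
        by (simp add: divide_simps power2_eq_square add_pos_nonneg) (simp add: algebra_simps)
      from mult_left_mono[OF this less_imp_le[OF w(1)[of x]]] show ?thesis by (simp add: v_def)
    qed
    then show "AE x in lborel. norm (v x) \<le> norm (exp (- (norm x)\<^sup>2 / 2) *\<^sub>R u x)"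
      using v0 by (simp add: w_def)
  qed measurable
  have "(\<integral>x. v x \<partial>lborel) = 0"
    using 0 unfolding uv integral_complex_of_real by simp
  then have "AE x in lborel. v x = 0"
    using integral_nonneg_eq_0_iff_AE[OF vint] v0 by simp
  then show ?thesis
  proof eventually_elim
    case (elim x)
    then show ?case using w(1)[of x] add_pos_nonneg[OF zero_less_one norm_ge_zero[of "u x"]] by (auto simp: v_def)
  qed
qed

text \<open>Gaussian summation. Damping the inversion integral gives \<open>g n\<close>, which tends
  to \<open>f0\<close> pointwise and is at the same time a mollification of \<open>f\<close>. Tested
  against a continuous, bounded, integrable \<open>q\<close>, the mollifier can be moved from
  \<open>f\<close> to \<open>q\<close>, where continuity makes it converge pointwise. Hence
  \<open>f\<close> and \<open>f0\<close> have the same integrals against all such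
  \<open>q\<close>.\<close>

lemma fourier_inversion:
  fixes f :: "'a::euclidean_space \<Rightarrow> complex"
  assumes f: "integrable lborel f"
    and fh: "integrable lborel (\<lambda>\<xi>. \<integral>y. f y * cis (- (y \<bullet> \<xi>)) \<partial>lborel)"
  shows "AE x in lborel. f x = (1 / (2 * pi) ^ DIM('a)) *\<^sub>R (\<integral>\<xi>. (\<integral>y. f y * cis (- (y \<bullet> \<xi>)) \<partial>lborel) * cis (x \<bullet> \<xi>) \<partial>lborel)"
proof -
  define h where "h \<xi> = (\<integral>y. f y * cis (- (y \<bullet> \<xi>)) \<partial>lborel)" for \<xi>
  have [measurable]: "f \<in> borel_measurable borel" using borel_measurable_integrable[OF f] by simp
  have hint: "integrable lborel h" using fh by (simp add: h_def[abs_def])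
  have [measurable]: "h \<in> borel_measurable borel" using borel_measurable_integrable[OF hint] by simp
  define c where "c = 1 / (2 * pi) ^ DIM('a)"
  have c: "c > 0" by (simp add: c_def)
  define f0 where "f0 x = c *\<^sub>R (\<integral>\<xi>. h \<xi> * cis (x \<bullet> \<xi>) \<partial>lborel)" for x
  define H where "H = (\<integral>\<xi>. norm (h \<xi>) \<partial>lborel)"
  \<comment> \<open>Stated for an arbitrary multiplier \<open>k\<close> of modulus at most 1, so
    that one constant bounds \<open>f0\<close> and all the damped versions
    \<open>g n\<close>.\<close>
  have bnd: "norm (c *\<^sub>R (\<integral>\<xi>. h \<xi> * k \<xi> \<partial>lborel)) \<le> c * H" if "\<And>\<xi>. norm (k \<xi>) \<le> 1" "k \<in> borel_measurable borel" for k :: "'a \<Rightarrow> complex"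
  proof -
    note [measurable] = that(2)
    have "integrable lborel (\<lambda>\<xi>. h \<xi> * k \<xi>)"
      by (rule Bochner_Integration.integrable_bound[OF hint]) (use that(1) in \<open>auto simp: norm_mult mult_left_le\<close>)
    then have "(\<integral>\<xi>. norm (h \<xi> * k \<xi>) \<partial>lborel) \<le> H"
      unfolding H_def by (intro integral_mono integrable_norm hint) (use that(1) in \<open>auto simp: norm_mult mult_left_le\<close>)
    then have "norm (\<integral>\<xi>. h \<xi> * k \<xi> \<partial>lborel) \<le> H"
      by (rule order_trans[OF integral_norm_bound])
    then show ?thesis using c by simp
  qed
  define e where "e n \<xi> = complex_of_real (exp (- (1 / real (Suc n)) * (norm \<xi>)\<^sup>2 / 2))" for n and \<xi> :: 'a
  have [measurable]: "e n \<in> borel_measurable borel" for n unfolding e_def by measurable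
  have e1: "norm (e n \<xi>) \<le> 1" for n \<xi> by (simp add: e_def divide_simps)
  define g where "g n x = c *\<^sub>R (\<integral>\<xi>. h \<xi> * (e n \<xi> * cis (x \<bullet> \<xi>)) \<partial>lborel)" for n x
  have [measurable]: "f0 \<in> borel_measurable borel" "g n \<in> borel_measurable borel" for n
    unfolding f0_def g_def by measurable
  have glim: "(\<lambda>n. g n x) \<longlonglongrightarrow> f0 x" for x
    unfolding g_def f0_def
  proof (intro tendsto_intros integral_dominated_convergence[where w="\<lambda>\<xi>. norm (h \<xi>)"])
    show "AE \<xi> in lborel. (\<lambda>n. h \<xi> * (e n \<xi> * cis (x \<bullet> \<xi>))) \<longlonglongrightarrow> h \<xi> * cis (x \<bullet> \<xi>)"
    proof (rule AE_I2)
      fix \<xi> :: 'a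
      have l: "(\<lambda>n. 1 / real (Suc n)) \<longlonglongrightarrow> 0"
        using LIMSEQ_inverse_real_of_nat by (simp add: inverse_eq_divide)
      have l2: "(\<lambda>n. exp (- (1 / real (Suc n)) * (norm \<xi>)\<^sup>2 / 2)) \<longlonglongrightarrow> exp (- 0 * (norm \<xi>)\<^sup>2 / 2)"
        by (intro tendsto_intros l) auto
      have "(\<lambda>n. h \<xi> * (e n \<xi> * cis (x \<bullet> \<xi>))) \<longlonglongrightarrow> h \<xi> * (of_real (exp (- 0 * (norm \<xi>)\<^sup>2 / 2)) * cis (x \<bullet> \<xi>))"
        unfolding e_def by (intro tendsto_mult tendsto_const tendsto_of_real l2)
      then show "(\<lambda>n. h \<xi> * (e n \<xi> * cis (x \<bullet> \<xi>))) \<longlonglongrightarrow> h \<xi> * cis (x \<bullet> \<xi>)" by simp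
    qed
    show "AE \<xi> in lborel. norm (h \<xi> * (e n \<xi> * cis (x \<bullet> \<xi>))) \<le> norm (h \<xi>)" for n
      using e1 by (auto simp: norm_mult mult_left_le)
  qed (use hint in auto)
  \<comment> \<open>The standard normal density on the whole space; rescaled by
    \<open>sqrt (Suc n)\<close> it concentrates at 0.\<close>
  define G where "G z = (1 / sqrt (2 * pi)) ^ DIM('a) * exp (- 1 * (norm z)\<^sup>2 / 2)" for z :: 'a
  have Gint: "integrable lborel G" "(\<integral>z. G z \<partial>lborel) = 1"
    unfolding G_def using gauss_integrable[of 1, where 'a='a] by (auto simp: power_divide)
  have [measurable]: "G \<in> borel_measurable borel" unfolding G_def by measurable
  have G0: "G z \<ge> 0" for z by (simp add: G_def)
  \<comment> \<open>Regularising the inverse transform by a Gaussian convolves \<open>f\<close> with an approximate identity.\<close>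
  have gconv: "g n x = (\<integral>y. f y * of_real (sqrt (Suc n) ^ DIM('a) * G (sqrt (Suc n) *\<^sub>R y + (- sqrt (Suc n)) *\<^sub>R x)) \<partial>lborel)" (is "_ = ?R") for n x
  proof -
    have int2: "integrable (lborel \<Otimes>\<^sub>M lborel) (\<lambda>(y, \<xi>). f y * (e n \<xi> * cis ((x - y) \<bullet> \<xi>)))"
    proof (rule lborel_pair.Fubini_integrable)
      have i: "integrable lborel (e n)" using gauss_fourier(1)[of "1 / Suc n" "0::'a"] by (simp add: e_def[abs_def])
      have "integrable lborel (\<lambda>y. norm (f y) * (\<integral>\<xi>. norm (e n \<xi>) \<partial>lborel))"
        by (intro integrable_mult_left integrable_norm f)
      then show "integrable lborel (\<lambda>y. \<integral>\<xi>. norm (case (y, \<xi>) of (y, \<xi>) \<Rightarrow> f y * (e n \<xi> * cis ((x - y) \<bullet> \<xi>))) \<partial>lborel)"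
        by (simp add: norm_mult)
      show "AE y in lborel. integrable lborel (\<lambda>\<xi>. case (y, \<xi>) of (y, \<xi>) \<Rightarrow> f y * (e n \<xi> * cis ((x - y) \<bullet> \<xi>)))"
      proof (rule AE_I2)
        fix y
        have "integrable lborel (\<lambda>\<xi>. e n \<xi> * cis ((x - y) \<bullet> \<xi>))"
          by (rule Bochner_Integration.integrable_bound[OF i]) (auto simp: norm_mult)
        then show "integrable lborel (\<lambda>\<xi>. case (y, \<xi>) of (y, \<xi>) \<Rightarrow> f y * (e n \<xi> * cis ((x - y) \<bullet> \<xi>)))"
          by simp
      qed
    qed measurable
    have "(\<integral>\<xi>. h \<xi> * (e n \<xi> * cis (x \<bullet> \<xi>)) \<partial>lborel) = (\<integral>\<xi>. (\<integral>y. f y * (e n \<xi> * cis ((x - y) \<bullet> \<xi>)) \<partial>lborel) \<partial>lborel)"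
    proof -
      have "cis (- (y \<bullet> \<xi>)) * cis (x \<bullet> \<xi>) = cis ((x - y) \<bullet> \<xi>)" for y \<xi>
        by (simp add: cis_mult inner_diff_left)
      then have eq: "f y * cis (- (y \<bullet> \<xi>)) * (e n \<xi> * cis (x \<bullet> \<xi>)) = f y * (e n \<xi> * cis ((x - y) \<bullet> \<xi>))" for y \<xi>
        by (metis mult.assoc mult.commute)
      show ?thesis
        unfolding h_def integral_mult_left_zero[symmetric] eq ..
    qed
    also have "\<dots> = (\<integral>y. (\<integral>\<xi>. f y * (e n \<xi> * cis ((x - y) \<bullet> \<xi>)) \<partial>lborel) \<partial>lborel)"
      by (rule lborel_pair.Fubini_integral[OF int2])
    also have "c *\<^sub>R \<dots> = ?R"
    proof -
      have "c *\<^sub>R (\<integral>\<xi>. f y * (e n \<xi> * cis ((x - y) \<bullet> \<xi>)) \<partial>lborel) = f y * of_real (sqrt (Suc n) ^ DIM('a) * G (sqrt (Suc n) *\<^sub>R y + (- sqrt (Suc n)) *\<^sub>R x))" for y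
      proof -
        have "norm (sqrt (Suc n) *\<^sub>R y + (- sqrt (Suc n)) *\<^sub>R x) = sqrt (Suc n) * norm (x - y)"
        proof -
          have "sqrt (Suc n) *\<^sub>R y + (- sqrt (Suc n)) *\<^sub>R x = sqrt (Suc n) *\<^sub>R (y - x)" by (simp add: algebra_simps)
          then show ?thesis by (simp only: norm_scaleR) (simp add: norm_minus_commute)
        qed
        then have a: "(norm (sqrt (Suc n) *\<^sub>R y + (- sqrt (Suc n)) *\<^sub>R x))\<^sup>2 = Suc n * (norm (x - y))\<^sup>2"
          by (simp add: power_mult_distrib)
        have "c * sqrt (2 * pi / (1 / Suc n)) ^ DIM('a) = sqrt (Suc n) ^ DIM('a) * (1 / sqrt (2 * pi)) ^ DIM('a)"
          unfolding c_def power_mult_distrib[symmetric] power_one_over[symmetric]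
        proof (rule arg_cong[where f="\<lambda>x. x ^ DIM('a)"])
          have "1 / (2 * pi) * (q * t) = t * (1 / q)" if "2 * pi = q * q" "q > 0" for q t
            using that by simp
          from this[of "sqrt (2 * pi)" "sqrt (Suc n)"]
          show "1 / (2 * pi) * sqrt (2 * pi / (1 / Suc n)) = sqrt (Suc n) * (1 / sqrt (2 * pi))"
            by (simp add: real_sqrt_mult[symmetric])
        qed
        then have "c * (sqrt (2 * pi / (1 / Suc n)) ^ DIM('a) * exp (- (norm (x-y))\<^sup>2 / (2 * (1 / Suc n)))) = sqrt (Suc n) ^ DIM('a) * G (sqrt (Suc n) *\<^sub>R y + (- sqrt (Suc n)) *\<^sub>R x)"
          unfolding G_def a by (simp add: mult_ac)
        moreover have "(\<integral>\<xi>. f y * (e n \<xi> * cis ((x - y) \<bullet> \<xi>)) \<partial>lborel) = f y * of_real (sqrt (2 * pi / (1 / Suc n)) ^ DIM('a) * exp (- (norm (x-y))\<^sup>2 / (2 * (1 / Suc n))))"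
          unfolding e_def by (subst integral_mult_right_zero, subst gauss_fourier) auto
        ultimately show ?thesis
          by (simp only: scaleR_conv_of_real mult.left_commute[of "of_real c"] of_real_mult[symmetric])
      qed
      then show ?thesis by (simp flip: integral_scaleR_right)
    qed
    finally show ?thesis by (simp add: g_def)
  qed
  have "AE x in lborel. f x - f0 x = 0"
  proof (rule AE_eq_0_of_orthogonal_continuous)
    show "integrable lborel (\<lambda>x. exp (- (norm x)\<^sup>2 / 2) *\<^sub>R (f x - f0 x))"
    proof -
      have "integrable lborel (\<lambda>x. exp (- (norm x)\<^sup>2 / 2) *\<^sub>R f x)"
        by (rule Bochner_Integration.integrable_bound[OF f]) (auto simp: mult_left_le_one_le)
      moreover have "integrable lborel (\<lambda>x. exp (- (norm x)\<^sup>2 / 2) *\<^sub>R f0 x)"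
      proof (rule Bochner_Integration.integrable_bound[OF integrable_mult_left[OF gauss_integrable(1)[of 1, where 'a='a], of "c * H"]])
        have "norm (f0 x) \<le> c * H" for x unfolding f0_def by (rule bnd) auto
        then have "norm (f0 x) \<le> \<bar>c * H\<bar>" for x by (meson abs_ge_self order_trans)
        then show "AE x in lborel. norm (exp (- (norm x)\<^sup>2 / 2) *\<^sub>R f0 x) \<le> norm (exp (- 1 * (norm x)\<^sup>2 / 2) * (c * H))"
          by (auto intro!: mult_left_mono simp: abs_mult)
      qed measurable
      ultimately show ?thesis by (simp add: scaleR_diff_right)
    qed
    fix q :: "'a \<Rightarrow> complex"
    assume qc: "continuous_on UNIV q" and qi: "integrable lborel q" and q1: "\<And>x. norm (q x) \<le> 1"
    have [measurable]: "q \<in> borel_measurable borel" using borel_measurable_continuous_onI[OF qc] .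
    have "(\<lambda>n. \<integral>x. g n x * q x \<partial>lborel) \<longlonglongrightarrow> (\<integral>x. f0 x * q x \<partial>lborel)"
    proof (rule integral_dominated_convergence)
      show "integrable lborel (\<lambda>x. c * H * norm (q x))" using qi by auto
      show "AE x in lborel. (\<lambda>n. g n x * q x) \<longlonglongrightarrow> f0 x * q x"
        by (intro AE_I2 tendsto_intros glim)
      have "norm (g n x) \<le> c * H" for n x
        unfolding g_def by (rule bnd) (use e1 in \<open>auto simp: norm_mult\<close>)
      then show "AE x in lborel. norm (g n x * q x) \<le> c * H * norm (q x)" for n
        by (auto simp: norm_mult intro!: mult_right_mono)
    qed measurable
    moreover have "(\<lambda>n. \<integral>x. g n x * q x \<partial>lborel) \<longlonglongrightarrow> (\<integral>y. f y * q y \<partial>lborel)"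
    proof -
      \<comment> \<open>The average of \<open>q\<close> under a Gaussian of width
        \<open>1 / sqrt (Suc n)\<close>. It is what Fubini and the substitution
        \<open>z = sqrt (Suc n) *\<^sub>R (y - x)\<close> make of the mollifier.\<close>
      define Q where "Q n y = (\<integral>z. G z *\<^sub>R q (y - (1 / sqrt (Suc n)) *\<^sub>R z) \<partial>lborel)" for n y
      have [measurable]: "Q n \<in> borel_measurable borel" for n unfolding Q_def by measurable
      have iGq: "integrable lborel (\<lambda>z. G z *\<^sub>R q (k z))" if [measurable]: "k \<in> borel_measurable borel" for k
        by (rule Bochner_Integration.integrable_bound[OF Gint(1)]) (use q1 G0 in \<open>auto simp: mult_left_le\<close>)
      have Q1: "norm (Q n y) \<le> 1" for n y
      proof -
        have "(\<integral>z. norm (G z *\<^sub>R q (y - (1 / sqrt (Suc n)) *\<^sub>R z)) \<partial>lborel) \<le> (\<integral>z. G z \<partial>lborel)"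
          by (intro integral_mono integrable_norm iGq Gint) (use q1 G0 in \<open>auto simp: mult_left_le\<close>)
        then show ?thesis unfolding Q_def using Gint(2) integral_norm_bound order_trans by metis
      qed
      have Qlim: "(\<lambda>n. Q n y) \<longlonglongrightarrow> q y" for y
      proof -
        have "(\<lambda>n. Q n y) \<longlonglongrightarrow> (\<integral>z. G z *\<^sub>R q y \<partial>lborel)"
          unfolding Q_def
        proof (rule integral_dominated_convergence)
          show "AE z in lborel. (\<lambda>n. G z *\<^sub>R q (y - (1 / sqrt (Suc n)) *\<^sub>R z)) \<longlonglongrightarrow> G z *\<^sub>R q y"
          proof (rule AE_I2)
            fix z
            have "(\<lambda>n. sqrt (inverse (Suc n))) \<longlonglongrightarrow> sqrt 0"
              by (intro tendsto_intros LIMSEQ_inverse_real_of_nat)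
            then have "(\<lambda>n. 1 / sqrt (Suc n)) \<longlonglongrightarrow> 0" by (simp add: real_sqrt_inverse inverse_eq_divide real_sqrt_divide)
            then have "(\<lambda>n. y - (1 / sqrt (Suc n)) *\<^sub>R z) \<longlonglongrightarrow> y - 0 *\<^sub>R z" by (intro tendsto_intros)
            moreover have "isCont q (y - 0 *\<^sub>R z)" using qc by (simp add: continuous_on_eq_continuous_at)
            ultimately have "(\<lambda>n. q (y - (1 / sqrt (Suc n)) *\<^sub>R z)) \<longlonglongrightarrow> q (y - 0 *\<^sub>R z)"
              by (rule isCont_tendsto_compose[rotated])
            then show "(\<lambda>n. G z *\<^sub>R q (y - (1 / sqrt (Suc n)) *\<^sub>R z)) \<longlonglongrightarrow> G z *\<^sub>R q y" by (intro tendsto_intros) simp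
          qed
          show "AE z in lborel. norm (G z *\<^sub>R q (y - (1 / sqrt (Suc n)) *\<^sub>R z)) \<le> G z" for n
            using q1 G0 by (auto simp: mult_left_le)
        qed (use Gint in auto)
        then show ?thesis using Gint by simp
      qed
      have "(\<integral>x. g n x * q x \<partial>lborel) = (\<integral>y. f y * Q n y \<partial>lborel)" for n
      proof -
        define r where "r = sqrt (Suc n)"
        have r: "r > 0" by (simp add: r_def)
        define K where "K y x = r ^ DIM('a) * G (r *\<^sub>R y + (- r) *\<^sub>R x)" for y x
        have K0: "K y x \<ge> 0" for y x using r G0 by (simp add: K_def)
        have Ki: "integrable lborel (K y)" "(\<integral>x. K y x \<partial>lborel) = 1" for y
          unfolding K_def using lborel_affine_has_integral[OF Gint(1), of "-r" "r *\<^sub>R y"] r Gint(2) by auto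
        have Km[measurable]: "(\<lambda>(y, x). K y x) \<in> borel_measurable (lborel \<Otimes>\<^sub>M lborel)"
          unfolding K_def by measurable
        have int2: "integrable (lborel \<Otimes>\<^sub>M lborel) (\<lambda>(y, x). f y * of_real (K y x) * q x)"
        proof (rule lborel_pair.Fubini_integrable)
          have i: "integrable lborel (\<lambda>x. f y * of_real (K y x) * q x)" for y
            by (rule Bochner_Integration.integrable_bound[OF integrable_mult_right[OF Ki(1)[of y], of "norm (f y)"]])
               (use q1 K0 in \<open>auto simp: norm_mult intro!: mult_left_le\<close>)
          have "(\<integral>x. norm (f y * of_real (K y x) * q x) \<partial>lborel) \<le> norm (f y)" for y
          proof -
            have "(\<integral>x. norm (f y * of_real (K y x) * q x) \<partial>lborel) \<le> (\<integral>x. norm (f y) * K y x \<partial>lborel)"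
              by (intro integral_mono integrable_norm i integrable_mult_right Ki)
                 (use q1 K0 in \<open>auto simp: norm_mult intro!: mult_left_le\<close>)
            then show ?thesis by (simp add: Ki)
          qed
          then show "integrable lborel (\<lambda>y. \<integral>x. norm (case (y, x) of (y, x) \<Rightarrow> f y * of_real (K y x) * q x) \<partial>lborel)"
            by (intro Bochner_Integration.integrable_bound[OF integrable_norm[OF f]]) auto
          show "AE y in lborel. integrable lborel (\<lambda>x. case (y, x) of (y, x) \<Rightarrow> f y * of_real (K y x) * q x)"
            using i by simp
        qed measurable
        have "(\<integral>x. g n x * q x \<partial>lborel) = (\<integral>x. (\<integral>y. f y * of_real (K y x) * q x \<partial>lborel) \<partial>lborel)"
          unfolding gconv K_def r_def integral_mult_left_zero[symmetric] ..
        also have "\<dots> = (\<integral>y. (\<integral>x. f y * of_real (K y x) * q x \<partial>lborel) \<partial>lborel)"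
          by (rule lborel_pair.Fubini_integral[OF int2])
        also have "\<dots> = (\<integral>y. f y * Q n y \<partial>lborel)"
        proof (rule Bochner_Integration.integral_cong[OF refl])
          fix y
          have eq: "q (y - (1 / r) *\<^sub>R (r *\<^sub>R y + (- r) *\<^sub>R x)) = q x" for x
            using r by (simp add: algebra_simps)
          have "(\<integral>x. G (r *\<^sub>R y + (- r) *\<^sub>R x) *\<^sub>R q x \<partial>lborel) = (1 / \<bar>-r\<bar> ^ DIM('a)) *\<^sub>R (\<integral>z. G z *\<^sub>R q (y - (1 / r) *\<^sub>R z) \<partial>lborel)"
            using lborel_affine_has_integral(2)[OF iGq[of "\<lambda>z. y - (1 / r) *\<^sub>R z"], of "- r" "r *\<^sub>R y"] r
            unfolding eq by simp
          then have "Q n y = r ^ DIM('a) *\<^sub>R (\<integral>x. G (r *\<^sub>R y + (- r) *\<^sub>R x) *\<^sub>R q x \<partial>lborel)"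
            using r by (simp add: Q_def r_def)
          also have "\<dots> = (\<integral>x. of_real (K y x) * q x \<partial>lborel)"
            by (simp only: integral_scaleR_right[symmetric] scaleR_scaleR) (simp only: K_def scaleR_conv_of_real)
          finally show "(\<integral>x. f y * of_real (K y x) * q x \<partial>lborel) = f y * Q n y"
            by (simp add: mult.assoc)
        qed
        finally show ?thesis .
      qed
      moreover have "(\<lambda>n. \<integral>y. f y * Q n y \<partial>lborel) \<longlonglongrightarrow> (\<integral>y. f y * q y \<partial>lborel)"
      proof (rule integral_dominated_convergence)
        show "integrable lborel (\<lambda>y. norm (f y))" using f by simp
        show "AE x in lborel. (\<lambda>n. f x * Q n x) \<longlonglongrightarrow> f x * q x" by (intro AE_I2 tendsto_intros Qlim)
        show "AE x in lborel. norm (f x * Q n x) \<le> norm (f x)" for n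
          using Q1 by (auto simp: norm_mult intro!: mult_left_le)
      qed measurable
      ultimately show ?thesis by simp
    qed
    ultimately have "(\<integral>x. f0 x * q x \<partial>lborel) = (\<integral>x. f x * q x \<partial>lborel)"
      by (rule LIMSEQ_unique)
    moreover have "integrable lborel (\<lambda>x. f x * q x)"
      by (rule Bochner_Integration.integrable_bound[OF f]) (use q1 in \<open>auto simp: norm_mult intro!: mult_left_le\<close>)
    moreover have "integrable lborel (\<lambda>x. f0 x * q x)"
    proof (rule Bochner_Integration.integrable_bound[OF integrable_mult_right[OF integrable_norm[OF qi], of "c * H"]])
      have "norm (f0 x) \<le> c * H" for x unfolding f0_def by (rule bnd) auto
      then have "norm (f0 x) \<le> \<bar>c * H\<bar>" for x by (meson abs_ge_self order_trans)
      then show "AE x in lborel. norm (f0 x * q x) \<le> norm (c * H * norm (q x))"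
        by (auto intro!: mult_right_mono simp: abs_mult norm_mult)
    qed measurable
    ultimately show "(\<integral>x. (f x - f0 x) * q x \<partial>lborel) = 0"
      by (simp add: left_diff_distrib)
  qed measurable
  then show ?thesis by (simp add: f0_def h_def c_def)
qed

section \<open>The Matern kernel as a mixture of Gaussians\<close>

text \<open>Dominated by a multiple of the exponential density plus its reflection.\<close>

lemma exp_abs_integrable:
  assumes c: "c > 0"
  shows "integrable lborel (\<lambda>t::real. exp (- c * \<bar>t\<bar>))"
proof -
  interpret prob_space "density lborel (exponential_density c)"
    by (rule prob_space_exponential_density[OF c])
  have i: "integrable lborel (exponential_density c)"
  proof (rule integrableI_nonneg)
    have "(\<integral>\<^sup>+ x. ennreal (exponential_density c x) \<partial>lborel) = 1"
      using emeasure_space_1 by (simp add: emeasure_density)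
    then show "(\<integral>\<^sup>+ x. ennreal (exponential_density c x) \<partial>lborel) < \<infinity>" by simp
  qed (use c in \<open>auto simp: exponential_density_nonneg\<close>)
  have j: "integrable lborel (\<lambda>x. exponential_density c (0 + (-1) * x))"
    by (rule lborel_integrable_real_affine[OF i]) simp
  show ?thesis
    by (rule Bochner_Integration.integrable_bound[OF integrable_mult_right[OF Bochner_Integration.integrable_add[OF i j], of "1 / c"]])
       (use c in \<open>auto simp: exponential_density_def mult_ac divide_simps\<close>)
qed

text \<open>For negative \<open>t\<close> the factor \<open>exp (a * t)\<close> decays. For positive
  \<open>t\<close>, \<open>exp t\<close> is at least \<open>t\<^sup>2 / 2\<close>, and completing
  the square bounds \<open>(a + 1) * t - b * (t\<^sup>2 / 2)\<close> by
  \<open>(a + 1)\<^sup>2 / (2 * b)\<close>; this is the origin of \<open>C\<close> and leaves the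
  decay \<open>exp (- t)\<close>.\<close>

lemma exp_exp_integrable:
  assumes a: "a > 0" and b: "b > 0"
  shows "integrable lborel (\<lambda>t::real. exp (a * t - b * exp t))"
proof -
  define c where "c = min a 1"
  have c: "c > 0" "c \<le> a" "c \<le> 1" using a by (auto simp: c_def)
  define C where "C = exp ((a + 1)\<^sup>2 / (2 * b))"
  have C1: "C \<ge> 1" using b by (simp add: C_def)
  have "exp (a * t - b * exp t) \<le> C * exp (- c * \<bar>t\<bar>)" for t
  proof (cases "t \<ge> 0")
    case True
    have "t\<^sup>2 / 2 \<le> exp t" using exp_lower_Taylor_quadratic[OF True] True by simp
    then have 1: "b * (t\<^sup>2 / 2) \<le> b * exp t" using b by (intro mult_left_mono) auto
    have "0 \<le> (b * t - (a + 1))\<^sup>2 / (2 * b)" using b by simp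
    also have "\<dots> = b * (t\<^sup>2 / 2) - (a + 1) * t + (a + 1)\<^sup>2 / (2 * b)"
      using b by (simp add: field_simps power2_eq_square)
    finally have 2: "(a + 1) * t - b * (t\<^sup>2 / 2) \<le> (a + 1)\<^sup>2 / (2 * b)" by simp
    have "c * t \<le> t" using c True by (simp add: mult_left_le_one_le)
    then have "a * t - b * exp t \<le> (a + 1)\<^sup>2 / (2 * b) + - c * \<bar>t\<bar>"
      using 1 2 True by (simp add: algebra_simps)
    then show ?thesis unfolding C_def exp_add[symmetric] by simp
  next
    case False
    then have "a * t \<le> c * t" using c by (intro mult_right_mono_neg) auto
    moreover have "b * exp t \<ge> 0" using b by simp
    ultimately have "a * t - b * exp t \<le> c * t" by linarith
    then have "exp (a * t - b * exp t) \<le> 1 * exp (- c * \<bar>t\<bar>)"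
      using False by simp
    also have "\<dots> \<le> C * exp (- c * \<bar>t\<bar>)" using C1 by (intro mult_right_mono) auto
    finally show ?thesis .
  qed
  then show ?thesis
    by (intro Bochner_Integration.integrable_bound[OF integrable_mult_right[OF exp_abs_integrable[OF c(1)], of C]])
       (use C1 in auto)
qed

lemma power_le_fact_exp:
  fixes x :: real
  assumes "x \<ge> 0"
  shows "x ^ n \<le> fact n * exp x"
proof -
  have "x ^ n /\<^sub>R fact n \<le> exp x"
    using sum_le_suminf[OF summable_exp_generic[of x], of "{n}"] assms by (simp add: exp_def)
  then show ?thesis by (simp add: divide_simps mult.commute)
qed

text \<open>
  With mixing variable \<open>e\<^sup>t\<close>, the variance of the Gaussian, passing between the integral of
  \<open>macdonald\<close>, the kernel and its Fourier transform only takes translations in \<open>t\<close>.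
\<close>

definition mix_kernel :: "real \<Rightarrow> real \<Rightarrow> real \<Rightarrow> real" where
  "mix_kernel \<nu> q t = exp (\<nu> * t - exp t / 2 - q * exp (- t) / 2)"

lemma mix_kernel_measurable [measurable]:
  "(\<lambda>x. mix_kernel \<nu> (q x) (t x)) \<in> borel_measurable M"
  if [measurable]: "q \<in> borel_measurable M" "t \<in> borel_measurable M"
  unfolding mix_kernel_def by measurable

lemma mix_kernel_nonneg: "mix_kernel \<nu> q t \<ge> 0"
  by (simp add: mix_kernel_def)

text \<open>The bound is free of \<open>q\<close>, so it can serve as dominating function when
  \<open>q\<close> tends to 0.\<close>

lemma mix_kernel_le: "q \<ge> 0 \<Longrightarrow> mix_kernel \<nu> q t \<le> exp (\<nu> * t - 1 / 2 * exp t)"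
  by (simp add: mix_kernel_def)

lemma mix_kernel_integrable:
  assumes "\<nu> > 0" "q \<ge> 0"
  shows "integrable lborel (mix_kernel \<nu> q)"
  using mix_kernel_le[OF assms(2)]
  by (intro Bochner_Integration.integrable_bound[OF exp_exp_integrable[of \<nu> "1/2"]])
     (use assms in \<open>auto simp: mix_kernel_nonneg\<close>)

text \<open>Shifting \<open>t\<close> by \<open>ln r\<close> turns the mixture integrand into
  \<open>r powr \<nu> * exp (- r * cosh t + \<nu> * t)\<close>. Folding the line at 0 pairs
  \<open>t\<close> with \<open>- t\<close> and produces \<open>2 * cosh (\<nu> * t)\<close> on the
  half line, whence the factor \<open>1 / 2\<close>.\<close>

lemma macdonald_mix:
  assumes \<nu>: "\<nu> > 0" and r: "r > 0"
  shows "r powr \<nu> * macdonald \<nu> r = (1 / 2) * (\<integral>t. mix_kernel \<nu> (r\<^sup>2) t \<partial>lborel)"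
proof -
  define k where "k t = exp (- r * cosh t + \<nu> * t)" for t
  have mk: "mix_kernel \<nu> (r\<^sup>2) (ln r + 1 * t) = r powr \<nu> * k t" for t
  proof -
    have "\<nu> * (ln r + t) - exp (ln r + t) / 2 - r\<^sup>2 * exp (- (ln r + t)) / 2 = \<nu> * ln r + (- r * cosh t + \<nu> * t)"
      using r by (simp add: exp_add exp_diff exp_minus cosh_def field_simps power2_eq_square)
    then show ?thesis
      using r by (simp add: mix_kernel_def k_def exp_add[symmetric] powr_def mult.commute)
  qed
  have mi: "integrable lborel (mix_kernel \<nu> (r\<^sup>2))" by (rule mix_kernel_integrable[OF \<nu>]) simp
  have "integrable lborel (\<lambda>t. mix_kernel \<nu> (r\<^sup>2) (ln r + 1 * t))"
    by (rule lborel_integrable_real_affine[OF mi]) simp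
  then have "integrable lborel (\<lambda>t. (1 / r powr \<nu>) * (r powr \<nu> * k t))"
    unfolding mk by (rule integrable_mult_right)
  then have ki: "integrable lborel k" using r by simp
  have 1: "(\<integral>t. mix_kernel \<nu> (r\<^sup>2) t \<partial>lborel) = r powr \<nu> * (\<integral>t. k t \<partial>lborel)"
    using lborel_integral_real_affine[of 1 "mix_kernel \<nu> (r\<^sup>2)" "ln r"] unfolding mk by simp
  have ki': "integrable lborel (\<lambda>t. k (0 + (-1) * t))"
    by (rule lborel_integrable_real_affine[OF ki]) simp
  have i1: "integrable lborel (\<lambda>t. indicator {0..} t *\<^sub>R k t)"
    by (rule integrable_mult_indicator[OF _ ki]) auto
  have i2: "integrable lborel (\<lambda>t. indicator {0..} t *\<^sub>R k (- t))"
    using integrable_mult_indicator[OF _ ki', of "{0..}"] by simp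
  have i3: "integrable lborel (\<lambda>t. indicator {0..} (- t) *\<^sub>R k t)"
    using integrable_mult_indicator[OF _ ki, of "{..0}"] by (simp add: indicator_def)
  have kk: "k t + k (- t) = 2 * (exp (- r * cosh t) * cosh (\<nu> * t))" for t
    unfolding k_def by (simp only: exp_add cosh_minus cosh_def[of "\<nu> * t"]) (simp add: algebra_simps)
  have "macdonald \<nu> r = (\<integral>t. (1/2) * (indicator {0..} t *\<^sub>R k t + indicator {0..} t *\<^sub>R k (- t)) \<partial>lborel)"
    unfolding macdonald_def set_lebesgue_integral_def
    by (intro Bochner_Integration.integral_cong refl)
       (use kk in \<open>auto split: split_indicator\<close>)
  also have "\<dots> = (1/2) * ((\<integral>t. indicator {0..} t *\<^sub>R k t \<partial>lborel) + (\<integral>t. indicator {0..} t *\<^sub>R k (- t) \<partial>lborel))"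
    by (subst Bochner_Integration.integral_add[OF i1 i2, symmetric]) (simp add: field_simps)
  also have "(\<integral>t. indicator {0..} t *\<^sub>R k (- t) \<partial>lborel) = (\<integral>t. indicator {0..} (- t) *\<^sub>R k t \<partial>lborel)"
    using lborel_integral_real_affine[of "-1" "\<lambda>t. indicator {0..} t *\<^sub>R k (- t)" 0] by simp
  also have "(\<integral>t. indicator {0..} t *\<^sub>R k t \<partial>lborel) + \<dots> = (\<integral>t. indicator {0..} t *\<^sub>R k t + indicator {0..} (- t) *\<^sub>R k t \<partial>lborel)"
    by (rule Bochner_Integration.integral_add[OF i1 i3, symmetric])
  also have "\<dots> = (\<integral>t. k t \<partial>lborel)"
  proof (rule integral_cong_AE)
    \<comment> \<open>The two half lines overlap in the point 0 only, which is a null set.\<close>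
    have "AE t in lborel. (t::real) \<noteq> 0" by (rule AE_lborel_singleton)
    then show "AE t in lborel. indicator {0..} t *\<^sub>R k t + indicator {0..} (- t) *\<^sub>R k t = k t"
      by eventually_elim (auto simp: indicator_def)
  qed (use ki i1 i3 in auto)
  finally show ?thesis unfolding 1 by simp
qed

lemma mix_kernel_integral_tendsto:
  assumes \<nu>: "\<nu> > 0"
  shows "((\<lambda>y::'a::real_normed_vector. \<integral>t. mix_kernel \<nu> ((norm y)\<^sup>2) t \<partial>lborel) \<longlongrightarrow> (\<integral>t. mix_kernel \<nu> 0 t \<partial>lborel)) (at 0)"
  unfolding tendsto_at_iff_sequentially
proof (intro allI impI)
  fix X :: "nat \<Rightarrow> 'a"
  assume X: "X \<longlonglongrightarrow> 0"
  have "(\<lambda>n. \<integral>t. mix_kernel \<nu> ((norm (X n))\<^sup>2) t \<partial>lborel) \<longlonglongrightarrow> (\<integral>t. mix_kernel \<nu> 0 t \<partial>lborel)"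
  proof (rule integral_dominated_convergence)
    show "integrable lborel (\<lambda>t. exp (\<nu> * t - 1 / 2 * exp t))"
      by (rule exp_exp_integrable[OF \<nu>]) simp
    show "AE t in lborel. (\<lambda>n. mix_kernel \<nu> ((norm (X n))\<^sup>2) t) \<longlonglongrightarrow> mix_kernel \<nu> 0 t"
    proof (rule AE_I2)
      fix t
      have "(\<lambda>n. exp (\<nu> * t - exp t / 2 - (norm (X n))\<^sup>2 * exp (- t) / 2)) \<longlonglongrightarrow> exp (\<nu> * t - exp t / 2 - (norm (0::'a))\<^sup>2 * exp (- t) / 2)"
        by (intro tendsto_intros X) auto
      then show "(\<lambda>n. mix_kernel \<nu> ((norm (X n))\<^sup>2) t) \<longlonglongrightarrow> mix_kernel \<nu> 0 t" by (simp add: mix_kernel_def)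
    qed
    show "AE t in lborel. norm (mix_kernel \<nu> ((norm (X n))\<^sup>2) t) \<le> exp (\<nu> * t - 1 / 2 * exp t)" for n
      using mix_kernel_le[of "(norm (X n))\<^sup>2" \<nu>] by (simp add: mix_kernel_nonneg)
  qed measurable
  then show "((\<lambda>y. \<integral>t. mix_kernel \<nu> ((norm y)\<^sup>2) t \<partial>lborel) \<circ> X) \<longlonglongrightarrow> (\<integral>t. mix_kernel \<nu> 0 t \<partial>lborel)"
    by (simp add: comp_def)
qed

text \<open>The origin is covered too: the mixture integral is continuous there and hence equals the
  \<open>Lim\<close> in the definition. All later properties of the kernel come from this
  formula.\<close>

lemma matern_mix:
  fixes x :: "real ^ 'n"
  assumes m: "real m > real CARD('n) / 2"
  shows "matern m x = (1 / 2) * (\<integral>t. mix_kernel (real m - real CARD('n) / 2) ((norm x)\<^sup>2) t \<partial>lborel)"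
proof -
  define \<nu> where "\<nu> = real m - real CARD('n) / 2"
  have \<nu>: "\<nu> > 0" using m by (simp add: \<nu>_def)
  define F where "F = (\<lambda>y :: real ^ 'n. norm y powr \<nu> * macdonald \<nu> (norm y))"
  have F: "F y = (1 / 2) * (\<integral>t. mix_kernel \<nu> ((norm y)\<^sup>2) t \<partial>lborel)" if "y \<noteq> 0" for y
    unfolding F_def using macdonald_mix[OF \<nu>] that by simp
  have "((\<lambda>y::real^'n. (1 / 2) * (\<integral>t. mix_kernel \<nu> ((norm y)\<^sup>2) t \<partial>lborel)) \<longlongrightarrow> (1 / 2) * (\<integral>t. mix_kernel \<nu> 0 t \<partial>lborel)) (at 0)"
    by (intro tendsto_intros mix_kernel_integral_tendsto \<nu>)
  then have "(F \<longlongrightarrow> (1 / 2) * (\<integral>t. mix_kernel \<nu> 0 t \<partial>lborel)) (at 0)"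
    by (rule Lim_transform_eventually) (auto simp: eventually_at_filter F)
  then have "Lim (at 0) F = (1 / 2) * (\<integral>t. mix_kernel \<nu> 0 t \<partial>lborel)"
    by (intro tendsto_Lim) auto
  then show ?thesis
    using F[of x] unfolding matern_def Let_def \<nu>_def[symmetric] F_def by (cases "x = 0") auto
qed

lemma matern_nonneg:
  fixes x :: "real ^ 'n"
  assumes m: "real m > real CARD('n) / 2"
  shows "matern m x \<ge> 0"
  unfolding matern_mix[OF m] by (simp add: integral_nonneg_AE mix_kernel_nonneg)

lemma matern_measurable:
  assumes m: "real m > real CARD('n) / 2"
  shows "(matern m :: real ^ 'n \<Rightarrow> real) \<in> borel_measurable borel"
  unfolding matern_mix[OF m, abs_def] by measurable

text \<open>With \<open>y = q * exp (- t) / 2\<close> one has \<open>q = 2 * y * exp t\<close>, so a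
  power of \<open>1 + q\<close> splits into powers of \<open>1 + y\<close> and of
  \<open>1 + exp t / 4\<close>. Exponentials absorb both: the first uses up all of the factor
  \<open>exp (- y)\<close>, the second one half of the exponent \<open>exp t / 2\<close>. What
  remains is free of \<open>q\<close> and integrable in \<open>t\<close>.\<close>

lemma matern_decay:
  assumes m: "real m > real CARD('n) / 2"
  shows "\<exists>C>0. \<forall>x :: real ^ 'n. matern m x \<le> C / (1 + (norm x)\<^sup>2) ^ N"
proof -
  define \<nu> where "\<nu> = real m - real CARD('n) / 2"
  have \<nu>: "\<nu> > 0" using m by (simp add: \<nu>_def)
  \<comment> \<open>Each use of \<open>power_le_fact_exp\<close> contributes
    \<open>fact N * exp 1\<close>; the 8 is the crude constant in
    \<open>1 + q \<le> (1 + y) * (8 * (1 + exp t / 4))\<close>.\<close>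
  define D :: real where "D = (fact N * exp 1)\<^sup>2 * 8 ^ N"
  have D: "D > 0" by (simp add: D_def)
  have int: "integrable lborel (\<lambda>t. D * exp (\<nu> * t - 1 / 4 * exp t))"
    by (intro integrable_mult_right exp_exp_integrable \<nu>) simp
  define I where "I = (\<integral>t. D * exp (\<nu> * t - 1 / 4 * exp t) \<partial>lborel)"
  have I0: "I \<ge> 0" unfolding I_def using D by (intro integral_nonneg_AE) auto
  have key: "(1 + q) ^ N * mix_kernel \<nu> q t \<le> D * exp (\<nu> * t - 1 / 4 * exp t)" if q: "q \<ge> 0" for q t
  proof -
    define y where "y = q * exp (- t) / 2"
    have y: "y \<ge> 0" using q by (simp add: y_def)
    have qy: "q = 2 * y * exp t" by (simp add: y_def exp_minus)
    have "1 + q \<le> (1 + y) * (8 * (1 + exp t / 4))"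
      unfolding qy using y by (simp add: algebra_simps)
    then have "(1 + q) ^ N \<le> ((1 + y) * (8 * (1 + exp t / 4))) ^ N"
      using q by (intro power_mono) auto
    also have "\<dots> = (1 + y) ^ N * (1 + exp t / 4) ^ N * 8 ^ N" by (simp only: power_mult_distrib mult_ac)
    also have "\<dots> \<le> (fact N * exp (1 + y)) * (fact N * exp (1 + exp t / 4)) * 8 ^ N"
      using y by (intro mult_mono power_le_fact_exp) auto
    also have "\<dots> = D * (exp y * exp (exp t / 4))"
      by (simp add: D_def exp_add power2_eq_square)
    finally have "(1 + q) ^ N * mix_kernel \<nu> q t \<le> D * (exp y * exp (exp t / 4)) * mix_kernel \<nu> q t"
      by (intro mult_right_mono) (auto simp: mix_kernel_nonneg)
    also have "\<dots> = D * exp (\<nu> * t - 1 / 4 * exp t)"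
      by (simp add: mix_kernel_def y_def flip: exp_add)
    finally show ?thesis .
  qed
  have "matern m x \<le> ((1 / 2) * I + 1) / (1 + (norm x)\<^sup>2) ^ N" for x :: "real ^ 'n"
  proof -
    have "(\<integral>t. (1 + (norm x)\<^sup>2) ^ N * mix_kernel \<nu> ((norm x)\<^sup>2) t \<partial>lborel) \<le> I"
      unfolding I_def by (intro integral_mono int integrable_mult_right mix_kernel_integrable \<nu> key) auto
    then have "(1 + (norm x)\<^sup>2) ^ N * matern m x \<le> (1 / 2) * I"
      unfolding matern_mix[OF m] \<nu>_def[symmetric] by simp
    then have "(1 + (norm x)\<^sup>2) ^ N * matern m x \<le> (1 / 2) * I + 1" by simp
    moreover have "(1 + (norm x)\<^sup>2) ^ N > 0" by (simp add: add_pos_nonneg)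
    ultimately show ?thesis by (simp add: pos_le_divide_eq mult.commute)
  qed
  then show ?thesis using I0 by (intro exI[of _ "(1 / 2) * I + 1"]) auto
qed

section \<open>Fourier transform of the kernel and lattice sums\<close>

text \<open>A Gamma integral in the variable \<open>exp t\<close> writes
  \<open>1 / (1 + (norm \<xi>)\<^sup>2) ^ m\<close> as a mixture of Gaussians of precision
  \<open>exp t\<close>. Transforming each of them gives a Gaussian of variance \<open>exp t\<close>
  and a factor \<open>exp (- t * d / 2)\<close>, \<open>d\<close> the dimension, which lowers the
  exponent from \<open>m\<close> to \<open>\<nu>\<close>; the result is the mixture of
  \<open>matern_mix\<close>.\<close>

lemma matern_fourier:
  assumes m0: "m > 0" and m: "real m > real CARD('n) / 2"
  shows "integrable lborel (\<lambda>\<xi>::real^'n. 1 / (1 + (norm \<xi>)\<^sup>2) ^ m)"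
    and "\<exists>B>0. \<forall>y::real^'n. (\<integral>\<xi>. of_real (1 / (1 + (norm \<xi>)\<^sup>2) ^ m) * cis (y \<bullet> \<xi>) \<partial>lborel) = of_real (B * matern m y)"
proof -
  define \<nu> where "\<nu> = real m - real CARD('n) / 2"
  have \<nu>: "\<nu> > 0" using m by (simp add: \<nu>_def)
  define E where "E t = exp (real m * t - 1 / 2 * exp t)" for t
  have Ei: "integrable lborel E" unfolding E_def by (rule exp_exp_integrable) (use m0 in auto)
  \<comment> \<open>The value of this integral is \<open>2 ^ m\<close> times the Gamma function at
    \<open>m\<close>; what is used of it is positivity.\<close>
  define \<kappa> where "\<kappa> = (\<integral>t. E t \<partial>lborel)"
  have "\<kappa> > 0"
  proof -
    have "\<kappa> \<ge> 0" unfolding \<kappa>_def by (intro integral_nonneg_AE) (simp add: E_def)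
    moreover have "\<kappa> \<noteq> 0"
    proof
      assume "\<kappa> = 0"
      then have "AE t in lborel. E t = 0"
        unfolding \<kappa>_def by (subst (asm) integral_nonneg_eq_0_iff_AE[OF Ei]) (auto simp: E_def)
      then have "AE t in (lborel :: real measure). False" by (simp add: E_def)
      then show False by (simp add: AE_iff_null emeasure_eq_0_AE null_sets_def)
    qed
    ultimately show ?thesis by simp
  qed
  define k where "k t \<xi> = exp (real m * t - exp t * (1 + (norm \<xi>)\<^sup>2) / 2)" for t and \<xi> :: "real^'n"
  have kt: "integrable lborel (\<lambda>t. k t \<xi>)" "(\<integral>t. k t \<xi> \<partial>lborel) = \<kappa> / (1 + (norm \<xi>)\<^sup>2) ^ m" for \<xi>
  proof -
    define b where "b = 1 + (norm \<xi>)\<^sup>2"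
    have b: "b > 0" by (simp add: b_def add_pos_nonneg)
    have eq: "k t \<xi> = (1 / b ^ m) * E (ln b + 1 * t)" for t
    proof -
      have "b ^ m = exp (real m * ln b)" using b by (simp add: exp_of_nat_mult)
      then show ?thesis using b
        by (simp add: k_def E_def b_def[symmetric] exp_add exp_diff ring_distribs)
    qed
    show "integrable lborel (\<lambda>t. k t \<xi>)" unfolding eq
      by (intro integrable_mult_right lborel_integrable_real_affine Ei) simp
    show "(\<integral>t. k t \<xi> \<partial>lborel) = \<kappa> / (1 + (norm \<xi>)\<^sup>2) ^ m" unfolding eq \<kappa>_def b_def[symmetric]
      using lborel_integral_real_affine[of 1 E "ln b"] by simp
  qed
  have sq: "exp (real m * t - exp t / 2) * (sqrt (2 * pi / exp t) ^ CARD('n) * exp (- q / (2 * exp t))) = sqrt (2 * pi) ^ CARD('n) * mix_kernel \<nu> q t" for t q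
  proof -
    have "sqrt (exp t) ^ CARD('n) = exp (t / 2) ^ CARD('n)"
    proof -
      have "sqrt (exp t) = exp (t / 2)" by (rule real_sqrt_unique) (auto simp: power2_eq_square exp_add[symmetric])
      then show ?thesis by simp
    qed
    also have "\<dots> = exp (t * real CARD('n) / 2)" by (simp add: exp_of_nat_mult[symmetric] mult.commute)
    finally have *: "sqrt (exp t) ^ CARD('n) = exp (t * real CARD('n) / 2)" .
    have "mix_kernel \<nu> q t = exp (real m * t - exp t / 2) * exp (- q / (2 * exp t)) / exp (t * real CARD('n) / 2)"
      unfolding mix_kernel_def \<nu>_def exp_add[symmetric] exp_diff[symmetric]
      by (simp add: exp_minus field_simps)
    then show ?thesis
      by (simp add: real_sqrt_divide power_divide * field_simps)
  qed
  have keq: "of_real (k t \<xi>) * cis (y \<bullet> \<xi>) = of_real (exp (real m * t - exp t / 2)) * (of_real (exp (- exp t * (norm \<xi>)\<^sup>2 / 2)) * cis (y \<bullet> \<xi>))" for t \<xi> y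
  proof -
    have "k t \<xi> = exp (real m * t - exp t / 2) * exp (- exp t * (norm \<xi>)\<^sup>2 / 2)"
      unfolding k_def exp_add[symmetric] by (rule arg_cong[where f=exp]) (simp add: ring_distribs add_divide_distrib)
    then show ?thesis by (simp only: of_real_mult mult.assoc)
  qed
  have kxi: "integrable lborel (\<lambda>\<xi>. of_real (k t \<xi>) * cis (y \<bullet> \<xi>))"
     "(\<integral>\<xi>. of_real (k t \<xi>) * cis (y \<bullet> \<xi>) \<partial>lborel) = complex_of_real (sqrt (2 * pi) ^ CARD('n) * mix_kernel \<nu> ((norm y)\<^sup>2) t)" for t y
    unfolding keq sq[symmetric] using gauss_fourier[of "exp t" y] by auto
  have nk: "norm (of_real (k t \<xi>) * cis (y \<bullet> \<xi>)) = k t \<xi>" for t \<xi> y by (simp add: norm_mult k_def)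
  have kxi0: "(\<integral>\<xi>. k t \<xi> \<partial>lborel) = sqrt (2 * pi) ^ CARD('n) * mix_kernel \<nu> 0 t" for t
    using kxi(2)[of t 0] by (simp del: of_real_mult of_real_power)
  \<comment> \<open>Absolute integrability: the inner integral of the norm is the transform at 0, a
    multiple of \<open>mix_kernel \<nu> 0 t\<close>, which is integrable in \<open>t\<close> because
    \<open>\<nu> > 0\<close>.\<close>
  have int2: "integrable (lborel \<Otimes>\<^sub>M lborel) (\<lambda>(t, \<xi>). of_real (k t \<xi>) * cis (y \<bullet> \<xi>))" for y
  proof (rule lborel_pair.Fubini_integrable)
    show "(\<lambda>(t, \<xi>). of_real (k t \<xi>) * cis (y \<bullet> \<xi>)) \<in> borel_measurable (lborel \<Otimes>\<^sub>M lborel)"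
      unfolding k_def by measurable
    show "integrable lborel (\<lambda>t. \<integral>\<xi>. norm (case (t, \<xi>) of (t, \<xi>) \<Rightarrow> of_real (k t \<xi>) * cis (y \<bullet> \<xi>)) \<partial>lborel)"
      by (simp only: prod.case nk kxi0) (intro integrable_mult_right mix_kernel_integrable \<nu> order_refl)
    show "AE t in lborel. integrable lborel (\<lambda>\<xi>. case (t, \<xi>) of (t, \<xi>) \<Rightarrow> of_real (k t \<xi>) * cis (y \<bullet> \<xi>))"
      using kxi(1) by simp
  qed
  have inner: "(\<integral>t. of_real (k t \<xi>) * cis (y \<bullet> \<xi>) \<partial>lborel) = of_real \<kappa> * (of_real (1 / (1 + (norm \<xi>)\<^sup>2) ^ m) * cis (y \<bullet> \<xi>))" for y \<xi>
    by (subst integral_mult_left_zero) (simp add: kt)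
  have "integrable lborel (\<lambda>\<xi>. \<integral>t. of_real (k t \<xi>) * cis (0 \<bullet> \<xi>) \<partial>lborel)"
    using lborel_pair.integrable_snd[OF int2[of 0]] by simp
  then have "integrable lborel (\<lambda>\<xi>::real^'n. of_real (1 / \<kappa>) * (of_real \<kappa> * (of_real (1 / (1 + (norm \<xi>)\<^sup>2) ^ m) * cis (0 \<bullet> \<xi>))))"
    unfolding inner by (rule integrable_mult_right)
  then have "integrable lborel (\<lambda>\<xi>::real^'n. complex_of_real (1 / (1 + (norm \<xi>)\<^sup>2) ^ m))"
    using \<open>\<kappa> > 0\<close> by simp
  then show "integrable lborel (\<lambda>\<xi>::real^'n. 1 / (1 + (norm \<xi>)\<^sup>2) ^ m)"
    by (simp only: complex_of_real_integrable_eq)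
  have "(\<integral>\<xi>. of_real (1 / (1 + (norm \<xi>)\<^sup>2) ^ m) * cis (y \<bullet> \<xi>) \<partial>lborel) = of_real ((2 * sqrt (2 * pi) ^ CARD('n) / \<kappa>) * matern m y)" for y :: "real^'n"
  proof -
    have "of_real \<kappa> * (\<integral>\<xi>. of_real (1 / (1 + (norm \<xi>)\<^sup>2) ^ m) * cis (y \<bullet> \<xi>) \<partial>lborel) = (\<integral>\<xi>. (\<integral>t. of_real (k t \<xi>) * cis (y \<bullet> \<xi>) \<partial>lborel) \<partial>lborel)"
      unfolding inner by (rule integral_mult_right_zero[symmetric])
    also have "\<dots> = (\<integral>t. (\<integral>\<xi>. of_real (k t \<xi>) * cis (y \<bullet> \<xi>) \<partial>lborel) \<partial>lborel)"
      by (rule lborel_pair.Fubini_integral[OF int2])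
    also have "\<dots> = of_real (sqrt (2 * pi) ^ CARD('n) * (2 * matern m y))"
      unfolding kxi(2) integral_complex_of_real matern_mix[OF m] \<nu>_def[symmetric] by simp
    finally show ?thesis using \<open>\<kappa> > 0\<close> by (simp add: field_simps)
  qed
  then show "\<exists>B>0. \<forall>y::real^'n. (\<integral>\<xi>. of_real (1 / (1 + (norm \<xi>)\<^sup>2) ^ m) * cis (y \<bullet> \<xi>) \<partial>lborel) = of_real (B * matern m y)"
    using \<open>\<kappa> > 0\<close> by (intro exI[of _ "2 * sqrt (2 * pi) ^ CARD('n) / \<kappa>"]) auto
qed

section \<open>Convergence and uniform bounds of sums over the lattice\<close>

lemma summable_on_int_powr:
  assumes p: "p > 1 / 2"
  shows "(\<lambda>k::int. (1 + (real_of_int k)\<^sup>2) powr (- p)) summable_on UNIV"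
proof -
  let ?g = "\<lambda>k::int. (1 + (real_of_int k)\<^sup>2) powr (- p)"
  have "summable (\<lambda>n. (1 + (real n)\<^sup>2) powr (- p))"
  proof (rule summable_comparison_test'[where N=1])
    show "summable (\<lambda>n. real n powr (- (2 * p)))" using p by (simp add: summable_real_powr_iff)
    show "norm ((1 + (real n)\<^sup>2) powr (- p)) \<le> real n powr (- (2 * p))" if "n \<ge> 1" for n
    proof -
      have "(real n)\<^sup>2 = real n powr 2" using that by simp
      then have "((real n)\<^sup>2) powr (- p) = real n powr (- (2 * p))" by (simp only: powr_powr) simp
      then show ?thesis using p that powr_mono2'[of "- p" "(real n)\<^sup>2" "1 + (real n)\<^sup>2"] by simp
    qed
  qed
  then have nat: "(\<lambda>n. (1 + (real n)\<^sup>2) powr (- p)) summable_on UNIV"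
    by (subst summable_on_UNIV_nonneg_real_iff) auto
  have 1: "?g summable_on range int"
    by (subst summable_on_reindex) (use nat in \<open>auto simp: comp_def\<close>)
  have 2: "?g summable_on range (\<lambda>n. - int n)"
    by (subst summable_on_reindex) (use nat in \<open>auto simp: comp_def inj_on_def\<close>)
  have "?g summable_on (range int \<union> (range (\<lambda>n. - int n) - range int))"
    by (intro summable_on_Un_disjoint 1 summable_on_subset_banach[OF 2]) auto
  moreover have "range int \<union> (range (\<lambda>n. - int n) - range int) = UNIV"
  proof -
    have "k \<in> range int \<union> range (\<lambda>n. - int n)" for k
      using int_cases2[of k] by (metis UnI1 UnI2 rangeI)
    then show ?thesis by blast
  qed
  ultimately show ?thesis by simp
qed

lemma lattice_point_nth [simp]: "lattice_point j $ i = real_of_int (j $ i)"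
  by (simp add: lattice_point_def)

text \<open>
  The summand is dominated by the product of \<open>(1 + k\<^sub>i\<^sup>2)\<close> to the power \<open>- N / d\<close>.
\<close>

lemma summable_on_lattice:
  assumes N: "real N > real CARD('n) / 2"
  shows "(\<lambda>k::int^'n. 1 / (1 + (norm (lattice_point k))\<^sup>2) ^ N) summable_on UNIV"
proof -
  define p where "p = real N / real CARD('n)"
  have p: "p > 1 / 2" using N by (simp add: p_def field_simps)
  let ?w = "\<lambda>k::int. (1 + (real_of_int k)\<^sup>2) powr (- p)"
  have "Infinite_Set_Sum.abs_summable_on ?w UNIV"
    using summable_on_int_powr[OF p] by (simp add: abs_summable_equivalent[symmetric])
  then have "Infinite_Set_Sum.abs_summable_on (\<lambda>g. \<Prod>i\<in>(UNIV::'n set). ?w (g i)) (PiE UNIV (\<lambda>_. UNIV))"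
    by (intro abs_summable_on_prod_PiE) auto
  then have "(\<lambda>g. norm (\<Prod>i\<in>(UNIV::'n set). ?w (g i))) summable_on UNIV"
    by (simp add: abs_summable_equivalent[symmetric] PiE_UNIV_domain)
  then have "(\<lambda>g. \<Prod>i\<in>(UNIV::'n set). ?w (g i)) summable_on UNIV"
    by (rule abs_summable_summable)
  moreover have "bij (vec_nth :: int^'n \<Rightarrow> 'n \<Rightarrow> int)"
    by (rule bijI') (auto simp: vec_eq_iff fun_eq_iff intro: exI[of _ "vec_lambda _"])
  ultimately have *: "(\<lambda>k::int^'n. \<Prod>i\<in>(UNIV::'n set). ?w (k $ i)) summable_on UNIV"
    by (subst summable_on_reindex_bij_betw[where f="\<lambda>g. \<Prod>i\<in>(UNIV::'n set). ?w (g i)"])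
  show ?thesis
  proof (rule summable_on_comparison_test[OF *])
    fix k :: "int^'n"
    let ?b = "1 + (norm (lattice_point k))\<^sup>2"
    have b: "?b > 0" by (simp add: add_pos_nonneg)
    have "?b powr (- p) \<le> ?w (k $ i)" for i
    proof (rule powr_mono2')
      have "\<bar>lattice_point k $ i\<bar> \<le> norm (lattice_point k)" by (rule component_le_norm_cart)
      then have "\<bar>real_of_int (k $ i)\<bar>\<^sup>2 \<le> (norm (lattice_point k))\<^sup>2" by (intro power_mono) auto
      then show "1 + (real_of_int (k $ i))\<^sup>2 \<le> ?b" by simp
    qed (use p in \<open>auto simp: add_pos_nonneg\<close>)
    then have "(\<Prod>i\<in>(UNIV::'n set). ?b powr (- p)) \<le> (\<Prod>i\<in>(UNIV::'n set). ?w (k $ i))"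
      by (intro prod_mono) auto
    moreover have "(\<Prod>i\<in>(UNIV::'n set). ?b powr (- p)) = 1 / ?b ^ N"
    proof -
      have "(\<Prod>i\<in>(UNIV::'n set). ?b powr (- p)) = (?b powr (- p)) powr (real CARD('n))"
        using b by (simp add: powr_realpow)
      also have "\<dots> = ?b powr (- real N)" by (simp add: powr_powr p_def)
      finally show ?thesis using b by (simp add: powr_minus powr_realpow inverse_eq_divide)
    qed
    ultimately show "1 / ?b ^ N \<le> (\<Prod>i\<in>(UNIV::'n set). ?w (k $ i))" by simp
  qed (auto simp: add_nonneg_nonneg)
qed

text \<open>Shift the summation index by a lattice point nearest to \<open>y / a\<close>. Each
  coordinate of the remainder is then at most 1/2 in modulus, and subtracting an integer
  \<open>K\<close> from it leaves modulus at least \<open>|K| / 2\<close>. So up to a constant every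
  such sum is dominated by the one centred at 0.\<close>

lemma lattice_sum_bound:
  assumes N: "real N > real CARD('n) / 2" and a: "a > 0"
  shows "\<exists>S. \<forall>y::real^'n. (\<lambda>j. 1 / (1 + (norm (y - a *\<^sub>R lattice_point j))\<^sup>2) ^ N) summable_on UNIV
    \<and> (\<Sum>\<^sub>\<infinity>j. 1 / (1 + (norm (y - a *\<^sub>R lattice_point j))\<^sup>2) ^ N) \<le> S"
proof -
  \<comment> \<open>Chosen so that \<open>\<delta> * (1 + n\<^sup>2) \<le> 1 + a\<^sup>2 / 4 *
    n\<^sup>2\<close> for all \<open>n\<close>.\<close>
  define \<delta> where "\<delta> = min 1 (a\<^sup>2 / 4)"
  have \<delta>: "\<delta> > 0" "\<delta> \<le> 1" "\<delta> \<le> a\<^sup>2 / 4" using a by (auto simp: \<delta>_def)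
  define T where "T k = (1 / \<delta> ^ N) * (1 / (1 + (norm (lattice_point k))\<^sup>2) ^ N)" for k :: "int^'n"
  have T: "T summable_on UNIV" unfolding T_def by (intro summable_on_cmult_right summable_on_lattice N)
  have "(\<lambda>j. 1 / (1 + (norm (y - a *\<^sub>R lattice_point j))\<^sup>2) ^ N) summable_on UNIV
    \<and> (\<Sum>\<^sub>\<infinity>j. 1 / (1 + (norm (y - a *\<^sub>R lattice_point j))\<^sup>2) ^ N) \<le> infsum T UNIV" for y :: "real^'n"
  proof -
    define k0 :: "int^'n" where "k0 = (\<chi> i. round (y $ i / a))"
    have bij: "bij (\<lambda>k. k + k0)" by (rule bij_plus_right)
    let ?t = "\<lambda>j. 1 / (1 + (norm (y - a *\<^sub>R lattice_point j))\<^sup>2) ^ N"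
    have le: "?t (k + k0) \<le> T k" for k
    proof -
      let ?z = "y - a *\<^sub>R lattice_point (k + k0)"
      have "norm ((a / 2) *\<^sub>R lattice_point k) \<le> norm ?z"
      proof (rule norm_le_componentwise_cart)
        fix i
        have "\<bar>real_of_int (round (y $ i / a)) - y $ i / a\<bar> \<le> 1 / 2" by (rule of_int_round_abs_le)
        then have "\<bar>y $ i / a - real_of_int (k0 $ i)\<bar> \<le> 1 / 2" by (simp add: k0_def abs_minus_commute)
        moreover have "\<bar>real_of_int (k $ i)\<bar> \<ge> 1 \<or> k $ i = 0" by linarith
        moreover have "\<bar>K\<bar> / 2 \<le> \<bar>A - K\<bar>" if "\<bar>A\<bar> \<le> 1 / 2" "\<bar>K\<bar> \<ge> 1 \<or> K = 0" for A K :: real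
          using that by linarith
        ultimately have "\<bar>real_of_int (k $ i)\<bar> / 2 \<le> \<bar>y $ i / a - real_of_int (k0 $ i) - real_of_int (k $ i)\<bar>" by auto
        then have "a * (\<bar>real_of_int (k $ i)\<bar> / 2) \<le> a * \<bar>y $ i / a - real_of_int (k0 $ i) - real_of_int (k $ i)\<bar>"
          using a by (intro mult_left_mono) auto
        also have "\<dots> = \<bar>a * (y $ i / a - real_of_int (k0 $ i) - real_of_int (k $ i))\<bar>" using a by (simp add: abs_mult)
        also have "a * (y $ i / a - real_of_int (k0 $ i) - real_of_int (k $ i)) = ?z $ i"
          using a by (simp add: algebra_simps)
        finally show "norm (((a / 2) *\<^sub>R lattice_point k) $ i) \<le> norm (?z $ i)"
          using a by (simp add: abs_mult)
      qed
      then have "(norm ((a / 2) *\<^sub>R lattice_point k))\<^sup>2 \<le> (norm ?z)\<^sup>2" by (intro power_mono) auto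
      then have "a\<^sup>2 / 4 * (norm (lattice_point k))\<^sup>2 \<le> (norm ?z)\<^sup>2" by (simp add: power_mult_distrib power_divide)
      moreover have "\<delta> * (norm (lattice_point k))\<^sup>2 \<le> a\<^sup>2 / 4 * (norm (lattice_point k))\<^sup>2"
        using \<delta> by (intro mult_right_mono) auto
      ultimately have "\<delta> * (1 + (norm (lattice_point k))\<^sup>2) \<le> 1 + (norm ?z)\<^sup>2"
        using \<delta>(2) by (simp add: ring_distribs)
      then have "(\<delta> * (1 + (norm (lattice_point k))\<^sup>2)) ^ N \<le> (1 + (norm ?z)\<^sup>2) ^ N"
        using \<delta> by (intro power_mono) (auto simp: add_nonneg_nonneg)
      then have "?t (k + k0) \<le> 1 / (\<delta> * (1 + (norm (lattice_point k))\<^sup>2)) ^ N"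
        using \<delta>(1) by (intro divide_left_mono) (auto intro!: mult_pos_pos zero_less_power add_pos_nonneg)
      then show ?thesis by (simp add: T_def power_mult_distrib)
    qed
    have s: "(\<lambda>k. ?t (k + k0)) summable_on UNIV"
      by (rule summable_on_comparison_test[OF T]) (use le in auto)
    have "infsum (\<lambda>k. ?t (k + k0)) UNIV \<le> infsum T UNIV"
      by (rule infsum_mono[OF s T le])
    then show ?thesis
      using s summable_on_reindex_bij_betw[OF bij, of ?t] infsum_reindex_bij_betw[OF bij, of ?t] by simp
  qed
  then show ?thesis by blast
qed

section \<open>Poisson summation on the cubic lattice\<close>

lemma lborel_prod_vec:
  fixes g :: "'n::finite \<Rightarrow> real \<Rightarrow> 'b::{real_normed_field, banach, second_countable_topology}"
  assumes g: "\<And>i. integrable lborel (g i)"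
  shows "(\<integral>x. (\<Prod>i\<in>UNIV. g i (x $ i)) \<partial>lborel) = (\<Prod>i\<in>UNIV. \<integral>x. g i x \<partial>lborel)"
proof -
  define ix :: "real^'n \<Rightarrow> 'n" where "ix b = (SOME i. b = axis i 1)" for b
  have ix: "ix (axis i 1) = i" for i by (simp add: ix_def axis_eq_axis)
  have B: "(Basis :: (real^'n) set) = (\<lambda>i. axis i 1) ` UNIV" by (auto simp: Basis_vec_def)
  have inj: "inj (\<lambda>i::'n. axis i (1::real))" by (auto simp: inj_on_def axis_eq_axis)
  have "(\<Prod>i\<in>UNIV. g i (x $ i)) = (\<Prod>b\<in>Basis. g (ix b) (x \<bullet> b))" for x :: "real^'n"
    unfolding B by (subst prod.reindex[OF inj]) (simp add: ix inner_axis)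
  moreover have "(\<Prod>i\<in>UNIV. \<integral>x. g i x \<partial>lborel) = (\<Prod>b\<in>(Basis::(real^'n) set). \<integral>x. g (ix b) x \<partial>lborel)"
    unfolding B by (subst prod.reindex[OF inj]) (simp add: ix)
  ultimately show ?thesis
    using lborel_prod_Basis(2)[of "\<lambda>b::real^'n. g (ix b)"] g by simp
qed

text \<open>The compact counterpart of \<open>cube\<close>, on which continuous functions are
  bounded and integrable.\<close>

definition ccube :: "(real^'n) set" where
  "ccube = cbox (\<chi> i. - pi) (\<chi> i. pi)"

text \<open>
  Half open, so that its translates by \<open>2 \<pi> \<int>\<^sup>d\<close> tile the space.
\<close>

definition cube :: "(real^'n) set" where
  "cube = {t. \<forall>i. - pi \<le> t $ i \<and> t $ i < pi}"

lemma mem_ccube: "t \<in> ccube \<longleftrightarrow> (\<forall>i. \<bar>t $ i\<bar> \<le> pi)"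
proof -
  have "t \<in> ccube \<longleftrightarrow> (\<forall>i. - pi \<le> t $ i \<and> t $ i \<le> pi)" by (simp add: ccube_def mem_box_cart)
  then show ?thesis by (simp add: abs_le_iff) (metis minus_le_iff)
qed

lemma compact_ccube: "compact ccube"
  by (simp add: ccube_def)

lemma cube_subset_ccube: "cube \<subseteq> ccube"
proof
  fix t :: "real^'n" assume "t \<in> cube"
  then have *: "- pi \<le> t $ i" "t $ i < pi" for i by (auto simp: cube_def)
  have "\<bar>t $ i\<bar> \<le> pi" for i using *[of i] by linarith
  then show "t \<in> ccube" by (simp add: mem_ccube)
qed

lemma cube_measurable [measurable]: "cube \<in> sets borel"
  unfolding cube_def by measurable

lemma cube_integrable:
  fixes f :: "real^'n \<Rightarrow> 'b::{banach, second_countable_topology}"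
  assumes "continuous_on ccube f"
  shows "integrable lborel (\<lambda>x. indicator cube x *\<^sub>R f x)"
proof -
  have "integrable lborel (\<lambda>x. indicator cube x *\<^sub>R (indicator ccube x *\<^sub>R f x))"
    by (rule integrable_mult_indicator[OF _ borel_integrable_compact[OF compact_ccube assms]]) simp
  moreover have "indicator cube x *\<^sub>R (indicator ccube x *\<^sub>R f x) = indicator cube x *\<^sub>R f x" for x
    using cube_subset_ccube by (auto split: split_indicator)
  ultimately show ?thesis by (simp only:)
qed

section \<open>Fourier coefficients on the cube\<close>

lemma cis_integral_interval:
  "integrable lborel (\<lambda>x. indicator {-pi..<pi} x *\<^sub>R cis (real_of_int k * x))"
  "(\<integral>x. indicator {-pi..<pi} x *\<^sub>R cis (real_of_int k * x) \<partial>lborel) = (if k = 0 then of_real (2 * pi) else 0)"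
proof -
  let ?f = "\<lambda>x. cis (real_of_int k * x)"
  have c: "continuous_on {-pi..pi} ?f" by (intro continuous_intros)
  have i: "integrable lborel (\<lambda>x. indicator {-pi..pi} x *\<^sub>R ?f x)"
    by (rule borel_integrable_compact[OF _ c]) auto
  have ae: "AE x in lborel. indicator {-pi..pi} x *\<^sub>R ?f x = indicator {-pi..<pi} x *\<^sub>R ?f x"
    using AE_lborel_singleton[of pi] by eventually_elim (auto split: split_indicator)
  show "integrable lborel (\<lambda>x. indicator {-pi..<pi} x *\<^sub>R ?f x)"
    by (rule integrable_cong_AE_imp[OF i]) (use ae in auto)
  have "(\<integral>x. indicator {-pi..<pi} x *\<^sub>R ?f x \<partial>lborel) = (\<integral>x. indicator {-pi..pi} x *\<^sub>R ?f x \<partial>lborel)"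
    by (rule integral_cong_AE) (use ae in auto)
  also have "\<dots> = (if k = 0 then of_real (2 * pi) else 0)"
  proof (cases "k = 0")
    case True
    have "(\<integral>x. indicator {-pi..pi} x *\<^sub>R ?f x \<partial>lborel) = complex_of_real pi - complex_of_real (-pi)"
    proof (rule integral_FTC_Icc[OF _ _ c])
      show "(complex_of_real has_vector_derivative ?f x) (at x within {-pi..pi})" for x
        using True has_vector_derivative_of_real[OF DERIV_ident[of "at x within {-pi..pi}"], where 'a=complex] by simp
    qed simp
    then show ?thesis using True by simp
  next
    case False
    define F where "F x = exp (\<i> * of_int k * complex_of_real x) / (\<i> * of_int k)" for x
    have "(\<integral>x. indicator {-pi..pi} x *\<^sub>R ?f x \<partial>lborel) = F pi - F (-pi)"
    proof (rule integral_FTC_Icc[OF _ _ c])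
      show "(F has_vector_derivative ?f x) (at x within {-pi..pi})" for x
        unfolding F_def
      proof (rule has_vector_derivative_real_field)
        show "((\<lambda>z. exp (\<i> * of_int k * z) / (\<i> * of_int k)) has_field_derivative ?f x) (at (complex_of_real x))"
          using False by (auto intro!: derivative_eq_intros simp: cis_conv_exp mult_ac)
      qed
    qed simp
    also have "F pi = F (-pi)"
    proof -
      have "exp (\<i> * of_int k * complex_of_real pi) = exp (\<i> * of_int k * complex_of_real (-pi)) * cis (2 * pi * real_of_int k)"
        unfolding cis_conv_exp exp_add[symmetric] by (rule arg_cong[where f=exp]) (simp add: algebra_simps)
      also have "cis (2 * pi * real_of_int k) = 1" by (rule cis_multiple_2pi) simp
      finally show ?thesis unfolding F_def by (simp only: mult_1_right)
    qed
    finally show ?thesis using False by simp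
  qed
  finally show "(\<integral>x. indicator {-pi..<pi} x *\<^sub>R ?f x \<partial>lborel) = (if k = 0 then of_real (2 * pi) else 0)" .
qed

lemma inner_vec_sum: "(x::real^'n) \<bullet> y = (\<Sum>i\<in>UNIV. x $ i * y $ i)"
  by (simp add: inner_vec_def)

lemma cis_integral_cube:
  "(\<integral>t. indicator cube t *\<^sub>R cis (lattice_point j \<bullet> t) \<partial>lborel) = (if j = 0 then of_real ((2 * pi) ^ CARD('n)) else 0)"
  for j :: "int^'n"
proof -
  have "indicator cube t *\<^sub>R cis (lattice_point j \<bullet> t)
      = (\<Prod>i\<in>UNIV. indicator {-pi..<pi} (t $ i) *\<^sub>R cis (real_of_int (j $ i) * t $ i))" for t :: "real^'n"
  proof -
    have "(indicator cube t :: real) = (\<Prod>i\<in>UNIV. indicator {-pi..<pi} (t $ i))"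
      by (auto simp: cube_def indicator_def)
    then show ?thesis by (simp add: inner_vec_sum cis_sum scaleR_conv_of_real prod.distrib)
  qed
  then have "(\<integral>t. indicator cube t *\<^sub>R cis (lattice_point j \<bullet> t) \<partial>lborel)
     = (\<Prod>i\<in>(UNIV::'n set). (if j $ i = 0 then of_real (2 * pi) else 0))"
    by (simp only: lborel_prod_vec[OF cis_integral_interval(1)] cis_integral_interval(2))
  also have "\<dots> = (if j = 0 then of_real ((2 * pi) ^ CARD('n)) else 0)"
    by (auto simp: vec_eq_iff)
  finally show ?thesis .
qed

lemma lattice_point_add: "lattice_point (j + k) = lattice_point j + lattice_point k"
  by (simp add: vec_eq_iff)

lemma lattice_point_minus: "lattice_point (- j) = - lattice_point j"
  by (simp add: vec_eq_iff)

lemma lattice_point_diff: "lattice_point (j - k) = lattice_point j - lattice_point k"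
  by (simp add: vec_eq_iff)

lemma lattice_point_0 [simp]: "lattice_point 0 = 0"
  by (simp add: vec_eq_iff)

lemma lattice_point_axis: "lattice_point (axis i 1) = axis i 1"
  by (simp add: vec_eq_iff axis_def)

text \<open>The cosine is half the sum of two characters, so the factor
  \<open>1 + cos (t $ i)\<close> merely combines the coefficients at \<open>j\<close>,
  \<open>j + axis i 1\<close> and \<open>j - axis i 1\<close>, all of which vanish.\<close>

lemma orthogonal_mult_cos:
  fixes W :: "real^'n \<Rightarrow> complex"
  assumes c: "continuous_on ccube W"
    and W: "\<And>j. (\<integral>t. indicator cube t *\<^sub>R (W t * cis (lattice_point j \<bullet> t)) \<partial>lborel) = 0"
  shows "(\<integral>t. indicator cube t *\<^sub>R (W t * of_real (1 + cos (t $ i)) * cis (lattice_point j \<bullet> t)) \<partial>lborel) = 0"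
proof -
  let ?I = "\<lambda>j t. indicator cube t *\<^sub>R (W t * cis (lattice_point j \<bullet> t))"
  have int: "integrable lborel (?I j)" for j
    by (rule cube_integrable) (intro continuous_intros c)
  have eq: "indicator cube t *\<^sub>R (W t * of_real (1 + cos (t $ i)) * cis (lattice_point j \<bullet> t))
      = ?I j t + (1/2) *\<^sub>R ?I (j + axis i 1) t + (1/2) *\<^sub>R ?I (j - axis i 1) t" for t
  proof -
    have "complex_of_real (cos (t $ i)) = (1/2) * (cis (t $ i) + cis (- (t $ i)))" by (simp add: complex_eq_iff)
    moreover have "lattice_point (j + axis i 1) \<bullet> t = lattice_point j \<bullet> t + t $ i"
      "lattice_point (j - axis i 1) \<bullet> t = lattice_point j \<bullet> t + - (t $ i)"
      by (simp_all add: lattice_point_add lattice_point_diff lattice_point_axis inner_left_distrib inner_diff_left inner_axis')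
    ultimately show ?thesis
      by (simp only: cis_mult[symmetric] of_real_add of_real_1 scaleR_conv_of_real) (simp add: algebra_simps)
  qed
  show ?thesis
    unfolding eq
    by (subst Bochner_Integration.integral_add, (intro int integrable_scaleR_right Bochner_Integration.integrable_add)+)+
       (simp only: integral_scaleR_right W, simp)
qed

text \<open>One cosine factor is multiplied in at a time. All indices \<open>j\<close> have to be
  carried through the inductions because each factor mixes neighbouring coefficients;
  \<open>j = 0\<close> is selected at the end.\<close>

lemma orthogonal_cos_power:
  fixes D :: "real^'n \<Rightarrow> complex"
  assumes c: "continuous_on ccube D"
    and D: "\<And>j. (\<integral>t. indicator cube t *\<^sub>R (D t * cis (lattice_point j \<bullet> t)) \<partial>lborel) = 0"
  shows "(\<integral>t. indicator cube t *\<^sub>R (D t * of_real ((\<Prod>i\<in>UNIV. 1 + cos (t $ i)) ^ n)) \<partial>lborel) = 0"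
proof -
  have step: "(\<integral>t. indicator cube t *\<^sub>R (W t * of_real (\<Prod>i\<in>I. 1 + cos (t $ i)) * cis (lattice_point j \<bullet> t)) \<partial>lborel) = 0"
    if cW: "continuous_on ccube W" and W: "\<And>j. (\<integral>t. indicator cube t *\<^sub>R (W t * cis (lattice_point j \<bullet> t)) \<partial>lborel) = 0"
    for W :: "real^'n \<Rightarrow> complex" and I j
  proof (induction I arbitrary: j rule: infinite_finite_induct)
    case (insert i I)
    have "continuous_on ccube (\<lambda>t. W t * of_real (\<Prod>i\<in>I. 1 + cos (t $ i)))" by (intro continuous_intros cW)
    from orthogonal_mult_cos[OF this insert.IH, of i j] insert.hyps
    show ?case by (simp add: mult_ac)
  qed (use W in auto)
  have "(\<integral>t. indicator cube t *\<^sub>R (D t * of_real ((\<Prod>i\<in>UNIV. 1 + cos (t $ i)) ^ n) * cis (lattice_point j \<bullet> t)) \<partial>lborel) = 0" for j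
  proof (induction n arbitrary: j)
    case (Suc n)
    have "continuous_on ccube (\<lambda>t. D t * of_real ((\<Prod>i\<in>UNIV. 1 + cos (t $ i)) ^ n))" by (intro continuous_intros c)
    from step[OF this Suc.IH, of UNIV j]
    show ?case by (simp add: mult_ac)
  qed (use D in auto)
  from this[of 0] show ?thesis by simp
qed

text \<open>
  The trigonometric polynomials \<open>(\<Prod>i. 1 + cos t\<^sub>i)\<^sup>n\<close> are orthogonal to \<open>D\<close>, but concentrate at \<open>0\<close>
  as \<open>n\<close> grows, which is impossible if \<open>D 0 \<noteq> 0\<close>.
\<close>

lemma fourier_uniqueness_at_0:
  fixes D :: "real^'n \<Rightarrow> complex"
  assumes c: "continuous_on ccube D"
    and D: "\<And>j. (\<integral>t. indicator cube t *\<^sub>R (D t * cis (lattice_point j \<bullet> t)) \<partial>lborel) = 0"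
  shows "D 0 = 0"
proof (rule ccontr)
  assume D0: "D 0 \<noteq> 0"
  \<comment> \<open>Rotated so that the value at 0 is the positive number
    \<open>(norm (D 0))\<^sup>2\<close>.\<close>
  define E where "E t = Re (cnj (D 0) * D t)" for t
  define K where "K t = (\<Prod>i\<in>UNIV. 1 + cos (t $ i))" for t :: "real^'n"
  have K0: "K t \<ge> 0" for t
    unfolding K_def
  proof (rule prod_nonneg)
    show "0 \<le> 1 + cos (t $ i)" for i using cos_ge_minus_one[of "t $ i"] by linarith
  qed
  have Kc: "continuous_on A K" for A unfolding K_def by (intro continuous_intros)
  have Ec: "continuous_on ccube E" unfolding E_def by (intro continuous_intros c)
  have EK: "integrable lborel (\<lambda>t. indicator cube t *\<^sub>R (E t * K t ^ n))" for n
    by (rule cube_integrable) (intro continuous_intros Ec Kc)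
  have EK0: "(\<integral>t. indicator cube t *\<^sub>R (E t * K t ^ n) \<partial>lborel) = 0" for n
  proof -
    have i: "integrable lborel (\<lambda>t. cnj (D 0) * (indicator cube t *\<^sub>R (D t * of_real (K t ^ n))))"
      by (intro integrable_mult_right cube_integrable continuous_intros c Kc)
    have Re_mult: "Re (complex_of_real r * z) = r * Re z" for r z by simp
    have "(\<integral>t. indicator cube t *\<^sub>R (E t * K t ^ n) \<partial>lborel) = (\<integral>t. Re (cnj (D 0) * (indicator cube t *\<^sub>R (D t * of_real (K t ^ n)))) \<partial>lborel)"
    proof (rule Bochner_Integration.integral_cong[OF refl])
      fix t
      have "cnj (D 0) * (indicator cube t *\<^sub>R (D t * of_real (K t ^ n))) = of_real (indicator cube t * K t ^ n) * (cnj (D 0) * D t)"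
        by (simp add: scaleR_conv_of_real mult_ac)
      then show "indicator cube t *\<^sub>R (E t * K t ^ n) = Re (cnj (D 0) * (indicator cube t *\<^sub>R (D t * of_real (K t ^ n))))"
        using Re_mult[of "indicator cube t * K t ^ n" "cnj (D 0) * D t"] by (simp only: E_def) (simp add: mult_ac)
    qed
    also have "\<dots> = Re (\<integral>t. cnj (D 0) * (indicator cube t *\<^sub>R (D t * of_real (K t ^ n))) \<partial>lborel)"
      by (rule integral_Re[OF i])
    also have "\<dots> = 0"
      unfolding integral_mult_right_zero using orthogonal_cos_power[OF c D, of n, folded K_def]
      by (simp del: of_real_power)
    finally show ?thesis .
  qed
  define a where "a = E 0 / 2"
  have "E 0 = (norm (D 0))\<^sup>2" unfolding cmod_power2 by (simp add: E_def power2_eq_square)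
  then have a: "a > 0" "E 0 > a" using D0 by (auto simp: a_def)
  have z: "(0::real^'n) \<in> ccube" by (simp add: mem_ccube)
  obtain \<delta> where \<delta>: "\<delta> > 0" "\<And>t. t \<in> ccube \<Longrightarrow> norm t < \<delta> \<Longrightarrow> E t > a"
  proof -
    have "\<exists>d>0. \<forall>x'\<in>ccube. dist x' 0 < d \<longrightarrow> dist (E x') (E 0) < a"
      using Ec z a(1) unfolding continuous_on_iff by blast
    then obtain d where "d > 0" and d: "\<And>x'. x' \<in> ccube \<Longrightarrow> norm x' < d \<Longrightarrow> \<bar>E x' - E 0\<bar> < a"
      by (auto simp: dist_real_def)
    show ?thesis
    proof (rule that[OF \<open>d > 0\<close>])
      fix t :: "real^'n" assume "t \<in> ccube" "norm t < d"
      from d[OF this] show "E t > a" unfolding a_def by linarith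
    qed
  qed
  obtain B where B: "B > 0" "\<And>t. t \<in> ccube \<Longrightarrow> \<bar>E t\<bar> \<le> B"
  proof -
    have "bounded (E ` ccube)" by (intro compact_imp_bounded compact_continuous_image Ec compact_ccube)
    then show ?thesis unfolding bounded_pos using that by auto
  qed
  \<comment> \<open>The value of \<open>K\<close> at 0. On the closed cube it is the maximum and is
    attained at 0 only, since \<open>cos\<close> equals 1 on \<open>[-pi, pi]\<close> only at 0;
    compactness then gives a strictly smaller bound \<open>M\<close> away from 0.\<close>
  define P :: real where "P = 2 ^ CARD('n)"
  obtain M where M: "M \<ge> 0" "M < P" "\<And>t. t \<in> ccube \<Longrightarrow> norm t \<ge> \<delta> \<Longrightarrow> K t \<le> M"
  proof (cases "ccube \<inter> {t::real^'n. norm t \<ge> \<delta>} = {}")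
    case True
    then show ?thesis using that[of 0] by (auto simp: P_def)
  next
    case False
    have "compact (ccube \<inter> {t::real^'n. norm t \<ge> \<delta>})"
      by (intro compact_Int_closed compact_ccube closed_Collect_le continuous_intros)
    from continuous_attains_sup[OF this False Kc]
    obtain s where s: "s \<in> ccube" "norm s \<ge> \<delta>" "\<And>t. t \<in> ccube \<Longrightarrow> norm t \<ge> \<delta> \<Longrightarrow> K t \<le> K s" by auto
    have "s \<noteq> 0" using s \<delta>(1) by auto
    then obtain i where i: "s $ i \<noteq> 0" by (auto simp: vec_eq_iff)
    have "cos (s $ i) \<noteq> 1"
    proof
      assume "cos (s $ i) = 1"
      moreover have "\<bar>s $ i\<bar> \<le> pi" using s(1) by (simp add: mem_ccube)
      moreover have "cos \<bar>s $ i\<bar> = cos (s $ i)" by simp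
      ultimately have "cos \<bar>s $ i\<bar> = cos 0" "\<bar>s $ i\<bar> \<in> {0..pi}" by auto
      then have "\<bar>s $ i\<bar> = 0" using cos_inj_pi[of "\<bar>s $ i\<bar>" 0] by auto
      then show False using i by simp
    qed
    then have ci: "1 + cos (s $ i) < 2" using cos_le_one[of "s $ i"] by linarith
    have "K s = (1 + cos (s $ i)) * (\<Prod>j\<in>UNIV - {i}. 1 + cos (s $ j))"
      unfolding K_def by (subst prod.remove[of _ i]) auto
    also have "\<dots> \<le> (1 + cos (s $ i)) * (\<Prod>j\<in>UNIV - {i}. 2)"
    proof (intro mult_left_mono prod_mono conjI)
      show "0 \<le> 1 + cos (s $ i)" using cos_ge_minus_one[of "s $ i"] by linarith
      show "0 \<le> 1 + cos (s $ j)" for j using cos_ge_minus_one[of "s $ j"] by linarith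
      show "1 + cos (s $ j) \<le> 2" for j using cos_le_one[of "s $ j"] by linarith
    qed
    also have "\<dots> < 2 * (\<Prod>j\<in>UNIV - {i}. 2)" by (intro mult_strict_right_mono ci prod_pos) auto
    also have "\<dots> = (\<Prod>j\<in>(UNIV::'n set). 2)" by (subst prod.remove[of _ i]) auto
    also have "\<dots> = P" by (simp add: P_def)
    finally show ?thesis using that[of "K s"] s K0 by auto
  qed
  \<comment> \<open>A level strictly between \<open>M\<close> and \<open>P\<close>: \<open>K\<close>
    is at least \<open>M'\<close> near 0 and at most \<open>M\<close> away from 0, and
    \<open>(M / M') ^ n\<close> tends to 0.\<close>
  define M' where "M' = (M + P) / 2"
  have M': "M < M'" "M' < P" "M' > 0" using M by (auto simp: M'_def)
  obtain \<eta> where \<eta>: "\<eta> > 0" "\<eta> \<le> \<delta>" "\<eta> \<le> pi" "\<And>t. norm t < \<eta> \<Longrightarrow> K t \<ge> M'"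
  proof -
    have "K 0 = P" by (simp add: K_def P_def)
    have "\<exists>d>0. \<forall>x'\<in>UNIV. dist x' 0 < d \<longrightarrow> dist (K x') (K 0) < P - M'"
    proof -
      have "P - M' > 0" using M'(2) by simp
      then show ?thesis using Kc[of UNIV, unfolded continuous_on_iff] by blast
    qed
    then obtain d where d: "d > 0" "\<And>x'. norm x' < d \<Longrightarrow> \<bar>K x' - K 0\<bar> < P - M'"
      by (auto simp: dist_real_def)
    have "K t \<ge> M'" if "norm t < d" for t using d(2)[OF that] \<open>K 0 = P\<close> by linarith
    then show ?thesis using that[of "min d (min \<delta> pi)"] d(1) \<delta>(1) by auto
  qed
  have ball_cube: "ball 0 \<eta> \<subseteq> (cube :: (real^'n) set)"
  proof
    fix t :: "real^'n" assume "t \<in> ball 0 \<eta>"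
    then have "\<bar>t $ i\<bar> < pi" for i using component_le_norm_cart[of t i] \<eta>(3) by simp
    then show "t \<in> cube" by (auto simp: cube_def abs_less_iff less_imp_le) (smt (verit))
  qed
  define v where "v = measure lborel (ball (0::real^'n) \<eta>)"
  have v: "v > 0" unfolding v_def using \<eta>(1) content_ball_pos by blast
  define V where "V = (\<integral>t. indicator (cube::(real^'n) set) t *\<^sub>R (1::real) \<partial>lborel)"
  have ci: "integrable lborel (\<lambda>t. indicator (cube::(real^'n) set) t *\<^sub>R (1::real))"
    by (rule cube_integrable) (intro continuous_intros)
  have V: "V \<ge> 0" unfolding V_def by (intro integral_nonneg_AE) auto
  \<comment> \<open>The vanishing integral of \<open>E t * K t ^ n\<close> is bounded from below:
    the integrand is at least \<open>a * M' ^ n\<close> on the ball of radius \<open>\<eta>\<close>,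
    nonnegative from there up to radius \<open>\<delta>\<close>, and at least
    \<open>- B * M ^ n\<close> on the rest of the cube.\<close>
  have ineq: "a * M' ^ n * v \<le> B * M ^ n * V" for n
  proof -
    have bi: "integrable lborel (\<lambda>t. indicator (ball (0::real^'n) \<eta>) t :: real)"
      by (rule integrable_real_indicator) (use emeasure_bounded_finite[OF bounded_ball, of "0::real^'n" \<eta>] in auto)
    have "a * M' ^ n * v - B * M ^ n * V = (\<integral>t. a * M' ^ n * indicator (ball (0::real^'n) \<eta>) t - B * M ^ n * (indicator cube t *\<^sub>R 1) \<partial>lborel)"
      using bi ci by (simp add: v_def V_def)
    also have "\<dots> \<le> (\<integral>t. indicator cube t *\<^sub>R (E t * K t ^ n) \<partial>lborel)"
    proof (rule integral_mono)
      show "integrable lborel (\<lambda>t. a * M' ^ n * indicator (ball (0::real^'n) \<eta>) t - B * M ^ n * (indicator cube t *\<^sub>R 1))"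
        by (intro Bochner_Integration.integrable_diff integrable_mult_right bi ci)
      fix t :: "real^'n"
      have BM: "B * M ^ n \<ge> 0" using B M by simp
      show "a * M' ^ n * indicator (ball 0 \<eta>) t - B * M ^ n * (indicator cube t *\<^sub>R 1) \<le> indicator cube t *\<^sub>R (E t * K t ^ n)"
      proof (cases "t \<in> cube")
        case False
        then show ?thesis using ball_cube by (auto simp: indicator_def)
      next
        case True
        then have tc: "t \<in> ccube" using cube_subset_ccube by blast
        consider "norm t < \<eta>" | "\<eta> \<le> norm t" "norm t < \<delta>" | "norm t \<ge> \<delta>" by linarith
        then show ?thesis
        proof cases
          case 1
          have "a * M' ^ n \<le> E t * K t ^ n"
            using \<delta>(2)[OF tc] 1 \<eta> M' a by (intro mult_mono power_mono) (auto intro: less_imp_le)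
          then show ?thesis using 1 True BM by simp
        next
          case 2
          then have "E t * K t ^ n \<ge> 0" using \<delta>(2)[OF tc] a K0[of t] by (intro mult_nonneg_nonneg) auto
          then show ?thesis using 2 True BM by simp
        next
          case 3
          have "\<bar>E t * K t ^ n\<bar> \<le> B * M ^ n"
            unfolding abs_mult using B(2)[OF tc] M(3)[OF tc 3] K0[of t] B(1)
            by (intro mult_mono) (auto intro: power_mono)
          then show ?thesis using 3 True \<eta>(2) by simp
        qed
      qed
    qed (rule EK)
    finally show ?thesis unfolding EK0 by simp
  qed
  have "(\<lambda>n. B * (M / M') ^ n * V) \<longlonglongrightarrow> B * 0 * V"
    using M M' by (intro tendsto_intros LIMSEQ_realpow_zero) auto
  moreover have "a * v \<le> B * (M / M') ^ n * V" for n
  proof -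
    have "a * v = (a * M' ^ n * v) / M' ^ n" using M'(3) by simp
    also have "\<dots> \<le> (B * M ^ n * V) / M' ^ n" using M'(3) by (intro divide_right_mono ineq) auto
    finally show ?thesis by (simp add: power_divide)
  qed
  ultimately have "a * v \<le> B * 0 * V" by (intro LIMSEQ_le_const) auto
  then show False using a v by (simp add: mult_le_0_iff)
qed

text \<open>In a coordinate with \<open>k $ i \<noteq> 0\<close> the right-hand side has modulus at
  least \<open>2 * pi * |k $ i| - pi\<close>, hence at least \<open>pi * |k $ i|\<close>; in the
  other coordinates the left-hand side is 0.\<close>

lemma norm_lattice_translate_cube:
  fixes t :: "real^'n"
  assumes "t \<in> ccube"
  shows "norm (pi *\<^sub>R lattice_point k) \<le> norm (t + (2 * pi) *\<^sub>R lattice_point k)"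
proof (rule norm_le_componentwise_cart)
  fix i
  have 1: "\<bar>t $ i\<bar> \<le> pi" using assms by (simp add: mem_ccube)
  have 2: "\<bar>real_of_int (k $ i)\<bar> \<ge> 1 \<or> real_of_int (k $ i) = 0" by (cases "k $ i = 0") auto
  have "\<bar>pi * K\<bar> \<le> \<bar>A + 2 * pi * K\<bar>" if A: "\<bar>A\<bar> \<le> pi" and K: "\<bar>K\<bar> \<ge> 1 \<or> K = 0" for A K :: real
  proof (cases "K = 0")
    case False
    then have "pi * 1 \<le> pi * \<bar>K\<bar>" using K by (intro mult_left_mono) auto
    moreover have "\<bar>2 * pi * K\<bar> = 2 * (pi * \<bar>K\<bar>)" "\<bar>pi * K\<bar> = pi * \<bar>K\<bar>" by (simp_all add: abs_mult)
    ultimately show ?thesis using A by linarith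
  qed simp
  from this[OF 1 2] show "norm ((pi *\<^sub>R lattice_point k) $ i) \<le> norm ((t + (2 * pi) *\<^sub>R lattice_point k) $ i)"
    by simp
qed

lemma decay_translate_cube:
  fixes t :: "real^'n"
  assumes "t \<in> ccube"
  shows "1 / (1 + (norm (t + (2 * pi) *\<^sub>R lattice_point k))\<^sup>2) ^ N \<le> 1 / (1 + (norm (lattice_point k :: real^'n))\<^sup>2) ^ N"
proof -
  have "norm (lattice_point k :: real^'n) \<le> norm (pi *\<^sub>R lattice_point k :: real^'n)"
    using pi_ge_two by (simp add: mult_le_cancel_right1)
  also note norm_lattice_translate_cube[OF assms]
  finally have "(1 + (norm (lattice_point k :: real^'n))\<^sup>2) ^ N \<le> (1 + (norm (t + (2 * pi) *\<^sub>R lattice_point k))\<^sup>2) ^ N"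
    by (intro power_mono add_left_mono) auto
  then show ?thesis
    by (intro divide_left_mono) (auto intro!: mult_pos_pos zero_less_power add_pos_nonneg)
qed

text \<open>Coordinatewise the condition says that \<open>k $ i\<close> is the floor of
  \<open>(s $ i + pi) / (2 * pi)\<close>.\<close>

lemma cube_translate_ex1:
  "\<exists>!k::int^'n. s - (2 * pi) *\<^sub>R lattice_point k \<in> cube"
proof -
  have eq: "- pi \<le> x - 2 * pi * real_of_int l \<and> x - 2 * pi * real_of_int l < pi \<longleftrightarrow> l = \<lfloor>(x + pi) / (2 * pi)\<rfloor>" for x l
  proof -
    have "l = \<lfloor>(x + pi) / (2 * pi)\<rfloor> \<longleftrightarrow> real_of_int l \<le> (x + pi) / (2 * pi) \<and> (x + pi) / (2 * pi) < real_of_int l + 1"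
      by (metis floor_unique floor_correct of_int_1 of_int_add)
    also have "\<dots> \<longleftrightarrow> - pi \<le> x - 2 * pi * real_of_int l \<and> x - 2 * pi * real_of_int l < pi"
      by (auto simp: pos_le_divide_eq pos_divide_less_eq algebra_simps)
    finally show ?thesis ..
  qed
  show ?thesis
    by (rule ex1I[of _ "\<chi> i. \<lfloor>(s $ i + pi) / (2 * pi)\<rfloor>"]) (auto simp: cube_def eq vec_eq_iff)
qed

lemma continuous_on_infsum_dominated:
  fixes f :: "'i \<Rightarrow> 'a::topological_space \<Rightarrow> complex"
  assumes c: "\<And>k. continuous_on A (f k)"
    and b: "\<And>k t. t \<in> A \<Longrightarrow> norm (f k t) \<le> M k" and M: "M summable_on UNIV"
  shows "continuous_on A (\<lambda>t. \<Sum>\<^sub>\<infinity>k. f k t)"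
proof (rule uniform_limit_theorem)
  show "uniform_limit A (\<lambda>X t. \<Sum>k\<in>X. f k t) (\<lambda>t. \<Sum>\<^sub>\<infinity>k. f k t) (finite_subsets_at_top UNIV)"
    by (rule Weierstrass_m_test_general[OF b M])
  show "\<forall>\<^sub>F X in finite_subsets_at_top UNIV. continuous_on A (\<lambda>t. \<Sum>k\<in>X. f k t)"
    by (intro always_eventually allI continuous_on_sum c)
qed simp

text \<open>The periodisation \<open>H\<close> of \<open>u\<close> and the Fourier series
  \<open>P\<close> are continuous on the closed cube and have the same coefficients, so they agree
  at 0. Continuity of \<open>H\<close> comes from the decay of \<open>u\<close>, that of
  \<open>P\<close> from the summability of the transform.\<close>

lemma poisson_summation:
  fixes u :: "real^'n \<Rightarrow> complex"
  assumes uc: "continuous_on UNIV u" and ui: "integrable lborel u"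
    and ub: "\<And>t. norm (u t) \<le> C / (1 + (norm t)\<^sup>2) ^ N" and N: "real N > real CARD('n) / 2"
    and us: "(\<lambda>j. norm (\<integral>t. u t * cis (- (lattice_point j \<bullet> t)) \<partial>lborel)) summable_on UNIV"
  shows "(\<Sum>\<^sub>\<infinity>k. u ((2 * pi) *\<^sub>R lattice_point k))
    = of_real (1 / (2 * pi) ^ CARD('n)) * (\<Sum>\<^sub>\<infinity>j. \<integral>t. u t * cis (- (lattice_point j \<bullet> t)) \<partial>lborel)"
proof -
  define uh where "uh j = (\<integral>t. u t * cis (- (lattice_point j \<bullet> t)) \<partial>lborel)" for j
  have us: "(\<lambda>j. norm (uh j)) summable_on UNIV" using us by (simp add: uh_def)
  define c where "c = 1 / (2 * pi) ^ CARD('n)"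
  have c: "c > 0" by (simp add: c_def)
  have C: "C \<ge> 0" using order_trans[OF norm_ge_zero ub[of 0]] by simp
  define M where "M k = C * (1 / (1 + (norm (lattice_point k :: real^'n))\<^sup>2) ^ N)" for k
  have Ms: "M summable_on UNIV" unfolding M_def by (intro summable_on_cmult_right summable_on_lattice N)
  have M0: "M k \<ge> 0" for k using C by (simp add: M_def)
  have [measurable]: "u \<in> borel_measurable borel" by (rule borel_measurable_continuous_onI[OF uc])
  have uM: "norm (u (t + (2 * pi) *\<^sub>R lattice_point k)) \<le> M k" if "t \<in> ccube" for t k
  proof -
    have "norm (u (t + (2 * pi) *\<^sub>R lattice_point k)) \<le> C * (1 / (1 + (norm (t + (2 * pi) *\<^sub>R lattice_point k))\<^sup>2) ^ N)"
      using ub[of "t + (2 * pi) *\<^sub>R lattice_point k"] by simp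
    also have "\<dots> \<le> M k" unfolding M_def by (rule mult_left_mono[OF decay_translate_cube[OF that] C])
    finally show ?thesis .
  qed
  define H where "H t = (\<Sum>\<^sub>\<infinity>k. u (t + (2 * pi) *\<^sub>R lattice_point k))" for t
  define P where "P t = (\<Sum>\<^sub>\<infinity>j. of_real c * uh j * cis (lattice_point j \<bullet> t))" for t :: "real^'n"
  have uck: "continuous_on A (\<lambda>t. u (t + (2 * pi) *\<^sub>R lattice_point k))" for A k
    by (rule continuous_on_compose2[OF uc]) (auto intro!: continuous_intros)
  have Hc: "continuous_on ccube H"
    unfolding H_def by (rule continuous_on_infsum_dominated[OF uck uM Ms])
  have cs: "(\<lambda>j. c * norm (uh j)) summable_on UNIV" by (intro summable_on_cmult_right us)
  have Pn: "norm (of_real c * uh j * cis (lattice_point j \<bullet> t)) \<le> c * norm (uh j)" for j and t :: "real^'n"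
    using c by (simp add: norm_mult)
  have Pc: "continuous_on ccube P"
    unfolding P_def by (rule continuous_on_infsum_dominated[OF _ Pn cs]) (intro continuous_intros)
  have vi: "integrable lborel (\<lambda>t. indicator (cube :: (real^'n) set) t *\<^sub>R (1::real))"
    by (rule cube_integrable) (intro continuous_intros)
  define V where "V = (\<integral>t. indicator (cube :: (real^'n) set) t *\<^sub>R (1::real) \<partial>lborel)"
  have sf: "sigma_finite_measure (lborel :: (real^'n) measure)" ..
  have Hcoef: "(\<integral>t. indicator cube t *\<^sub>R (H t * cis (- (lattice_point l \<bullet> t))) \<partial>lborel) = uh l" for l
  proof -
    define e where "e t = cis (- (lattice_point l \<bullet> t))" for t :: "real^'n"
    have [measurable]: "e \<in> borel_measurable borel" unfolding e_def by measurable
    have ne: "norm (e t) = 1" for t by (simp add: e_def)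
    have ec: "continuous_on A e" for A unfolding e_def by (intro continuous_intros)
    have eper: "e (t + (2 * pi) *\<^sub>R lattice_point k) = e t" for t k
    proof -
      have "lattice_point l \<bullet> (lattice_point k :: real^'n) \<in> \<int>"
        unfolding inner_vec_sum by (intro Ints_sum Ints_mult) auto
      then have "cis (2 * pi * (- (lattice_point l \<bullet> (lattice_point k :: real^'n)))) = 1" by (intro cis_multiple_2pi) auto
      moreover have "e (t + (2 * pi) *\<^sub>R lattice_point k) = e t * cis (2 * pi * (- (lattice_point l \<bullet> (lattice_point k :: real^'n))))"
        unfolding e_def cis_mult by (simp add: inner_add_right algebra_simps)
      ultimately show ?thesis by simp
    qed
    define f where "f k t = indicator cube t *\<^sub>R (u (t + (2 * pi) *\<^sub>R lattice_point k) * e t)" for k t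
    have fi: "integrable lborel (f k)" for k
      unfolding f_def by (rule cube_integrable) (intro continuous_intros uck ec)
    have fM: "norm (f k t) \<le> M k * (indicator cube t *\<^sub>R 1)" for k t
      using uM[of t k] cube_subset_ccube M0[of k] by (auto simp: f_def norm_mult ne split: split_indicator)
    have fnS: "(\<lambda>k. \<integral>t. norm (f k t) \<partial>lborel) summable_on UNIV"
    proof (rule summable_on_comparison_test)
      show "(\<lambda>k. M k * V) summable_on UNIV" by (intro summable_on_cmult_left Ms)
      show "(\<integral>t. norm (f k t) \<partial>lborel) \<le> M k * V" for k
        unfolding V_def integral_mult_right_zero[symmetric]
        by (intro integral_mono integrable_norm fi integrable_mult_right vi fM)
    qed simp
    have 1: "(\<integral>t. (\<Sum>\<^sub>\<infinity>k. f k t) \<partial>lborel) = (\<Sum>\<^sub>\<infinity>k. \<integral>t. f k t \<partial>lborel)"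
    proof (rule integral_infsum(2)[OF sf fi fnS])
      fix t
      show "(\<lambda>k. norm (f k t)) summable_on UNIV"
        by (rule summable_on_comparison_test[OF summable_on_cmult_left[OF Ms, of "indicator cube t *\<^sub>R 1"]]) (use fM in auto)
    qed
    \<comment> \<open>\<open>g k\<close> is the part of \<open>u * e\<close> on the cube moved by
      \<open>(2 * pi) *\<^sub>R lattice_point k\<close>. The moved cubes tile the space and
      \<open>e\<close> is periodic, so the coefficient of \<open>H\<close> unfolds into an integral
      over the whole space.\<close>
    define g where "g k t = indicator cube (t - (2 * pi) *\<^sub>R lattice_point k) *\<^sub>R (u t * e t)" for k t
    have fg: "f k t = g k ((2 * pi) *\<^sub>R lattice_point k + 1 *\<^sub>R t)" for k t
      using eper[of t k] by (simp add: f_def g_def add.commute)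
    have gi: "integrable lborel (g k)" for k
    proof (rule Bochner_Integration.integrable_bound[OF ui])
      show "AE t in lborel. norm (g k t) \<le> norm (u t)"
        by (auto simp: g_def norm_mult ne split: split_indicator)
      have "(\<lambda>t. indicator cube (t - (2 * pi) *\<^sub>R lattice_point k) :: real) \<in> borel_measurable borel"
        by (rule measurable_compose[OF _ borel_measurable_indicator[OF cube_measurable]]) measurable
      then show "g k \<in> borel_measurable lborel" unfolding g_def by measurable
    qed
    have gf: "(\<integral>t. g k t \<partial>lborel) = (\<integral>t. f k t \<partial>lborel)" for k
      unfolding fg using lborel_affine_has_integral(2)[OF gi, of 1] by simp
    have gf': "(\<integral>t. norm (g k t) \<partial>lborel) = (\<integral>t. norm (f k t) \<partial>lborel)" for k
      unfolding fg using lborel_affine_has_integral(2)[OF integrable_norm[OF gi], of 1] by simp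
    have g1: "finite {k. g k t \<noteq> 0} \<and> (\<Sum>\<^sub>\<infinity>k. g k t) = u t * e t" for t
    proof -
      obtain k0 where k0: "t - (2 * pi) *\<^sub>R lattice_point k0 \<in> cube" "\<And>k. t - (2 * pi) *\<^sub>R lattice_point k \<in> cube \<Longrightarrow> k = k0"
        using cube_translate_ex1[of t] by blast
      have gk: "g k t = (if k = k0 then u t * e t else 0)" for k
        using k0(1) k0(2)[of k] by (cases "k = k0") (auto simp: g_def indicator_def)
      have "{k. g k t \<noteq> 0} \<subseteq> {k0}" by (auto simp: gk)
      then have "finite {k. g k t \<noteq> 0}" by (rule finite_subset) simp
      moreover have "(\<Sum>\<^sub>\<infinity>k. g k t) = (\<Sum>\<^sub>\<infinity>k\<in>{k0}. u t * e t)"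
        by (rule infsum_cong_neutral) (auto simp: gk)
      ultimately show ?thesis by simp
    qed
    have "(\<integral>t. (\<Sum>\<^sub>\<infinity>k. g k t) \<partial>lborel) = (\<Sum>\<^sub>\<infinity>k. \<integral>t. g k t \<partial>lborel)"
    proof (rule integral_infsum(2)[OF sf gi])
      show "(\<lambda>k. \<integral>t. norm (g k t) \<partial>lborel) summable_on UNIV" unfolding gf' by (rule fnS)
      show "(\<lambda>k. norm (g k t)) summable_on UNIV" for t
        by (rule finite_nonzero_values_imp_summable_on) (use g1[of t] in simp)
    qed
    then have "uh l = (\<Sum>\<^sub>\<infinity>k. \<integral>t. f k t \<partial>lborel)" using g1 by (simp add: gf uh_def e_def)
    also have "\<dots> = (\<integral>t. (\<Sum>\<^sub>\<infinity>k. f k t) \<partial>lborel)" by (rule 1[symmetric])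
    also have "(\<lambda>t. \<Sum>\<^sub>\<infinity>k. f k t) = (\<lambda>t. indicator cube t *\<^sub>R (H t * e t))"
      unfolding f_def H_def by (simp add: infsum_cmult_left' scaleR_conv_of_real infsum_cmult_right')
    finally show ?thesis by (simp add: e_def)
  qed
  have Pcoef: "(\<integral>t. indicator cube t *\<^sub>R (P t * cis (- (lattice_point l \<bullet> t))) \<partial>lborel) = uh l" for l
  proof -
    define f where "f j t = indicator cube t *\<^sub>R (of_real c * uh j * cis (lattice_point j \<bullet> t) * cis (- (lattice_point l \<bullet> t)))" for j and t :: "real^'n"
    have fi: "integrable lborel (f j)" for j
      unfolding f_def by (rule cube_integrable) (intro continuous_intros)
    have fM: "norm (f j t) \<le> (c * norm (uh j)) * (indicator cube t *\<^sub>R 1)" for j t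
      using c by (auto simp: f_def norm_mult split: split_indicator)
    have 1: "(\<integral>t. (\<Sum>\<^sub>\<infinity>k. f k t) \<partial>lborel) = (\<Sum>\<^sub>\<infinity>k. \<integral>t. f k t \<partial>lborel)"
    proof (rule integral_infsum(2)[OF sf fi])
      show "(\<lambda>k. norm (f k t)) summable_on UNIV" for t
        by (rule summable_on_comparison_test[OF summable_on_cmult_left[OF cs, of "indicator cube t *\<^sub>R 1"]]) (use fM in auto)
      show "(\<lambda>k. \<integral>t. norm (f k t) \<partial>lborel) summable_on UNIV"
      proof (rule summable_on_comparison_test)
        show "(\<lambda>k. (c * norm (uh k)) * V) summable_on UNIV" by (intro summable_on_cmult_left cs)
        show "(\<integral>t. norm (f k t) \<partial>lborel) \<le> (c * norm (uh k)) * V" for k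
          unfolding V_def integral_mult_right_zero[symmetric]
          by (intro integral_mono integrable_norm fi integrable_mult_right vi fM)
      qed simp
    qed
    have fint: "(\<integral>t. f j t \<partial>lborel) = (if j = l then uh l else 0)" for j
    proof -
      have "f j t = (of_real c * uh j) * (indicator cube t *\<^sub>R cis (lattice_point (j - l) \<bullet> t))" for t
        by (simp add: f_def lattice_point_diff inner_diff_left cis_mult mult.assoc)
      then have "(\<integral>t. f j t \<partial>lborel) = (of_real c * uh j) * (if j - l = 0 then of_real ((2 * pi) ^ CARD('n)) else 0)"
        by (simp only: integral_mult_right_zero cis_integral_cube)
      then show ?thesis by (simp add: c_def)
    qed
    have "(\<Sum>\<^sub>\<infinity>j. \<integral>t. f j t \<partial>lborel) = (\<Sum>\<^sub>\<infinity>j\<in>{l}. uh l)"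
      unfolding fint by (rule infsum_cong_neutral) auto
    then have "(\<integral>t. (\<Sum>\<^sub>\<infinity>k. f k t) \<partial>lborel) = uh l" using 1 by simp
    also have "(\<lambda>t. \<Sum>\<^sub>\<infinity>k. f k t) = (\<lambda>t. indicator cube t *\<^sub>R (P t * cis (- (lattice_point l \<bullet> t))))"
      unfolding f_def P_def by (simp add: infsum_cmult_left' scaleR_conv_of_real infsum_cmult_right')
    finally show ?thesis .
  qed
  have "H 0 - P 0 = 0"
  proof (rule fourier_uniqueness_at_0[where D="\<lambda>t. H t - P t"])
    show "continuous_on ccube (\<lambda>t. H t - P t)" by (intro continuous_intros Hc Pc)
    fix j
    have e: "cis (lattice_point j \<bullet> t) = cis (- (lattice_point (- j) \<bullet> t))" for t :: "real^'n"
      by (simp add: lattice_point_minus)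
    have i: "integrable lborel (\<lambda>t. indicator cube t *\<^sub>R (H t * cis (- (lattice_point (- j) \<bullet> t))))"
       "integrable lborel (\<lambda>t. indicator cube t *\<^sub>R (P t * cis (- (lattice_point (- j) \<bullet> t))))"
      by (rule cube_integrable, intro continuous_intros Hc Pc)+
    show "(\<integral>t. indicator cube t *\<^sub>R ((H t - P t) * cis (lattice_point j \<bullet> t)) \<partial>lborel) = 0"
      unfolding e left_diff_distrib scaleR_diff_right
      by (subst Bochner_Integration.integral_diff[OF i]) (simp only: Hcoef Pcoef, simp)
  qed
  moreover have "P 0 = of_real c * (\<Sum>\<^sub>\<infinity>j. uh j)"
    unfolding P_def by (simp add: infsum_cmult_right' del: times_divide_eq_left)
  ultimately show ?thesis by (simp add: H_def c_def uh_def)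
qed

section \<open>Aliasing\<close>

lemma matern_summable:
  fixes x :: "real^'n"
  assumes m: "real m > real CARD('n) / 2" and h: "h > 0"
  shows "(\<lambda>j. matern m (x - h *\<^sub>R lattice_point j)) summable_on UNIV"
proof -
  obtain C where C: "C > 0" "\<And>y::real^'n. matern m y \<le> C / (1 + (norm y)\<^sup>2) ^ m" using matern_decay[OF m] by blast
  have "(\<lambda>j. 1 / (1 + (norm (x - h *\<^sub>R lattice_point j))\<^sup>2) ^ m) summable_on UNIV"
    using lattice_sum_bound[OF m h] by blast
  from summable_on_cmult_right[OF this, of C]
  show ?thesis by (rule summable_on_comparison_test) (use C(2) matern_nonneg[OF m] in auto)
qed

lemma norm_bessel_wave:
  "norm (complex_of_real (1 / (1 + (norm \<zeta>)\<^sup>2) ^ m) * cis a) = 1 / (1 + (norm \<zeta>)\<^sup>2) ^ m"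
proof -
  have "norm (complex_of_real (1 / (1 + (norm \<zeta>)\<^sup>2) ^ m)) = 1 / (1 + (norm \<zeta>)\<^sup>2) ^ m"
    unfolding norm_of_real by (intro abs_of_nonneg) auto
  then show ?thesis by (simp only: norm_mult norm_cis mult_1_right)
qed

lemma bessel_wave_integrable:
  assumes "m > 0" "real m > real CARD('n) / 2"
  shows "integrable lborel (\<lambda>\<zeta>::real^'n. of_real (1 / (1 + (norm \<zeta>)\<^sup>2) ^ m) * cis (x \<bullet> \<zeta>))"
proof (rule Bochner_Integration.integrable_bound[OF matern_fourier(1)[OF assms]])
  show "AE \<zeta> in lborel. norm (complex_of_real (1 / (1 + (norm (\<zeta>::real^'n))\<^sup>2) ^ m) * cis (x \<bullet> \<zeta>)) \<le> norm (1 / (1 + (norm \<zeta>)\<^sup>2) ^ m)"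
    unfolding norm_bessel_wave by simp
qed measurable

text \<open>
  Poisson summation for \<open>t \<mapsto> p (\<xi> + t / h)\<close>: a plane wave sampled on \<open>h \<int>\<^sup>d\<close> and spread by the kernel
  is the sum of all its aliases, weighted by the Fourier transform of the kernel.
\<close>

lemma weighted_plane_wave_sum:
  fixes x \<xi> :: "real^'n"
  assumes m0: "m > 0" and m: "real m > real CARD('n) / 2" and h: "h > 0"
    and B: "\<And>y::real^'n. (\<integral>\<zeta>. of_real (1 / (1 + (norm \<zeta>)\<^sup>2) ^ m) * cis (y \<bullet> \<zeta>) \<partial>lborel) = of_real (B * matern m y)"
    and B0: "B > 0"
  defines "p \<equiv> \<lambda>\<zeta>::real^'n. of_real (1 / (1 + (norm \<zeta>)\<^sup>2) ^ m) * cis (x \<bullet> \<zeta>)"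
  shows "(\<Sum>\<^sub>\<infinity>k. p (\<xi> + (2 * pi / h) *\<^sub>R lattice_point k))
    = (\<Sum>\<^sub>\<infinity>j. of_real (B * (h / (2 * pi)) ^ CARD('n) * matern m (x - h *\<^sub>R lattice_point j)) * cis (lattice_point j \<bullet> (h *\<^sub>R \<xi>)))"
proof -
  define u where "u t = p (\<xi> + (1 / h) *\<^sub>R t)" for t
  have b0: "1 + (norm \<zeta>)\<^sup>2 \<noteq> 0" for \<zeta> :: "real^'n" by (metis add_pos_nonneg less_irrefl zero_le_power2 zero_less_one)
  have pc: "continuous_on A p" for A
    unfolding p_def by (intro continuous_intros) (use b0 in auto)
  have pi': "integrable lborel p"
    unfolding p_def by (rule bessel_wave_integrable[OF m0 m])
  have ui: "integrable lborel u" unfolding u_def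
    by (rule lborel_affine_has_integral(1)[OF pi']) (use h in auto)
  have uc: "continuous_on UNIV u" unfolding u_def
    by (rule continuous_on_compose2[OF pc]) (auto intro!: continuous_intros)
  \<comment> \<open>With \<open>t = h *\<^sub>R (\<zeta> - \<xi>)\<close>, moving the centre of the
    decay to 0 costs a factor depending on \<open>h\<close> and \<open>\<xi>\<close>. It secures a
    hypothesis of Poisson summation and leaves no trace in the identity.\<close>
  define Q where "Q = 1 + 2 * h\<^sup>2 * (1 + (norm \<xi>)\<^sup>2)"
  have Q: "Q > 0" unfolding Q_def by (intro add_pos_nonneg mult_nonneg_nonneg) auto
  have ub: "norm (u t) \<le> Q ^ m / (1 + (norm t)\<^sup>2) ^ m" for t
  proof -
    define \<zeta> where "\<zeta> = \<xi> + (1 / h) *\<^sub>R t"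
    have t: "t = h *\<^sub>R (\<zeta> - \<xi>)" using h by (simp add: \<zeta>_def)
    have "norm t \<le> h * (norm \<zeta> + norm \<xi>)"
      unfolding t using h by (simp add: norm_triangle_ineq4)
    then have "(norm t)\<^sup>2 \<le> (h * (norm \<zeta> + norm \<xi>))\<^sup>2" by (intro power_mono) auto
    also have "\<dots> \<le> 2 * h\<^sup>2 * ((norm \<zeta>)\<^sup>2 + (norm \<xi>)\<^sup>2)"
    proof -
      have "(norm \<zeta> + norm \<xi>)\<^sup>2 \<le> 2 * ((norm \<zeta>)\<^sup>2 + (norm \<xi>)\<^sup>2)"
        using sum_squares_bound[of "norm \<zeta>" "norm \<xi>"] by (simp add: power2_sum)
      from mult_left_mono[OF this, of "h\<^sup>2"] show ?thesis unfolding power_mult_distrib by (simp add: distrib_left mult_ac)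
    qed
    also have "\<dots> \<le> 2 * h\<^sup>2 * ((1 + (norm \<xi>)\<^sup>2) * (1 + (norm \<zeta>)\<^sup>2))"
      by (intro mult_left_mono) (auto simp: ring_distribs)
    also have "\<dots> = (Q - 1) * (1 + (norm \<zeta>)\<^sup>2)" by (simp add: Q_def)
    finally have "1 + (norm t)\<^sup>2 \<le> 1 + (Q - 1) * (1 + (norm \<zeta>)\<^sup>2)" by simp
    also have "\<dots> \<le> Q * (1 + (norm \<zeta>)\<^sup>2)" by (simp add: algebra_simps)
    finally have "(1 + (norm t)\<^sup>2) ^ m \<le> (Q * (1 + (norm \<zeta>)\<^sup>2)) ^ m"
      by (intro power_mono) auto
    then have "(1 + (norm t)\<^sup>2) ^ m \<le> Q ^ m * (1 + (norm \<zeta>)\<^sup>2) ^ m"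
      by (simp only: power_mult_distrib)
    moreover have "norm (u t) = 1 / (1 + (norm \<zeta>)\<^sup>2) ^ m"
      unfolding u_def \<zeta>_def[symmetric] p_def by (rule norm_bessel_wave)
    moreover have "(1 + (norm t)\<^sup>2) ^ m > 0" "(1 + (norm \<zeta>)\<^sup>2) ^ m > 0" by (auto intro!: zero_less_power add_pos_nonneg)
    ultimately show ?thesis by (simp only: pos_le_divide_eq pos_divide_le_eq) (simp add: divide_simps mult.commute)
  qed
  have uh: "(\<integral>t. u t * cis (- (lattice_point j \<bullet> t)) \<partial>lborel) = of_real (h ^ CARD('n) * (B * matern m (x - h *\<^sub>R lattice_point j))) * cis (lattice_point j \<bullet> (h *\<^sub>R \<xi>))" for j
  proof -
    \<comment> \<open>For \<open>t = h *\<^sub>R (\<zeta> - \<xi>)\<close> the phase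
      \<open>x \<bullet> \<zeta> - lattice_point j \<bullet> t\<close> is
      \<open>(x - h *\<^sub>R lattice_point j) \<bullet> \<zeta>\<close> plus the constant
      \<open>lattice_point j \<bullet> (h *\<^sub>R \<xi>)\<close>. So the transform is the kernel
      centred at a lattice point, times a phase.\<close>
    define G where "G \<zeta> = (of_real (1 / (1 + (norm \<zeta>)\<^sup>2) ^ m) * cis ((x - h *\<^sub>R lattice_point j) \<bullet> \<zeta>)) * cis (lattice_point j \<bullet> (h *\<^sub>R \<xi>))" for \<zeta> :: "real^'n"
    have Gi: "integrable lborel G"
      unfolding G_def by (intro integrable_mult_left bessel_wave_integrable m0 m)
    have Gint: "(\<integral>\<zeta>. G \<zeta> \<partial>lborel) = of_real (B * matern m (x - h *\<^sub>R lattice_point j)) * cis (lattice_point j \<bullet> (h *\<^sub>R \<xi>))"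
      unfolding G_def integral_mult_left_zero B ..
    have "u t * cis (- (lattice_point j \<bullet> t)) = G (\<xi> + (1 / h) *\<^sub>R t)" for t
    proof -
      have "x \<bullet> (\<xi> + (1 / h) *\<^sub>R t) + - (lattice_point j \<bullet> t) = (x - h *\<^sub>R lattice_point j) \<bullet> (\<xi> + (1 / h) *\<^sub>R t) + lattice_point j \<bullet> (h *\<^sub>R \<xi>)"
        using h by (simp add: inner_diff_left inner_add_right diff_divide_distrib)
      then show ?thesis unfolding u_def G_def p_def mult.assoc cis_mult by (simp only:)
    qed
    then have "(\<integral>t. u t * cis (- (lattice_point j \<bullet> t)) \<partial>lborel) = (\<integral>t. G (\<xi> + (1 / h) *\<^sub>R t) \<partial>lborel)" by (simp only:)
    also have "\<dots> = (1 / \<bar>1 / h\<bar> ^ DIM(real^'n)) *\<^sub>R (\<integral>\<zeta>. G \<zeta> \<partial>lborel)"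
      by (rule lborel_affine_has_integral(2)[OF Gi]) (use h in auto)
    also have "1 / \<bar>1 / h\<bar> ^ DIM(real^'n) = h ^ CARD('n)" using h by (simp add: power_one_over)
    finally show ?thesis unfolding Gint by (simp add: scaleR_conv_of_real)
  qed
  note Ms = matern_summable[OF m h]
  have "(\<Sum>\<^sub>\<infinity>k. u ((2 * pi) *\<^sub>R lattice_point k)) = of_real (1 / (2 * pi) ^ CARD('n)) * (\<Sum>\<^sub>\<infinity>j. \<integral>t. u t * cis (- (lattice_point j \<bullet> t)) \<partial>lborel)"
  proof (rule poisson_summation[OF uc ui ub m])
    have eq: "norm (complex_of_real (h ^ CARD('n) * (B * matern m (x - h *\<^sub>R lattice_point j))) * cis (lattice_point j \<bullet> (h *\<^sub>R \<xi>))) = h ^ CARD('n) * (B * matern m (x - h *\<^sub>R lattice_point j))" for j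
      using h B0 matern_nonneg[OF m, of "x - h *\<^sub>R lattice_point j"] by (simp only: norm_mult norm_cis norm_of_real) (simp add: abs_mult)
    show "(\<lambda>j. norm (\<integral>t. u t * cis (- (lattice_point j \<bullet> t)) \<partial>lborel)) summable_on UNIV"
      unfolding uh eq by (intro summable_on_cmult_right Ms)
  qed
  also have "\<dots> = (\<Sum>\<^sub>\<infinity>j. of_real (1 / (2 * pi) ^ CARD('n)) * (of_real (h ^ CARD('n) * (B * matern m (x - h *\<^sub>R lattice_point j))) * cis (lattice_point j \<bullet> (h *\<^sub>R \<xi>))))"
    unfolding uh by (rule infsum_cmult_right'[symmetric])
  also have "\<dots> = (\<Sum>\<^sub>\<infinity>j. of_real (B * (h / (2 * pi)) ^ CARD('n) * matern m (x - h *\<^sub>R lattice_point j)) * cis (lattice_point j \<bullet> (h *\<^sub>R \<xi>)))"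
    by (intro infsum_cong) (simp add: power_divide)
  finally show ?thesis by (simp add: u_def)
qed

text \<open>For \<open>k \<noteq> 0\<close> put \<open>n = norm (lattice_point k)\<close>. The alias
  \<open>\<zeta>\<close> satisfies \<open>n \<le> h * norm \<zeta>\<close>, and
  \<open>n \<ge> 1\<close> then gives \<open>1 + n\<^sup>2 \<le> 2 * h\<^sup>2 * (1 + (norm
  \<zeta>)\<^sup>2)\<close>. So each alias has weight at most \<open>2 ^ m * h ^ (2 * m)\<close>
  times a summable function of \<open>k\<close>. The bound is absolute; division by the weight of
  \<open>\<xi>\<close> happens where the lemma is applied.\<close>

lemma aliasing_error:
  fixes x \<xi> :: "real^'n"
  assumes m: "real m > real CARD('n) / 2" and h: "h > 0" and cube: "h *\<^sub>R \<xi> \<in> ccube"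
  defines "p \<equiv> \<lambda>\<zeta>::real^'n. of_real (1 / (1 + (norm \<zeta>)\<^sup>2) ^ m) * cis (x \<bullet> \<zeta>)"
  shows "norm ((\<Sum>\<^sub>\<infinity>k. p (\<xi> + (2 * pi / h) *\<^sub>R lattice_point k)) - p \<xi>)
    \<le> (2 ^ m * (\<Sum>\<^sub>\<infinity>k::int^'n. 1 / (1 + (norm (lattice_point k))\<^sup>2) ^ m)) * h ^ (2 * m)"
proof -
  let ?T = "\<lambda>k::int^'n. 2 ^ m * (1 / (1 + (norm (lattice_point k))\<^sup>2) ^ m) * h ^ (2 * m)"
  let ?q = "\<lambda>k. if k = 0 then 0 else p (\<xi> + (2 * pi / h) *\<^sub>R lattice_point k)"
  let ?d = "\<lambda>k. if k = 0 then p \<xi> else 0"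
  have T: "?T summable_on UNIV" by (intro summable_on_cmult_left summable_on_cmult_right summable_on_lattice m)
  have le: "norm (?q k) \<le> ?T k" for k
  proof (cases "k = 0")
    case True
    then show ?thesis using h by simp
  next
    case False
    let ?\<zeta> = "\<xi> + (2 * pi / h) *\<^sub>R lattice_point k"
    let ?n = "norm (lattice_point k :: real^'n)"
    obtain i where "k $ i \<noteq> 0" using False by (auto simp: vec_eq_iff)
    then have "\<bar>lattice_point k $ i :: real\<bar> \<ge> 1" by simp
    then have n1: "?n \<ge> 1" using component_le_norm_cart[of "lattice_point k :: real^'n" i] by linarith
    have "?n \<le> norm (pi *\<^sub>R lattice_point k :: real^'n)"
      using pi_ge_two by (simp add: mult_le_cancel_right1)
    also have "\<dots> \<le> norm (h *\<^sub>R \<xi> + (2 * pi) *\<^sub>R lattice_point k)"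
      by (rule norm_lattice_translate_cube[OF cube])
    also have "h *\<^sub>R \<xi> + (2 * pi) *\<^sub>R lattice_point k = h *\<^sub>R ?\<zeta>" using h by (simp add: scaleR_add_right)
    also have "norm (h *\<^sub>R ?\<zeta>) = h * norm ?\<zeta>" using h by simp
    finally have hz: "?n \<le> h * norm ?\<zeta>" .
    have "1 + ?n\<^sup>2 \<le> 2 * ?n\<^sup>2" using n1 by simp
    also have "\<dots> \<le> 2 * (h * norm ?\<zeta>)\<^sup>2" using hz by (intro mult_left_mono power_mono) auto
    also have "\<dots> \<le> 2 * h\<^sup>2 * (1 + (norm ?\<zeta>)\<^sup>2)" by (simp add: power_mult_distrib ring_distribs)
    finally have "(1 + ?n\<^sup>2) ^ m \<le> (2 * h\<^sup>2 * (1 + (norm ?\<zeta>)\<^sup>2)) ^ m" by (intro power_mono) auto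
    then have "(1 + ?n\<^sup>2) ^ m \<le> 2 ^ m * h ^ (2 * m) * (1 + (norm ?\<zeta>)\<^sup>2) ^ m"
      by (simp add: power_mult_distrib power_mult)
    moreover have "(1 + ?n\<^sup>2) ^ m > 0" "(1 + (norm ?\<zeta>)\<^sup>2) ^ m > 0" by (auto intro!: zero_less_power add_pos_nonneg)
    ultimately have "1 / (1 + (norm ?\<zeta>)\<^sup>2) ^ m \<le> ?T k" by (simp add: divide_simps mult_ac)
    moreover have "norm (?q k) = 1 / (1 + (norm ?\<zeta>)\<^sup>2) ^ m"
      using False unfolding p_def by (simp only: norm_bessel_wave if_False)
    ultimately show ?thesis by simp
  qed
  have qs: "(\<lambda>k. norm (?q k)) summable_on UNIV"
    by (rule summable_on_comparison_test[OF T]) (use le in auto)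
  have "(?q has_sum (infsum ?q UNIV)) UNIV"
    by (rule has_sum_infsum[OF abs_summable_summable[OF qs]])
  moreover have "(?d has_sum p \<xi>) UNIV"
    by (rule has_sum_finite_neutralI[of "{0}"]) auto
  ultimately have "((\<lambda>k. ?q k + ?d k) has_sum (infsum ?q UNIV + p \<xi>)) UNIV"
    by (rule has_sum_add)
  moreover have "(\<lambda>k. ?q k + ?d k) = (\<lambda>k. p (\<xi> + (2 * pi / h) *\<^sub>R lattice_point k))" by auto
  ultimately have "(\<Sum>\<^sub>\<infinity>k. p (\<xi> + (2 * pi / h) *\<^sub>R lattice_point k)) - p \<xi> = infsum ?q UNIV"
    by (simp add: infsumI)
  moreover have "norm (infsum ?q UNIV) \<le> infsum ?T UNIV"
    by (rule order_trans[OF norm_infsum_bound[OF qs] infsum_mono[OF qs T le]])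
  moreover have "infsum ?T UNIV = (2 ^ m * (\<Sum>\<^sub>\<infinity>k::int^'n. 1 / (1 + (norm (lattice_point k))\<^sup>2) ^ m)) * h ^ (2 * m)"
    by (simp only: infsum_cmult_left' infsum_cmult_right')
  ultimately show ?thesis by simp
qed

text \<open>A value of modulus above \<open>\<epsilon>\<close> keeps \<open>norm (g y)\<close> at
  least \<open>\<epsilon> / 2\<close> on a ball of radius \<open>\<epsilon> / (2 * L)\<close>, which
  adds a fixed amount to the integral. Far from the origin the tails of the integral are too small
  for that.\<close>

lemma lipschitz_integrable_vanishes:
  fixes g :: "'a::euclidean_space \<Rightarrow> complex"
  assumes L: "L > 0" "\<And>x y. norm (g x - g y) \<le> L * norm (x - y)" and gi: "integrable lborel g" and e: "\<epsilon> > 0"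
  shows "\<exists>R>0. \<forall>x. norm x \<ge> R \<longrightarrow> norm (g x) \<le> \<epsilon>"
proof -
  define r where "r = \<epsilon> / (2 * L)"
  have r: "r > 0" using L e by (simp add: r_def)
  define v where "v = measure lborel (ball (0::'a) r)"
  have v: "v > 0" unfolding v_def using r content_ball_pos by blast
  have vx: "measure lborel (ball x r) = v" for x :: 'a using r by (simp add: v_def content_ball)
  have [measurable]: "g \<in> borel_measurable borel" using borel_measurable_integrable[OF gi] by simp
  define tail where "tail n = (\<integral>y. indicator {y. norm y \<ge> real n} y * norm (g y) \<partial>lborel)" for n
  have ti: "integrable lborel (\<lambda>y. indicator {y. norm y \<ge> real n} y * norm (g y))" for n
    by (rule Bochner_Integration.integrable_bound[OF integrable_norm[OF gi]]) (auto split: split_indicator)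
  have "tail \<longlonglongrightarrow> integral\<^sup>L lborel (\<lambda>y::'a. 0)"
    unfolding tail_def
  proof (rule integral_dominated_convergence[where w="\<lambda>y. norm (g y)"])
    show "AE y in lborel. (\<lambda>n. indicator {y. norm y \<ge> real n} y * norm (g y)) \<longlonglongrightarrow> 0"
    proof (rule AE_I2)
      fix y :: 'a
      obtain n0 :: nat where "norm y < real n0" using reals_Archimedean2 by blast
      then have "\<forall>\<^sub>F n in sequentially. indicator {y. norm y \<ge> real n} y * norm (g y) = 0"
        by (intro eventually_sequentiallyI[of n0]) (auto simp: indicator_def)
      then show "(\<lambda>n. indicator {y. norm y \<ge> real n} y * norm (g y)) \<longlonglongrightarrow> 0" by (rule tendsto_eventually)
    qed
    show "AE y in lborel. norm (indicator {y. norm y \<ge> real n} y * norm (g y)) \<le> norm (g y)" for n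
      by (auto split: split_indicator)
  qed (use gi in auto)
  then have "\<forall>\<^sub>F n in sequentially. tail n < v * (\<epsilon> / 2)"
    using v e by (intro order_tendstoD(2)) auto
  then obtain n where n: "tail n < v * (\<epsilon> / 2)" by (auto simp: eventually_sequentially)
  have "norm (g x) \<le> \<epsilon>" if x: "norm x \<ge> real n + r" for x
  proof (rule ccontr)
    assume "\<not> norm (g x) \<le> \<epsilon>"
    then have gx: "norm (g x) > \<epsilon>" by simp
    have "indicator (ball x r) y * (\<epsilon> / 2) \<le> indicator {y. norm y \<ge> real n} y * norm (g y)" for y
    proof (cases "y \<in> ball x r")
      case True
      then have xy: "norm (x - y) < r" by (simp add: dist_norm)
      have "norm (g x - g y) \<le> L * r" using L(2)[of x y] mult_left_mono[OF less_imp_le[OF xy], of L] L(1) by linarith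
      also have "L * r = \<epsilon> / 2" using L(1) by (simp add: r_def)
      finally have "norm (g y) \<ge> \<epsilon> / 2" using gx norm_triangle_ineq2[of "g x" "g y"] by linarith
      moreover have "norm y \<ge> real n" using x xy norm_triangle_ineq2[of x y] by linarith
      ultimately show ?thesis using True by simp
    qed (auto intro: mult_nonneg_nonneg)
    moreover have bi: "integrable lborel (indicator (ball x r) :: 'a \<Rightarrow> real)"
      by (rule integrable_real_indicator) (use emeasure_bounded_finite[OF bounded_ball, of x r] in auto)
    ultimately have "(\<integral>y. indicator (ball x r) y * (\<epsilon> / 2) \<partial>lborel) \<le> tail n"
      unfolding tail_def by (intro integral_mono[OF integrable_mult_left[OF bi] ti])
    moreover have "(\<integral>y. indicator (ball x r) y * (\<epsilon> / 2) \<partial>lborel) = v * (\<epsilon> / 2)"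
      unfolding integral_mult_left_zero by (simp add: vx)
    ultimately show False using n by linarith
  qed
  then show ?thesis using r by (intro exI[of _ "real n + r"]) auto
qed

section \<open>Approximants with bounded and with finitely many coefficients\<close>

lemma bounded_coefficients_summable:
  fixes x :: "real^'n" and c :: "int^'n \<Rightarrow> complex"
  assumes m: "real m > real CARD('n) / 2" and h: "h > 0" and c: "bounded (range c)"
  shows "(\<lambda>j. c j * complex_of_real (matern m (x - h *\<^sub>R lattice_point j))) summable_on UNIV"
proof -
  obtain Bc where Bc: "\<And>j. norm (c j) \<le> Bc" using c unfolding bounded_iff by auto
  show ?thesis
  proof (rule abs_summable_summable, rule summable_on_comparison_test)
    show "(\<lambda>j. Bc * matern m (x - h *\<^sub>R lattice_point j)) summable_on UNIV"
      by (intro summable_on_cmult_right matern_summable m h)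
    show "norm (c j * complex_of_real (matern m (x - h *\<^sub>R lattice_point j))) \<le> Bc * matern m (x - h *\<^sub>R lattice_point j)" for j
      using Bc[of j] matern_nonneg[OF m, of "x - h *\<^sub>R lattice_point j"] by (simp add: norm_mult mult_right_mono)
  qed simp
qed

text \<open>The lattice sum is pulled into the integral over \<open>\<xi>\<close>, where
  \<open>weighted_plane_wave_sum\<close> evaluates it. The error becomes an integral of
  \<open>F\<close> against the difference between a weighted plane wave and the sum of its aliases,
  which is estimated for each \<open>\<xi>\<close> separately.\<close>

lemma bounded_coefficients_approximation:
  fixes fh :: "real^'n \<Rightarrow> complex"
  assumes m0: "m > 0" and m: "real m > real CARD('n) / 2"
    and fm [measurable]: "fh \<in> borel_measurable borel"
    and Fi: "integrable lborel (\<lambda>\<xi>. of_real ((1 + (norm \<xi>)\<^sup>2) ^ m) * fh \<xi>)"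
  shows "\<exists>A\<ge>0. \<forall>h>0. \<exists>c. bounded (range c) \<and>
    (\<forall>x. norm ((1 / (2 * pi) ^ CARD('n)) *\<^sub>R (\<integral>\<xi>. fh \<xi> * cis (x \<bullet> \<xi>) \<partial>lborel)
       - (\<Sum>\<^sub>\<infinity>j. c j * complex_of_real (matern m (x - h *\<^sub>R lattice_point j)))) \<le> A * h ^ (2 * m))"
proof -
  \<comment> \<open>Up to a constant, \<open>fh\<close> divided by the Fourier transform of the
    kernel.\<close>
  define F where "F \<xi> = of_real ((1 + (norm \<xi>)\<^sup>2) ^ m) * fh \<xi>" for \<xi>
  have Fi: "integrable lborel F" using Fi by (simp add: F_def[abs_def])
  have [measurable]: "F \<in> borel_measurable borel" unfolding F_def by measurable
  have bpos: "(1 + (norm \<xi>)\<^sup>2) ^ m > 0" for \<xi> :: "real^'n" by (intro zero_less_power add_pos_nonneg) auto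
  have fhF: "fh \<xi> = F \<xi> * of_real (1 / (1 + (norm \<xi>)\<^sup>2) ^ m)" for \<xi>
  proof -
    have "(1 + (norm \<xi>)\<^sup>2) ^ m * (1 / (1 + (norm \<xi>)\<^sup>2) ^ m) = 1"
      unfolding times_divide_eq_right mult_1_right by (rule divide_self[OF less_imp_neq[OF bpos, symmetric]])
    then have "complex_of_real ((1 + (norm \<xi>)\<^sup>2) ^ m) * of_real (1 / (1 + (norm \<xi>)\<^sup>2) ^ m) = 1"
      unfolding of_real_mult[symmetric] by (simp only: of_real_1)
    then show ?thesis unfolding F_def by (metis (no_types) mult.assoc mult.commute mult_1_left)
  qed
  obtain B where B0: "B > 0"
    and B: "\<And>y::real^'n. (\<integral>\<zeta>. of_real (1 / (1 + (norm \<zeta>)\<^sup>2) ^ m) * cis (y \<bullet> \<zeta>) \<partial>lborel) = of_real (B * matern m y)"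
    using matern_fourier(2)[OF m0 m] by blast
  define T where "T = 2 ^ m * (\<Sum>\<^sub>\<infinity>k::int^'n. 1 / (1 + (norm (lattice_point k))\<^sup>2) ^ m)"
  have T: "T \<ge> 0" unfolding T_def by (intro mult_nonneg_nonneg infsum_nonneg) auto
  define \<alpha> where "\<alpha> = 1 / (2 * pi) ^ CARD('n)"
  have \<alpha>: "\<alpha> > 0" by (simp add: \<alpha>_def)
  \<comment> \<open>Relative to \<open>norm (F \<xi>)\<close>, the error at a frequency is at most
    \<open>T * h ^ (2 * m)\<close> inside the cube, from the aliases, and \<open>h ^ (2 * m)\<close>
    outside it, from the omission; \<open>T + 1\<close> covers both.\<close>
  define A where "A = \<alpha> * ((\<integral>\<xi>. norm (F \<xi>) \<partial>lborel) * (T + 1))"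
  have A: "A \<ge> 0" unfolding A_def using \<alpha> T by (intro mult_nonneg_nonneg integral_nonneg_AE) auto
  have "\<exists>c. bounded (range c) \<and> (\<forall>x. norm (\<alpha> *\<^sub>R (\<integral>\<xi>. fh \<xi> * cis (x \<bullet> \<xi>) \<partial>lborel)
       - (\<Sum>\<^sub>\<infinity>j. c j * complex_of_real (matern m (x - h *\<^sub>R lattice_point j)))) \<le> A * h ^ (2 * m))" if h: "h > 0" for h
  proof -
    define b where "b = B * (h / (2 * pi)) ^ CARD('n)"
    have b: "b > 0" using B0 h by (simp add: b_def)
    define e where "e j \<xi> = cis (lattice_point j \<bullet> (h *\<^sub>R \<xi>))" for j and \<xi> :: "real^'n"
    have [measurable]: "e j \<in> borel_measurable borel" for j unfolding e_def by measurable
    define I where "I \<xi> = (indicator cube (h *\<^sub>R \<xi>) :: real)" for \<xi> :: "real^'n"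
    have Im[measurable]: "I \<in> borel_measurable borel" unfolding I_def
      by (rule measurable_compose[OF _ borel_measurable_indicator[OF cube_measurable]]) measurable
    have I01: "I \<xi> = (if h *\<^sub>R \<xi> \<in> cube then 1 else 0)" for \<xi> by (simp add: I_def)
    have IFe: "integrable lborel (\<lambda>\<xi>. I \<xi> *\<^sub>R (F \<xi> * e j \<xi>))" for j
      by (rule Bochner_Integration.integrable_bound[OF Fi]) (auto simp: I01 e_def norm_mult)
    have IFn: "(\<integral>\<xi>. norm (I \<xi> *\<^sub>R (F \<xi> * e j \<xi>)) \<partial>lborel) \<le> (\<integral>\<xi>. norm (F \<xi>) \<partial>lborel)" for j
      by (intro integral_mono integrable_norm IFe Fi) (auto simp: I01 e_def norm_mult)
    \<comment> \<open>Each plane wave of frequency in the cube is divided by the Fourier transform of the kernel and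
      sampled on the lattice; the frequencies outside are dropped.\<close>
    define c where "c j = of_real (\<alpha> * b) * (\<integral>\<xi>. I \<xi> *\<^sub>R (F \<xi> * e j \<xi>) \<partial>lborel)" for j
    have "norm (c j) \<le> \<alpha> * b * (\<integral>\<xi>. norm (F \<xi>) \<partial>lborel)" for j
      using \<alpha> b order_trans[OF integral_norm_bound IFn, of j]
      by (simp add: c_def norm_mult abs_mult mult_left_mono)
    then have cb: "bounded (range c)" unfolding bounded_iff by blast
    moreover have "norm (\<alpha> *\<^sub>R (\<integral>\<xi>. fh \<xi> * cis (x \<bullet> \<xi>) \<partial>lborel)
       - (\<Sum>\<^sub>\<infinity>j. c j * complex_of_real (matern m (x - h *\<^sub>R lattice_point j)))) \<le> A * h ^ (2 * m)" for x
    proof -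
      define M where "M j = matern m (x - h *\<^sub>R lattice_point j)" for j
      have M0: "M j \<ge> 0" for j unfolding M_def by (rule matern_nonneg[OF m])
      have Ms: "M summable_on UNIV" unfolding M_def by (rule matern_summable[OF m h])
      define p where "p \<zeta> = of_real (1 / (1 + (norm \<zeta>)\<^sup>2) ^ m) * cis (x \<bullet> \<zeta>)" for \<zeta> :: "real^'n"
      define S where "S \<xi> = (\<Sum>\<^sub>\<infinity>j. of_real (b * M j) * e j \<xi>)" for \<xi>
      have S: "S \<xi> = (\<Sum>\<^sub>\<infinity>k. p (\<xi> + (2 * pi / h) *\<^sub>R lattice_point k))" for \<xi>
        unfolding S_def b_def M_def e_def p_def by (rule weighted_plane_wave_sum[OF m0 m h B B0, symmetric])
      define g where "g j \<xi> = I \<xi> *\<^sub>R (F \<xi> * (of_real (b * M j) * e j \<xi>))" for j \<xi>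
      have geq: "g j \<xi> = of_real (b * M j) * (I \<xi> *\<^sub>R (F \<xi> * e j \<xi>))" for j \<xi> by (simp add: g_def)
      have gi: "integrable lborel (g j)" for j unfolding geq by (intro integrable_mult_right IFe)
      have gint: "(\<integral>\<xi>. g j \<xi> \<partial>lborel) = of_real (b * M j) * (\<integral>\<xi>. I \<xi> *\<^sub>R (F \<xi> * e j \<xi>) \<partial>lborel)" for j
        unfolding geq integral_mult_right_zero ..
      have gn: "norm (g j \<xi>) = b * M j * norm (I \<xi> *\<^sub>R (F \<xi> * e j \<xi>))" for j \<xi>
        unfolding geq using b M0[of j] by (simp add: norm_mult abs_mult)
      have gs1: "(\<lambda>j. \<integral>\<xi>. norm (g j \<xi>) \<partial>lborel) summable_on UNIV"
      proof (rule summable_on_comparison_test)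
        show "(\<lambda>j. b * M j * (\<integral>\<xi>. norm (F \<xi>) \<partial>lborel)) summable_on UNIV"
          by (intro summable_on_cmult_left summable_on_cmult_right Ms)
        show "(\<integral>\<xi>. norm (g j \<xi>) \<partial>lborel) \<le> b * M j * (\<integral>\<xi>. norm (F \<xi>) \<partial>lborel)" for j
          unfolding gn integral_mult_right_zero using IFn[of j] b M0[of j] by (intro mult_left_mono) auto
      qed simp
      have gs2: "(\<lambda>j. norm (g j \<xi>)) summable_on UNIV" for \<xi>
      proof (rule summable_on_comparison_test)
        show "(\<lambda>j. b * M j * norm (F \<xi>)) summable_on UNIV"
          by (intro summable_on_cmult_left summable_on_cmult_right Ms)
        show "norm (g j \<xi>) \<le> b * M j * norm (F \<xi>)" for j
          unfolding gn using b M0[of j] by (intro mult_left_mono) (auto simp: I01 e_def norm_mult)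
      qed simp
      have gS: "(\<Sum>\<^sub>\<infinity>j. g j \<xi>) = I \<xi> *\<^sub>R (F \<xi> * S \<xi>)" for \<xi>
        unfolding g_def S_def scaleR_conv_of_real infsum_cmult_right' ..
      have sf: "sigma_finite_measure (lborel :: (real^'n) measure)" ..
      have IFS: "integrable lborel (\<lambda>\<xi>. I \<xi> *\<^sub>R (F \<xi> * S \<xi>))"
        using integral_infsum(1)[OF sf gi gs1 gs2] unfolding gS .
      have "(\<Sum>\<^sub>\<infinity>j. c j * complex_of_real (M j)) = (\<Sum>\<^sub>\<infinity>j. of_real \<alpha> * (\<integral>\<xi>. g j \<xi> \<partial>lborel))"
        by (intro infsum_cong) (simp add: c_def gint mult_ac)
      also have "\<dots> = of_real \<alpha> * (\<integral>\<xi>. I \<xi> *\<^sub>R (F \<xi> * S \<xi>) \<partial>lborel)"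
        unfolding infsum_cmult_right' integral_infsum(2)[OF sf gi gs1 gs2, symmetric] gS ..
      finally have s: "(\<Sum>\<^sub>\<infinity>j. c j * complex_of_real (M j)) = \<alpha> *\<^sub>R (\<integral>\<xi>. I \<xi> *\<^sub>R (F \<xi> * S \<xi>) \<partial>lborel)"
        by (simp add: scaleR_conv_of_real)
      have fe: "fh \<xi> * cis (x \<bullet> \<xi>) = F \<xi> * p \<xi>" for \<xi> by (simp add: fhF[of \<xi>] p_def mult.assoc)
      have np: "norm (p \<xi>) = 1 / (1 + (norm \<xi>)\<^sup>2) ^ m" for \<xi> unfolding p_def by (rule norm_bessel_wave)
      have [measurable]: "p \<in> borel_measurable borel" unfolding p_def by measurable
      have Fp: "integrable lborel (\<lambda>\<xi>. F \<xi> * p \<xi>)"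
      proof (rule Bochner_Integration.integrable_bound[OF Fi])
        have "norm (p \<xi>) \<le> 1" for \<xi> unfolding np by (simp add: divide_le_eq_1 bpos one_le_power)
        then show "AE \<xi> in lborel. norm (F \<xi> * p \<xi>) \<le> norm (F \<xi>)" by (simp add: norm_mult mult_left_le)
      qed measurable
      have pt: "norm (F \<xi> * p \<xi> - I \<xi> *\<^sub>R (F \<xi> * S \<xi>)) \<le> norm (F \<xi>) * ((T + 1) * h ^ (2 * m))" for \<xi>
      proof (cases "h *\<^sub>R \<xi> \<in> cube")
        case True
        then have "norm (S \<xi> - p \<xi>) \<le> T * h ^ (2 * m)"
          unfolding S p_def T_def using cube_subset_ccube by (intro aliasing_error[OF m h]) auto
        also have "\<dots> \<le> (T + 1) * h ^ (2 * m)" using h by (intro mult_right_mono) auto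
        finally have "norm (S \<xi> - p \<xi>) \<le> (T + 1) * h ^ (2 * m)" .
        moreover have "F \<xi> * p \<xi> - I \<xi> *\<^sub>R (F \<xi> * S \<xi>) = - (F \<xi> * (S \<xi> - p \<xi>))" using True by (simp add: I01 algebra_simps)
        ultimately show ?thesis by (simp add: norm_mult mult_left_mono)
      next
        case False
        \<comment> \<open>Outside the cube \<open>h * norm \<xi>\<close> is at least 1, so the
          weight of the frequency is at most \<open>h ^ (2 * m)\<close>.\<close>
        then obtain i where i: "\<not> (- pi \<le> h * \<xi> $ i \<and> h * \<xi> $ i < pi)" by (auto simp: cube_def)
        then have "\<bar>h * \<xi> $ i\<bar> \<ge> 1" using pi_ge_two by linarith
        also have "\<bar>h * \<xi> $ i\<bar> \<le> h * norm \<xi>" using h component_le_norm_cart[of \<xi> i] by (simp add: abs_mult)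
        finally have "1 \<le> (h * norm \<xi>)\<^sup>2" by simp
        also have "\<dots> \<le> h\<^sup>2 * (1 + (norm \<xi>)\<^sup>2)" by (simp add: power_mult_distrib distrib_left)
        finally have "1 \<le> (h\<^sup>2 * (1 + (norm \<xi>)\<^sup>2)) ^ m" by (rule one_le_power)
        then have "1 \<le> h ^ (2 * m) * (1 + (norm \<xi>)\<^sup>2) ^ m" by (simp add: power_mult_distrib power_mult)
        then have "norm (p \<xi>) \<le> h ^ (2 * m)" unfolding np using bpos[of \<xi>] by (simp add: pos_divide_le_eq)
        also have "\<dots> \<le> (T + 1) * h ^ (2 * m)" using T h by (simp add: mult_le_cancel_right1)
        finally show ?thesis using False by (simp add: I01 norm_mult mult_left_mono)
      qed
      have "\<alpha> *\<^sub>R (\<integral>\<xi>. fh \<xi> * cis (x \<bullet> \<xi>) \<partial>lborel) - (\<Sum>\<^sub>\<infinity>j. c j * complex_of_real (M j))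
          = \<alpha> *\<^sub>R (\<integral>\<xi>. F \<xi> * p \<xi> - I \<xi> *\<^sub>R (F \<xi> * S \<xi>) \<partial>lborel)"
        unfolding s fe Bochner_Integration.integral_diff[OF Fp IFS] by (simp add: scaleR_diff_right)
      also have "norm \<dots> = \<alpha> * norm (\<integral>\<xi>. F \<xi> * p \<xi> - I \<xi> *\<^sub>R (F \<xi> * S \<xi>) \<partial>lborel)" using \<alpha> by simp
      also have "\<dots> \<le> \<alpha> * (\<integral>\<xi>. norm (F \<xi>) * ((T + 1) * h ^ (2 * m)) \<partial>lborel)"
      proof (intro mult_left_mono)
        have "(\<integral>\<xi>. norm (F \<xi> * p \<xi> - I \<xi> *\<^sub>R (F \<xi> * S \<xi>)) \<partial>lborel) \<le> (\<integral>\<xi>. norm (F \<xi>) * ((T + 1) * h ^ (2 * m)) \<partial>lborel)"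
          by (intro integral_mono integrable_norm Bochner_Integration.integrable_diff Fp IFS integrable_mult_left Fi pt)
        then show "norm (\<integral>\<xi>. F \<xi> * p \<xi> - I \<xi> *\<^sub>R (F \<xi> * S \<xi>) \<partial>lborel) \<le> (\<integral>\<xi>. norm (F \<xi>) * ((T + 1) * h ^ (2 * m)) \<partial>lborel)"
          by (rule order_trans[OF integral_norm_bound])
      qed (use \<alpha> in simp)
      also have "\<dots> = A * h ^ (2 * m)" by (simp add: A_def)
      finally show ?thesis by (simp add: M_def)
    qed
    ultimately show ?thesis by blast
  qed
  then show ?thesis using A unfolding \<alpha>_def by blast
qed

text \<open>
  The coefficients are multiplied by samples of a wide tent function \<open>\<psi>\<close>. As \<open>\<psi>\<close> varies slowly and the
  kernel is localised, this changes \<open>s\<close> into nearly \<open>\<psi> s\<close>, while \<open>\<psi> f0\<close> is nearly \<open>f0\<close>.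
\<close>

lemma lattice_cutoff:
  fixes f0 :: "real^'n \<Rightarrow> complex"
  assumes m: "real m > real CARD('n) / 2" and h: "h > 0"
    and van: "\<And>\<epsilon>. \<epsilon> > 0 \<Longrightarrow> \<exists>R>0. \<forall>x. norm x \<ge> R \<longrightarrow> norm (f0 x) \<le> \<epsilon>"
    and bd: "\<And>x. norm (f0 x) \<le> Mf"
    and c: "bounded (range c)" and \<delta>: "\<delta> \<ge> 0" and e: "\<epsilon> > 0"
  shows "\<exists>J r. finite J \<and> (\<forall>x. norm (f0 x - (\<Sum>\<^sub>\<infinity>j. c j * complex_of_real (matern m (x - h *\<^sub>R lattice_point j)))) \<le> \<delta>
     \<longrightarrow> norm (f0 x - (\<Sum>j\<in>J. (of_real (r j) * c j) * complex_of_real (matern m (x - h *\<^sub>R lattice_point j)))) \<le> \<delta> + \<epsilon>)"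
proof -
  obtain R0 where R0: "R0 > 0" "\<And>x. norm x \<ge> R0 \<Longrightarrow> norm (f0 x) \<le> \<epsilon> / 2" using van[of "\<epsilon> / 2"] e by auto
  \<comment> \<open>The decay of the kernel is taken with one power more than the lattice sum: the
    extra power absorbs the distance from \<open>x\<close> to the lattice point that the Lipschitz
    bound for \<open>\<psi>\<close> produces.\<close>
  obtain Bc where Bc: "Bc > 0" "\<And>j. norm (c j) \<le> Bc" using c unfolding bounded_pos by auto
  obtain C where C: "C > 0" "\<And>y::real^'n. matern m y \<le> C / (1 + (norm y)\<^sup>2) ^ Suc m" using matern_decay[OF m, of "Suc m"] by blast
  obtain S where S: "\<And>y::real^'n. (\<lambda>j. 1 / (1 + (norm (y - h *\<^sub>R lattice_point j))\<^sup>2) ^ m) summable_on UNIV"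
    "\<And>y::real^'n. (\<Sum>\<^sub>\<infinity>j. 1 / (1 + (norm (y - h *\<^sub>R lattice_point j))\<^sup>2) ^ m) \<le> S"
    using lattice_sum_bound[OF m h] by blast
  have Mf: "Mf \<ge> 0" using order_trans[OF norm_ge_zero bd[of 0]] .
  \<comment> \<open>Large enough for two errors to be at most \<open>\<epsilon> / 2\<close>: moving
    \<open>\<psi>\<close> across the sum costs at most \<open>Bc * C * S / R\<close>, and where
    \<open>norm x < R0\<close> the loss \<open>1 - \<psi> x\<close> is at most
    \<open>R0 / R\<close>.\<close>
  define R where "R = max R0 (max (2 * (Bc * C * S) / \<epsilon>) (2 * (Mf * R0) / \<epsilon>))"
  have R: "R > 0" "R \<ge> R0" using R0 by (auto simp: R_def)
  have Ra: "Bc * C * S / R \<le> \<epsilon> / 2"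
  proof -
    have "2 * (Bc * C * S) / \<epsilon> \<le> R" by (simp add: R_def)
    then show ?thesis using e R by (simp add: field_simps)
  qed
  have Rb: "Mf * R0 / R \<le> \<epsilon> / 2"
  proof -
    have "2 * (Mf * R0) / \<epsilon> \<le> R" by (simp add: R_def)
    then show ?thesis using e R by (simp add: field_simps)
  qed
  define \<psi> where "\<psi> x = max 0 (1 - norm x / R)" for x :: "real^'n"
  have \<psi>01: "0 \<le> \<psi> x" "\<psi> x \<le> 1" for x using R by (auto simp: \<psi>_def)
  have \<psi>L: "\<bar>\<psi> x - \<psi> y\<bar> \<le> norm (x - y) / R" for x y
  proof -
    have "\<bar>\<psi> x - \<psi> y\<bar> \<le> \<bar>norm x / R - norm y / R\<bar>" unfolding \<psi>_def by (auto simp: max_def)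
    also have "\<dots> = \<bar>norm x - norm y\<bar> / R" using R by (simp add: diff_divide_distrib[symmetric])
    also have "\<dots> \<le> norm (x - y) / R" using R norm_triangle_ineq3[of x y] by (intro divide_right_mono) auto
    finally show ?thesis .
  qed
  define J where "J = {j::int^'n. norm (h *\<^sub>R lattice_point j :: real^'n) < R}"
  have "finite J"
  proof (rule finite_subset)
    define L where "L = \<lceil>R / h\<rceil>"
    show "J \<subseteq> vec_lambda ` (PiE UNIV (\<lambda>_. {-L..L}))"
    proof
      fix j assume "j \<in> J"
      have "\<bar>j $ i\<bar> \<le> L" for i
      proof -
        have "h * \<bar>real_of_int (j $ i)\<bar> \<le> h * norm (lattice_point j :: real^'n)"
          using h component_le_norm_cart[of "lattice_point j :: real^'n" i] by (intro mult_left_mono) auto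
        also have "\<dots> < R" using \<open>j \<in> J\<close> h by (simp add: J_def)
        finally have "\<bar>real_of_int (j $ i)\<bar> < R / h" using h by (simp add: pos_less_divide_eq mult.commute)
        then show ?thesis unfolding L_def by linarith
      qed
      then have "vec_nth j \<in> PiE UNIV (\<lambda>_. {-L..L})" by (auto simp: abs_le_iff minus_le_iff)
      then show "j \<in> vec_lambda ` (PiE UNIV (\<lambda>_. {-L..L}))" by (metis imageI vec_nth_inverse)
    qed
    show "finite (vec_lambda ` (PiE (UNIV::'n set) (\<lambda>_. {-L..L})))" by (intro finite_imageI finite_PiE) auto
  qed
  have \<psi>J: "\<psi> (h *\<^sub>R lattice_point j) = 0" if "j \<notin> J" for j
    using that R h by (simp add: J_def \<psi>_def)
  define r where "r j = \<psi> (h *\<^sub>R lattice_point j)" for j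
  \<comment> \<open>\<open>J\<close> and \<open>r\<close> are fixed before \<open>x\<close>, and
    closeness is used at this \<open>x\<close> only; so the result also applies when closeness holds
    merely almost everywhere.\<close>
  have "norm (f0 x - (\<Sum>j\<in>J. (of_real (r j) * c j) * complex_of_real (matern m (x - h *\<^sub>R lattice_point j)))) \<le> \<delta> + \<epsilon>"
    if hyp: "norm (f0 x - (\<Sum>\<^sub>\<infinity>j. c j * complex_of_real (matern m (x - h *\<^sub>R lattice_point j)))) \<le> \<delta>" for x
  proof -
    define M where "M j = matern m (x - h *\<^sub>R lattice_point j)" for j
    have M0: "M j \<ge> 0" for j unfolding M_def by (rule matern_nonneg[OF m])
    define s where "s = (\<Sum>\<^sub>\<infinity>j. c j * complex_of_real (M j))"
    define s' where "s' = (\<Sum>j\<in>J. (of_real (r j) * c j) * complex_of_real (M j))"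
    \<comment> \<open>The commutator of cutoff and summation: the \<open>d j\<close> add up to
      \<open>\<psi> x * s - s'\<close>.\<close>
    define d where "d j = of_real (\<psi> x - r j) * (c j * complex_of_real (M j))" for j
    have dle: "norm (d j) \<le> Bc * C / R * (1 / (1 + (norm (x - h *\<^sub>R lattice_point j))\<^sup>2) ^ m)" for j
    proof -
      define n where "n = norm (x - h *\<^sub>R lattice_point j)"
      have n: "n \<ge> 0" by (simp add: n_def)
      have b: "1 + n\<^sup>2 > 0" by (intro add_pos_nonneg) auto
      have "n \<le> 1 + n\<^sup>2" using sum_squares_bound[of n 1] zero_le_power2[of "n"] n by (simp add: power2_eq_square)
      then have "n * M j \<le> (1 + n\<^sup>2) * (C / (1 + n\<^sup>2) ^ Suc m)"
        using C M0 n unfolding M_def n_def by (intro mult_mono) auto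
      also have "\<dots> = C / (1 + n\<^sup>2) ^ m"
      proof -
        have "q * (C / q ^ Suc m) = C / q ^ m" if "q > 0" for q :: real using that by simp
        then show ?thesis using b .
      qed
      finally have nM: "n * M j \<le> C / (1 + n\<^sup>2) ^ m" .
      have "norm (d j) = \<bar>\<psi> x - r j\<bar> * (norm (c j) * M j)" using M0[of j] by (simp add: d_def norm_mult flip: of_real_diff)
      also have "\<dots> \<le> n / R * (Bc * M j)"
        unfolding r_def n_def using Bc(1) Bc(2)[of j] M0[of j] R by (intro mult_mono \<psi>L) auto
      also have "\<dots> = Bc / R * (n * M j)" by simp
      also have "\<dots> \<le> Bc / R * (C / (1 + n\<^sup>2) ^ m)" using Bc R nM by (intro mult_left_mono) auto
      finally show ?thesis by (simp add: n_def)
    qed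
    have Ds: "(\<lambda>j. Bc * C / R * (1 / (1 + (norm (x - h *\<^sub>R lattice_point j))\<^sup>2) ^ m)) summable_on UNIV"
      by (rule summable_on_cmult_right[OF S(1)])
    have dn: "(\<lambda>j. norm (d j)) summable_on UNIV"
      by (rule summable_on_comparison_test[OF Ds dle]) auto
    have "norm (infsum d UNIV) \<le> Bc * C / R * (\<Sum>\<^sub>\<infinity>j. 1 / (1 + (norm (x - h *\<^sub>R lattice_point j))\<^sup>2) ^ m)"
      using order_trans[OF norm_infsum_bound[OF dn] infsum_mono[OF dn Ds dle]] unfolding infsum_cmult_right' .
    also have "\<dots> \<le> Bc * C / R * S" using Bc C R by (intro mult_left_mono S(2)) auto
    also have "\<dots> \<le> \<epsilon> / 2" using Ra by simp
    finally have d: "norm (infsum d UNIV) \<le> \<epsilon> / 2" .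
    have "((\<lambda>j. of_real (r j) * c j * complex_of_real (M j)) has_sum s') UNIV"
      unfolding s'_def by (rule has_sum_finite_neutralI[OF \<open>finite J\<close>]) (auto simp: r_def \<psi>J)
    moreover have "(d has_sum infsum d UNIV) UNIV" by (rule has_sum_infsum[OF abs_summable_summable[OF dn]])
    ultimately have "((\<lambda>j. of_real (r j) * c j * complex_of_real (M j) + d j) has_sum (s' + infsum d UNIV)) UNIV"
      by (rule has_sum_add)
    moreover have "of_real (r j) * c j * complex_of_real (M j) + d j = of_real (\<psi> x) * (c j * complex_of_real (M j))" for j
      by (simp add: d_def algebra_simps)
    ultimately have "s' + infsum d UNIV = of_real (\<psi> x) * s"
      unfolding s_def infsum_cmult_right'[symmetric] by (simp add: infsumI)
    then have s': "s' = of_real (\<psi> x) * s - infsum d UNIV" by (simp add: algebra_simps)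
    have tail: "norm (of_real (1 - \<psi> x) * f0 x) \<le> \<epsilon> / 2"
    proof (cases "norm x \<ge> R0")
      case True
      have "norm (of_real (1 - \<psi> x) * f0 x) \<le> 1 * norm (f0 x)"
        unfolding norm_mult norm_of_real using \<psi>01[of x] by (intro mult_right_mono) auto
      then show ?thesis using R0(2)[OF True] by simp
    next
      case False
      have "1 - \<psi> x \<le> R0 / R"
      proof -
        have "1 - \<psi> x \<le> norm x / R" by (simp add: \<psi>_def)
        also have "\<dots> \<le> R0 / R" using False R by (intro divide_right_mono) auto
        finally show ?thesis .
      qed
      then have "norm (of_real (1 - \<psi> x) * f0 x) \<le> R0 / R * Mf"
        unfolding norm_mult norm_of_real using \<psi>01[of x] bd[of x] R R0 by (intro mult_mono) auto
      also have "R0 / R * Mf = Mf * R0 / R" by simp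
      finally show ?thesis using Rb by linarith
    qed
    \<comment> \<open>Three errors: the part of \<open>f0\<close> that the cutoff removes, the old
      error times \<open>\<psi> x \<le> 1\<close>, and the commutator.\<close>
    have "f0 x - s' = of_real (1 - \<psi> x) * f0 x + (of_real (\<psi> x) * (f0 x - s) + infsum d UNIV)"
      unfolding s' by (simp add: algebra_simps)
    also have "norm \<dots> \<le> norm (of_real (1 - \<psi> x) * f0 x) + (norm (of_real (\<psi> x) * (f0 x - s)) + norm (infsum d UNIV))"
      by (intro order_trans[OF norm_triangle_ineq] add_left_mono norm_triangle_ineq)
    also have "norm (of_real (\<psi> x) * (f0 x - s)) \<le> 1 * \<delta>"
      unfolding norm_mult norm_of_real using \<psi>01[of x] hyp[folded M_def, folded s_def] by (intro mult_mono) auto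
    finally show ?thesis using tail d unfolding s'_def M_def by linarith
  qed
  then show ?thesis using \<open>finite J\<close> by blast
qed

section \<open>Approximation order\<close>

lemma norm_cis_diff_le: "norm (cis a - cis b) \<le> \<bar>a - b\<bar>"
proof -
  have "cis a - cis b = cis b * (cis (a - b) - 1)" by (simp add: right_diff_distrib cis_mult)
  then have "norm (cis a - cis b) = norm (iexp (a - b) - 1)" by (simp add: norm_mult cis_conv_exp)
  also have "\<dots> \<le> \<bar>a - b\<bar>" using iexp_approx1[of "a - b" 0] by simp
  finally show ?thesis .
qed

text \<open>The whole space is not a null set. This extracts the sign of an essential supremum from
  a pointwise bound.\<close>

lemma AE_lebesgue_const: "(AE x in (lebesgue :: 'a::euclidean_space measure). P) \<Longrightarrow> P"
proof (rule ccontr)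
  assume "AE x in (lebesgue :: 'a measure). P" and "\<not> P"
  then have "AE x in (lborel :: 'a measure). False" by (simp add: AE_completion_iff)
  then show False by (simp add: AE_iff_null emeasure_eq_0_AE null_sets_def)
qed

text \<open>Membership in \<open>L2m1\<close> gives Lebesgue measurability only, whereas Fubini and
  the inversion formula are applied on \<open>lborel\<close>.\<close>

lemma lebesgue_measurable_complex_borel_version:
  fixes f :: "'a::euclidean_space \<Rightarrow> complex"
  assumes "f \<in> borel_measurable lebesgue"
  shows "\<exists>g \<in> borel_measurable borel. AE x in lborel. f x = g x"
proof -
  have "(\<lambda>x. Re (f x)) \<in> borel_measurable lebesgue" "(\<lambda>x. Im (f x)) \<in> borel_measurable lebesgue"
    using assms by (auto intro: borel_measurable_Re borel_measurable_Im)
  from this[THEN completion_ex_borel_measurable_real] obtain u v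
    where [measurable]: "u \<in> borel_measurable lborel" "v \<in> borel_measurable lborel"
      and ae: "AE x in lborel. Re (f x) = u x" "AE x in lborel. Im (f x) = v x" by blast
  show ?thesis
  proof (rule bexI[of _ "\<lambda>x. complex_of_real (u x) + \<i> * complex_of_real (v x)"])
    show "AE x in lborel. f x = complex_of_real (u x) + \<i> * complex_of_real (v x)"
      using ae by eventually_elim (simp add: complex_eq_iff)
    have [measurable]: "u \<in> borel_measurable borel" "v \<in> borel_measurable borel"
      using \<open>u \<in> borel_measurable lborel\<close> \<open>v \<in> borel_measurable lborel\<close> by simp_all
    show "(\<lambda>x. complex_of_real (u x) + \<i> * complex_of_real (v x)) \<in> borel_measurable borel" by measurable
  qed
qed

lemma dilate_translate:
  "h \<noteq> 0 \<Longrightarrow> dilate h \<phi> (inverse h *\<^sub>R x - lattice_point j) = \<phi> (x - h *\<^sub>R lattice_point j)"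
  by (simp add: dilate_def scaleR_diff_right)

lemma shift_space0_subset:
  assumes "0 \<in> K"
  shows "shift_space0 K h \<phi> \<subseteq> shift_space K h \<phi>"
proof
  fix s assume "s \<in> shift_space0 K h \<phi>"
  then obtain J c where J: "finite J" "c ` J \<subseteq> K"
    and s: "s = (\<lambda>x. \<Sum>j\<in>J. c j * complex_of_real (\<phi> (inverse h *\<^sub>R x - lattice_point j)))"
    unfolding shift_space0_def by blast
  define c' where "c' j = (if j \<in> J then c j else 0)" for j
  have "s = (\<lambda>x. \<Sum>\<^sub>\<infinity>j\<in>UNIV. c' j * complex_of_real (\<phi> (inverse h *\<^sub>R x - lattice_point j)))"
  proof
    fix x
    have "((\<lambda>j. c' j * complex_of_real (\<phi> (inverse h *\<^sub>R x - lattice_point j))) has_sum s x) UNIV"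
      unfolding s by (rule has_sum_finite_neutralI[OF J(1)]) (auto simp: c'_def)
    then show "s x = (\<Sum>\<^sub>\<infinity>j\<in>UNIV. c' j * complex_of_real (\<phi> (inverse h *\<^sub>R x - lattice_point j)))"
      by (rule infsumI[symmetric])
  qed
  moreover have "range c' \<subseteq> K" using J(2) assms by (auto simp: c'_def)
  moreover have "bounded (range c')"
  proof (rule finite_imp_bounded)
    have "range c' \<subseteq> insert 0 (c ` J)" by (auto simp: c'_def)
    then show "finite (range c')" by (rule finite_subset) (simp add: J(1))
  qed
  ultimately show "s \<in> shift_space K h \<phi>" unfolding shift_space_def by blast
qed

text \<open>The inversion integral defines a continuous representative \<open>f0\<close> of
  \<open>f\<close>. The weight is at least 1, which bounds \<open>f0\<close>, and since
  \<open>m > 0\<close> it also dominates \<open>norm \<xi>\<close>, which bounds the differences of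
  \<open>f0\<close>.\<close>

lemma L2m1_Fourier_representation:
  fixes f :: "real^'n \<Rightarrow> complex"
  assumes m0: "m > 0" and f: "f \<in> L2m1 m"
  obtains f0 M L where
    "f0 = (\<lambda>x. (1 / (2 * pi) ^ CARD('n)) *\<^sub>R (\<integral>\<xi>. fourier f \<xi> * cis (x \<bullet> \<xi>) \<partial>lborel))"
    "fourier f \<in> borel_measurable borel"
    "integrable lborel (\<lambda>\<xi>. of_real ((1 + (norm \<xi>)\<^sup>2) ^ m) * fourier f \<xi>)"
    "AE x in lebesgue. f x = f0 x" "integrable lborel f0"
    "\<And>x. norm (f0 x) \<le> M" "L > 0" "\<And>x y. norm (f0 x - f0 y) \<le> L * norm (x - y)"
proof -
  have fi: "integrable lebesgue f"
    and Fi: "integrable lebesgue (\<lambda>\<xi>. complex_of_real ((1 + (norm \<xi>)\<^sup>2) ^ m) * fourier f \<xi>)"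
    using f by (auto simp: L2m1_def)
  obtain g where g[measurable]: "g \<in> borel_measurable borel" and fg: "AE x in lborel. f x = g x"
    using lebesgue_measurable_complex_borel_version[OF borel_measurable_integrable[OF fi]] by blast
  have fg': "AE x in lebesgue. f x = g x" using fg by (rule AE_completion)
  have gl: "g \<in> borel_measurable lebesgue" by (rule measurable_completion) simp
  have "integrable lebesgue g" by (rule integrable_cong_AE_imp[OF fi gl]) (use fg' in \<open>auto elim: eventually_mono\<close>)
  then have gi: "integrable lborel g" by (subst (asm) integrable_completion) simp
  have ff: "fourier f \<xi> = (\<integral>y. g y * cis (- (y \<bullet> \<xi>)) \<partial>lborel)" for \<xi>
  proof -
    have cm: "(\<lambda>y. cis (- (y \<bullet> \<xi>))) \<in> borel_measurable lebesgue" by (rule measurable_completion) measurable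
    have "fourier f \<xi> = (\<integral>y. g y * cis (- (y \<bullet> \<xi>)) \<partial>lebesgue)"
      unfolding fourier_def
    proof (rule integral_cong_AE)
      show "AE x in lebesgue. f x * cis (- (x \<bullet> \<xi>)) = g x * cis (- (x \<bullet> \<xi>))"
        using fg' by eventually_elim simp
    qed (intro borel_measurable_times cm gl borel_measurable_integrable[OF fi])+
    also have "\<dots> = (\<integral>y. g y * cis (- (y \<bullet> \<xi>)) \<partial>lborel)" by (rule integral_completion) measurable
    finally show ?thesis .
  qed
  have fm[measurable]: "fourier f \<in> borel_measurable borel" unfolding ff[abs_def] by measurable
  define F where "F \<xi> = complex_of_real ((1 + (norm \<xi>)\<^sup>2) ^ m) * fourier f \<xi>" for \<xi>
  have [measurable]: "F \<in> borel_measurable borel" unfolding F_def by measurable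
  have Fi: "integrable lborel F"
    using Fi unfolding F_def[symmetric, abs_def] by (subst (asm) integrable_completion) auto
  have nF: "norm (F \<xi>) = (1 + (norm \<xi>)\<^sup>2) ^ m * norm (fourier f \<xi>)" for \<xi>
    unfolding F_def norm_mult norm_of_real by (simp add: abs_of_nonneg)
  have F1: "norm (fourier f \<xi>) \<le> norm (F \<xi>)" for \<xi>
    unfolding nF by (simp add: mult_le_cancel_right1 one_le_power)
  have F2: "norm \<xi> * norm (fourier f \<xi>) \<le> norm (F \<xi>)" for \<xi>
  proof -
    have "2 * norm \<xi> \<le> (norm \<xi>)\<^sup>2 + 1" using sum_squares_bound[of "norm \<xi>" 1] by simp
    then have "norm \<xi> \<le> 1 + (norm \<xi>)\<^sup>2" using norm_ge_zero[of \<xi>] by linarith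
    also have "\<dots> \<le> (1 + (norm \<xi>)\<^sup>2) ^ m" using m0 power_increasing[of 1 m "1 + (norm \<xi>)\<^sup>2"] by simp
    finally show ?thesis unfolding nF by (intro mult_right_mono) auto
  qed
  have fhi: "integrable lborel (fourier f)"
    by (rule Bochner_Integration.integrable_bound[OF Fi]) (use F1 in auto)
  define \<alpha> where "\<alpha> = 1 / (2 * pi) ^ CARD('n)"
  have \<alpha>: "\<alpha> > 0" by (simp add: \<alpha>_def)
  define f0 where "f0 x = \<alpha> *\<^sub>R (\<integral>\<xi>. fourier f \<xi> * cis (x \<bullet> \<xi>) \<partial>lborel)" for x
  have "AE x in lborel. g x = f0 x"
    using fourier_inversion[OF gi] fhi unfolding ff[symmetric] f0_def \<alpha>_def by simp
  then have gf0: "AE x in lebesgue. g x = f0 x" "AE x in lborel. g x = f0 x" by (auto intro: AE_completion)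
  have ff0: "AE x in lebesgue. f x = f0 x" using fg' gf0(1) by eventually_elim simp
  have f0m: "f0 \<in> borel_measurable borel" unfolding f0_def by measurable
  have f0i: "integrable lborel f0"
    by (rule integrable_cong_AE_imp[OF gi]) (use f0m gf0(2) in \<open>auto elim: eventually_mono\<close>)
  define I where "I = (\<integral>\<xi>. norm (F \<xi>) \<partial>lborel)"
  have I0: "I \<ge> 0" unfolding I_def by (intro integral_nonneg_AE) auto
  have ei: "integrable lborel (\<lambda>\<xi>. fourier f \<xi> * cis (x \<bullet> \<xi>))" for x
    by (rule Bochner_Integration.integrable_bound[OF fhi]) (auto simp: norm_mult)
  have bd: "norm (f0 x) \<le> \<alpha> * I" for x
  proof -
    have "(\<integral>\<xi>. norm (fourier f \<xi> * cis (x \<bullet> \<xi>)) \<partial>lborel) \<le> I"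
      unfolding I_def by (intro integral_mono integrable_norm ei Fi) (use F1 in \<open>simp add: norm_mult\<close>)
    from order_trans[OF integral_norm_bound this] show ?thesis unfolding f0_def using \<alpha> by simp
  qed
  \<comment> \<open>Adding 1 makes the Lipschitz constant positive even if
    \<open>I = 0\<close>.\<close>
  have lip: "norm (f0 x - f0 y) \<le> (\<alpha> * I + 1) * norm (x - y)" for x y
  proof -
    have eq: "f0 x - f0 y = \<alpha> *\<^sub>R (\<integral>\<xi>. fourier f \<xi> * cis (x \<bullet> \<xi>) - fourier f \<xi> * cis (y \<bullet> \<xi>) \<partial>lborel)"
      unfolding f0_def by (simp add: ei scaleR_diff_right)
    have "(\<integral>\<xi>. norm (fourier f \<xi> * cis (x \<bullet> \<xi>) - fourier f \<xi> * cis (y \<bullet> \<xi>)) \<partial>lborel) \<le> (\<integral>\<xi>. norm (F \<xi>) * norm (x - y) \<partial>lborel)"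
    proof (intro integral_mono integrable_norm Bochner_Integration.integrable_diff ei integrable_mult_left Fi)
      fix \<xi> :: "real^'n"
      have "norm (fourier f \<xi> * cis (x \<bullet> \<xi>) - fourier f \<xi> * cis (y \<bullet> \<xi>)) = norm (fourier f \<xi>) * norm (cis (x \<bullet> \<xi>) - cis (y \<bullet> \<xi>))"
        by (simp add: norm_mult flip: right_diff_distrib)
      also have "\<dots> \<le> norm (fourier f \<xi>) * (norm \<xi> * norm (x - y))"
      proof (intro mult_left_mono)
        have "norm (cis (x \<bullet> \<xi>) - cis (y \<bullet> \<xi>)) \<le> \<bar>(x - y) \<bullet> \<xi>\<bar>"
          using norm_cis_diff_le[of "x \<bullet> \<xi>" "y \<bullet> \<xi>"] by (simp add: inner_diff_left)
        also have "\<dots> \<le> norm \<xi> * norm (x - y)" using Cauchy_Schwarz_ineq2[of "x - y" \<xi>] by (simp add: mult.commute)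
        finally show "norm (cis (x \<bullet> \<xi>) - cis (y \<bullet> \<xi>)) \<le> norm \<xi> * norm (x - y)" .
      qed simp
      also have "\<dots> = (norm \<xi> * norm (fourier f \<xi>)) * norm (x - y)" by simp
      also have "\<dots> \<le> norm (F \<xi>) * norm (x - y)" by (intro mult_right_mono F2) simp
      finally show "norm (fourier f \<xi> * cis (x \<bullet> \<xi>) - fourier f \<xi> * cis (y \<bullet> \<xi>)) \<le> norm (F \<xi>) * norm (x - y)" .
    qed
    then have "norm (\<integral>\<xi>. fourier f \<xi> * cis (x \<bullet> \<xi>) - fourier f \<xi> * cis (y \<bullet> \<xi>) \<partial>lborel) \<le> I * norm (x - y)"
      unfolding integral_mult_left_zero I_def[symmetric] by (rule order_trans[OF integral_norm_bound])
    then have "norm (f0 x - f0 y) \<le> \<alpha> * (I * norm (x - y))" unfolding eq using \<alpha> by simp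
    then show ?thesis by (simp add: distrib_right add_increasing2)
  qed
  show ?thesis
    by (rule that[OF _ fm _ ff0 f0i bd _ lip])
       (use Fi \<alpha> I0 in \<open>auto simp: f0_def \<alpha>_def F_def[abs_def] add_nonneg_pos\<close>)
qed

theorem theorem4p2:
  fixes m :: nat and f :: "real ^ 'n \<Rightarrow> complex"
  assumes "m > 0"
    and "real m > real CARD('n) / 2"
    and "f \<in> L2m1 m"
  shows "\<exists>C::real. C > 0 \<and>
    (\<forall>(K::complex set) (h::real).
      (K = UNIV \<or> (K = \<real> \<and> range f \<subseteq> \<real>)) \<longrightarrow> 0 < h \<longrightarrow> h \<le> 1 \<longrightarrow>
        Linf_dist f (shift_space0 K h (dilate h (matern m))) =
          Linf_dist f (shift_space K h (dilate h (matern m))) \<and>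
        Linf_dist f (shift_space K h (dilate h (matern m))) \<le> ereal (C * h ^ (2 * m)))"
proof -
  note m = assms(2)
  obtain f0 M L where f0: "f0 = (\<lambda>x. (1 / (2 * pi) ^ CARD('n)) *\<^sub>R (\<integral>\<xi>. fourier f \<xi> * cis (x \<bullet> \<xi>) \<partial>lborel))"
    and fm: "fourier f \<in> borel_measurable borel"
    and Fi: "integrable lborel (\<lambda>\<xi>. of_real ((1 + (norm \<xi>)\<^sup>2) ^ m) * fourier f \<xi>)"
    and ae: "AE x in lebesgue. f x = f0 x" and f0i: "integrable lborel f0"
    and bd: "\<And>x. norm (f0 x) \<le> M" and L: "L > 0" "\<And>x y. norm (f0 x - f0 y) \<le> L * norm (x - y)"
    by (rule L2m1_Fourier_representation[OF assms(1,3)]) (rule that)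
  have fl: "f \<in> borel_measurable lebesgue" using assms(3) by (auto simp: L2m1_def)
  note van = lipschitz_integrable_vanishes[OF L f0i]
  obtain A where A: "A \<ge> 0" and approx: "\<And>h. h > 0 \<Longrightarrow> \<exists>c. bounded (range c) \<and>
    (\<forall>x. norm (f0 x - (\<Sum>\<^sub>\<infinity>j. c j * complex_of_real (matern m (x - h *\<^sub>R lattice_point j)))) \<le> A * h ^ (2 * m))"
    using bounded_coefficients_approximation[OF assms(1) m fm Fi] unfolding f0 by blast
  have main: "Linf_dist f (shift_space0 K h (dilate h (matern m))) = Linf_dist f (shift_space K h (dilate h (matern m))) \<and>
        Linf_dist f (shift_space K h (dilate h (matern m))) \<le> ereal (A * h ^ (2 * m))"
    if K: "K = UNIV \<or> (K = \<real> \<and> range f \<subseteq> \<real>)" and h: "h > 0" for K h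
  proof -
    let ?V = "shift_space0 K h (dilate h (matern m)) :: (real^'n \<Rightarrow> complex) set"
      and ?W = "shift_space K h (dilate h (matern m)) :: (real^'n \<Rightarrow> complex) set"
    have dil: "dilate h (matern m) (inverse h *\<^sub>R x - lattice_point j) = matern m (x - h *\<^sub>R lattice_point j)" for x and j :: "int^'n"
      using h by (intro dilate_translate) simp
    \<comment> \<open>Both claims go through this: applied to an arbitrary element of
      \<open>?W\<close> it gives the equality of the distances, applied to the constructed
      approximant it gives the rate.\<close>
    have fin: "Linf_dist f ?V \<le> ereal \<delta>"
      if cK: "range c \<subseteq> K" and cb: "bounded (range c)" and \<delta>: "\<delta> \<ge> 0"
        and close: "AE x in lebesgue. norm (f x - (\<Sum>\<^sub>\<infinity>j. c j * complex_of_real (matern m (x - h *\<^sub>R lattice_point j)))) \<le> \<delta>"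
      for c \<delta>
    proof (rule ereal_le_epsilon2)
      fix \<epsilon> :: real assume e: "\<epsilon> > 0"
      obtain J r where J: "finite J" and cut: "\<And>x. norm (f0 x - (\<Sum>\<^sub>\<infinity>j. c j * complex_of_real (matern m (x - h *\<^sub>R lattice_point j)))) \<le> \<delta>
          \<Longrightarrow> norm (f0 x - (\<Sum>j\<in>J. (of_real (r j) * c j) * complex_of_real (matern m (x - h *\<^sub>R lattice_point j)))) \<le> \<delta> + \<epsilon>"
        using lattice_cutoff[OF m h van bd cb \<delta> e] by blast
      define s where "s x = (\<Sum>j\<in>J. (of_real (r j) * c j) * complex_of_real (matern m (x - h *\<^sub>R lattice_point j)))" for x
      \<comment> \<open>The cutoff factors are real, so the coefficients remain in \<open>K\<close>
        in the real case as well.\<close>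
      have "of_real (r j) * c j \<in> K" for j
        using K cK by (auto intro!: Reals_mult)
      then have "s \<in> ?V"
        unfolding shift_space0_def s_def mem_Collect_eq dil
        by (intro exI[of _ J] exI[of _ "\<lambda>j. of_real (r j) * c j"]) (use J in auto)
      note matern_measurable[OF m, measurable]
      have "s \<in> borel_measurable borel" unfolding s_def by measurable
      then have "s \<in> borel_measurable lebesgue" by (intro measurable_completion) simp
      then have meas: "(\<lambda>x. ereal (norm (f x - s x))) \<in> borel_measurable lebesgue"
        by (intro borel_measurable_ereal measurable_compose[OF borel_measurable_diff[OF fl] borel_measurable_norm])
      have "AE x in lebesgue. ereal (norm (f x - s x)) \<le> ereal (\<delta> + \<epsilon>)"
        using close ae by eventually_elim (use cut in \<open>simp add: s_def\<close>)
      then have "Linf_norm (\<lambda>x. f x - s x) \<le> ereal (\<delta> + \<epsilon>)"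
        unfolding Linf_norm_def by (rule esssup_I[OF meas])
      then show "Linf_dist f ?V \<le> ereal \<delta> + ereal \<epsilon>"
        unfolding Linf_dist_def using \<open>s \<in> ?V\<close> by (intro INF_lower2[of s]) auto
    qed
    have "0 \<in> K" using K by (elim disjE conjE) simp_all
    then have le1: "Linf_dist f ?W \<le> Linf_dist f ?V"
      unfolding Linf_dist_def by (rule INF_superset_mono[OF shift_space0_subset order_refl])
    \<comment> \<open>If the norm is infinite (for instance because \<open>f - s\<close> is not measurable) there is nothing to show.\<close>
    have le2: "Linf_dist f ?V \<le> Linf_dist f ?W"
      unfolding Linf_dist_def[of f ?W]
    proof (rule INF_greatest)
      fix s assume "s \<in> ?W"
      then obtain c where cK: "range c \<subseteq> K" and cb: "bounded (range c)"
        and s: "s = (\<lambda>x. \<Sum>\<^sub>\<infinity>j. c j * complex_of_real (matern m (x - h *\<^sub>R lattice_point j)))"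
        unfolding shift_space_def dil mem_Collect_eq by (elim exE conjE) (rule that)
      have le: "AE x in lebesgue. ereal (norm (f x - s x)) \<le> Linf_norm (\<lambda>x. f x - s x)"
        unfolding Linf_norm_def by (rule esssup_AE)
      then have "AE x in (lebesgue :: (real^'n) measure). 0 \<le> Linf_norm (\<lambda>x. f x - s x)"
        by eventually_elim (meson ereal_less_eq(5) norm_ge_zero order_trans)
      then have nn: "0 \<le> Linf_norm (\<lambda>x. f x - s x)" by (rule AE_lebesgue_const)
      show "Linf_dist f ?V \<le> Linf_norm (\<lambda>x. f x - s x)"
      proof (cases "Linf_norm (\<lambda>x. f x - s x)")
        case (real \<delta>)
        then show ?thesis using fin[OF cK cb, of \<delta>] le nn by (simp add: s)
      qed (use nn in auto)
    qed
    have "Linf_dist f ?V \<le> ereal (A * h ^ (2 * m))"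
    proof -
      obtain c where cb: "bounded (range c)"
        and close: "\<And>x. norm (f0 x - (\<Sum>\<^sub>\<infinity>j. c j * complex_of_real (matern m (x - h *\<^sub>R lattice_point j)))) \<le> A * h ^ (2 * m)"
        using approx[OF h] by blast
      have A0: "A * h ^ (2 * m) \<ge> 0" using A h by simp
      show ?thesis
      proof (cases "K = UNIV")
        case True
        have "AE x in lebesgue. norm (f x - (\<Sum>\<^sub>\<infinity>j. c j * complex_of_real (matern m (x - h *\<^sub>R lattice_point j)))) \<le> A * h ^ (2 * m)"
          using ae by eventually_elim (use close in simp)
        then show ?thesis using True by (intro fin[OF _ cb A0]) auto
      next
        case False
        then have KR: "K = \<real>" and fR: "range f \<subseteq> \<real>" using K by auto
        \<comment> \<open>The kernel is real, so taking real parts of the coefficients takes the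
          real part of the sum; as \<open>f\<close> is real-valued, this does not increase the
          error.\<close>
        have "bounded (range (\<lambda>j. complex_of_real (Re (c j))))"
          using cb unfolding bounded_iff by (metis (no_types, lifting) abs_Re_le_cmod norm_of_real order_trans rangeE rangeI)
        moreover have "AE x in lebesgue. norm (f x - (\<Sum>\<^sub>\<infinity>j. complex_of_real (Re (c j)) * complex_of_real (matern m (x - h *\<^sub>R lattice_point j)))) \<le> A * h ^ (2 * m)"
          using ae
        proof eventually_elim
          case (elim x)
          let ?s = "\<Sum>\<^sub>\<infinity>j. c j * complex_of_real (matern m (x - h *\<^sub>R lattice_point j))"
          have "((\<lambda>j. complex_of_real (Re (c j * complex_of_real (matern m (x - h *\<^sub>R lattice_point j))))) has_sum complex_of_real (Re ?s)) UNIV"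
            by (intro has_sum_of_real has_sum_Re has_sum_infsum bounded_coefficients_summable m h cb)
          then have eq: "(\<Sum>\<^sub>\<infinity>j. complex_of_real (Re (c j)) * complex_of_real (matern m (x - h *\<^sub>R lattice_point j))) = complex_of_real (Re ?s)"
            by (intro infsumI) simp
          have "f x \<in> \<real>" using fR by auto
          then have "f x - complex_of_real (Re ?s) = complex_of_real (Re (f x - ?s))"
            by (simp add: complex_is_Real_iff complex_eq_iff)
          then have "norm (f x - complex_of_real (Re ?s)) = \<bar>Re (f x - ?s)\<bar>"
            by (simp only: norm_of_real)
          also have "\<dots> \<le> norm (f x - ?s)" by (rule abs_Re_le_cmod)
          also have "\<dots> \<le> A * h ^ (2 * m)" using close[of x] elim by simp
          finally show ?case unfolding eq .
        qed
        ultimately show ?thesis using KR by (intro fin[OF _ _ A0]) auto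
      qed
    qed
    then show ?thesis using le1 le2 by auto
  qed
  show ?thesis
  \<comment> \<open>\<open>A\<close> may be 0, while the constant has to be positive.\<close>
  proof (intro exI[of _ "A + 1"] conjI allI impI)
    fix K :: "complex set" and h :: real
    assume K: "K = UNIV \<or> (K = \<real> \<and> range f \<subseteq> \<real>)" and h: "0 < h" "h \<le> 1"
    show "Linf_dist f (shift_space0 K h (dilate h (matern m))) = Linf_dist f (shift_space K h (dilate h (matern m)))"
      using main[OF K h(1)] by simp
    have "A * h ^ (2 * m) \<le> (A + 1) * h ^ (2 * m)" using h by (intro mult_right_mono) auto
    then show "Linf_dist f (shift_space K h (dilate h (matern m))) \<le> ereal ((A + 1) * h ^ (2 * m))"
      using main[OF K h(1)] by (meson ereal_less_eq(3) order_trans)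
  qed (use A in simp)
qed

end
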